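(* Let $(R,\mathfrak m)$ be a one-dimensional Noetherian Cohen-Macaulay local ring possessing a canonical module $\omega_R$, with total ring of fractions $Q(R)$ and integral closure $\overline R$ of $R$ in $Q(R)$. Suppose that: (a) there is an $R$-submodule $C$ of $Q(R)$ with $R\subseteq C\subseteq\overline R$ and $C\cong\omega_R$; (b) $\overline R$ is finitely generated as an $R$-module; (c) $\overline R$ is a local ring. Suppose that $R$ is a far-flung Gorenstein ring, and let $M$ be a finitely generated reflexive $R$-module of rank $r>0$. Then $\mathrm{Hom}_R(\omega_R,M)\cong\overline R^{\,r}$.
   Context: For a finitely generated $R$-module $M$, the trace ideal is $\mathrm{tr}_R(M)=\sum_{f\in\mathrm{Hom}_R(M,R)}\mathrm{Im}\,f\subseteq R$. For fractional ideals $I,J$ (finitely generated $R$-submodules of $Q(R)$ containing a non-zerodivisor of $R$), $I:J=\{\alpha\in Q(R): \alpha J\subseteq I\}$. A ring $R$ satisfying (a) and (b) is called far-flung Gorenstein if $\mathrm{tr}_R(\omega_R)=R:\overline R$. An $R$-module $M$ is reflexive if the natural map $M\to\mathrm{Hom}_R(\mathrm{Hom}_R(M,R),R)$ is an isomorphism, and has rank $r$ if $M\otimes_R Q(R)\cong Q(R)^r$. *)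

theory Defs
  imports "HOL-Algebra.Algebra" "HOL-Library.Extended_Nat"
begin

section \<open>Modules\<close>

text \<open>
  A ring regarded as a module by multiplication. If \<open>R\<close> is a subring of \<open>S\<close>, then
  \<open>self_module S\<close> is also the \<open>R\<close>-module \<open>S\<close>: the scalars are those given as the ring argument
  of \<^const>\<open>module\<close>, \<^const>\<open>submodule\<close> and of the notions below.
\<close>

definition self_module :: "('a, 'c) ring_scheme \<Rightarrow> ('a, 'a) module" where
  "self_module S = \<lparr>carrier = carrier S, monoid.mult = (\<otimes>\<^bsub>S\<^esub>), monoid.one = \<one>\<^bsub>S\<^esub>,
     ring.zero = \<zero>\<^bsub>S\<^esub>, ring.add = (\<oplus>\<^bsub>S\<^esub>), smult = (\<otimes>\<^bsub>S\<^esub>)\<rparr>"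

definition module_span ::
    "('a, 'c) ring_scheme \<Rightarrow> ('a, 'b, 'd) module_scheme \<Rightarrow> 'b set \<Rightarrow> 'b set" where
  "module_span R M B = \<Inter>{N. submodule N R M \<and> B \<subseteq> N}"

definition fin_gen_module :: "('a, 'c) ring_scheme \<Rightarrow> ('a, 'b, 'd) module_scheme \<Rightarrow> bool" where
  "fin_gen_module R M \<longleftrightarrow> (\<exists>B. finite B \<and> B \<subseteq> carrier M \<and> module_span R M B = carrier M)"

text \<open>
  Linear maps are taken to be extensional (undefined outside the domain), so that equality of
  linear maps is equality in HOL. The record type of modules extends that of rings; the fields
  for multiplication and unit are irrelevant for a module and left undefined.
\<close>

definition lin_maps :: "('a, 'c) ring_scheme \<Rightarrow> ('a, 'm, 'd) module_scheme \<Rightarrow>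
    ('a, 'n, 'e) module_scheme \<Rightarrow> ('m \<Rightarrow> 'n) set" where
  "lin_maps R M N = {f \<in> carrier M \<rightarrow>\<^sub>E carrier N.
     (\<forall>x\<in>carrier M. \<forall>y\<in>carrier M. f (x \<oplus>\<^bsub>M\<^esub> y) = f x \<oplus>\<^bsub>N\<^esub> f y) \<and>
     (\<forall>a\<in>carrier R. \<forall>x\<in>carrier M. f (a \<odot>\<^bsub>M\<^esub> x) = a \<odot>\<^bsub>N\<^esub> f x)}"

definition module_isos :: "('a, 'c) ring_scheme \<Rightarrow> ('a, 'm, 'd) module_scheme \<Rightarrow>
    ('a, 'n, 'e) module_scheme \<Rightarrow> ('m \<Rightarrow> 'n) set" where
  "module_isos R M N = {f \<in> lin_maps R M N. bij_betw f (carrier M) (carrier N)}"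

definition isomorphic_modules :: "('a, 'c) ring_scheme \<Rightarrow> ('a, 'm, 'd) module_scheme \<Rightarrow>
    ('a, 'n, 'e) module_scheme \<Rightarrow> bool" where
  "isomorphic_modules R M N \<longleftrightarrow> module_isos R M N \<noteq> {}"

definition Hom_module :: "('a, 'c) ring_scheme \<Rightarrow> ('a, 'm, 'd) module_scheme \<Rightarrow>
    ('a, 'n, 'e) module_scheme \<Rightarrow> ('a, 'm \<Rightarrow> 'n) module" where
  "Hom_module R M N = \<lparr>carrier = lin_maps R M N, monoid.mult = undefined, monoid.one = undefined,
     ring.zero = (\<lambda>x\<in>carrier M. \<zero>\<^bsub>N\<^esub>),
     ring.add = (\<lambda>f g. \<lambda>x\<in>carrier M. f x \<oplus>\<^bsub>N\<^esub> g x),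
     smult = (\<lambda>a f. \<lambda>x\<in>carrier M. a \<odot>\<^bsub>N\<^esub> f x)\<rparr>"

definition quot_module :: "('a, 'm, 'd) module_scheme \<Rightarrow> 'm set \<Rightarrow> ('a, 'm set) module" where
  "quot_module M N = \<lparr>carrier = a_rcosets\<^bsub>M\<^esub> N, monoid.mult = undefined, monoid.one = undefined,
     ring.zero = N, ring.add = (<+>\<^bsub>M\<^esub>),
     smult = (\<lambda>a A. \<Union>x\<in>A. N +>\<^bsub>M\<^esub> (a \<odot>\<^bsub>M\<^esub> x))\<rparr>"

text \<open>The direct sum of \<open>n\<close> copies of \<open>M\<close>.\<close>

definition power_module :: "('a, 'm, 'd) module_scheme \<Rightarrow> nat \<Rightarrow> ('a, nat \<Rightarrow> 'm) module" where
  "power_module M n = \<lparr>carrier = {..<n} \<rightarrow>\<^sub>E carrier M,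
     monoid.mult = undefined, monoid.one = undefined,
     ring.zero = (\<lambda>i\<in>{..<n}. \<zero>\<^bsub>M\<^esub>),
     ring.add = (\<lambda>u v. \<lambda>i\<in>{..<n}. u i \<oplus>\<^bsub>M\<^esub> v i),
     smult = (\<lambda>a u. \<lambda>i\<in>{..<n}. a \<odot>\<^bsub>M\<^esub> u i)\<rparr>"

definition bidual_map :: "('a, 'c) ring_scheme \<Rightarrow> ('a, 'm, 'd) module_scheme \<Rightarrow>
    'm \<Rightarrow> ('m \<Rightarrow> 'a) \<Rightarrow> 'a" where
  "bidual_map R M = (\<lambda>x\<in>carrier M. \<lambda>f\<in>lin_maps R M (self_module R). f x)"

definition reflexive_module :: "('a, 'c) ring_scheme \<Rightarrow> ('a, 'm, 'd) module_scheme \<Rightarrow> bool" where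
  "reflexive_module R M \<longleftrightarrow> bidual_map R M \<in>
     module_isos R M (Hom_module R (Hom_module R M (self_module R)) (self_module R))"

definition trace_ideal :: "('a, 'c) ring_scheme \<Rightarrow> ('a, 'm, 'd) module_scheme \<Rightarrow> 'a set" where
  "trace_ideal R M = Idl\<^bsub>R\<^esub> (\<Union>f\<in>lin_maps R M (self_module R). f ` carrier M)"


section \<open>Tensor products\<close>

text \<open>
  The tensor product is the free module on the set \<open>M \<times> N\<close> (functions with finite
  support) modulo the relations expressing bilinearity.
\<close>

definition free_module_on :: "('a, 'c) ring_scheme \<Rightarrow> 's set \<Rightarrow> ('a, 's \<Rightarrow> 'a) module" where
  "free_module_on R S = \<lparr>carrier = {c \<in> S \<rightarrow>\<^sub>E carrier R. finite {s \<in> S. c s \<noteq> \<zero>\<^bsub>R\<^esub>}},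
     monoid.mult = undefined, monoid.one = undefined,
     ring.zero = (\<lambda>s\<in>S. \<zero>\<^bsub>R\<^esub>),
     ring.add = (\<lambda>c d. \<lambda>s\<in>S. c s \<oplus>\<^bsub>R\<^esub> d s),
     smult = (\<lambda>a c. \<lambda>s\<in>S. a \<otimes>\<^bsub>R\<^esub> c s)\<rparr>"

definition free_generator :: "('a, 'c) ring_scheme \<Rightarrow> 's set \<Rightarrow> 's \<Rightarrow> 's \<Rightarrow> 'a" where
  "free_generator R S s = (\<lambda>t\<in>S. if t = s then \<one>\<^bsub>R\<^esub> else \<zero>\<^bsub>R\<^esub>)"

definition tensor_module :: "('a, 'c) ring_scheme \<Rightarrow> ('a, 'm, 'd) module_scheme \<Rightarrow>
    ('a, 'n, 'e) module_scheme \<Rightarrow> ('a, ('m \<times> 'n \<Rightarrow> 'a) set) module" where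
  "tensor_module R M N =
    (let S = carrier M \<times> carrier N; F = free_module_on R S; e = free_generator R S in
     quot_module F (module_span R F
       ({e (x \<oplus>\<^bsub>M\<^esub> x', y) \<ominus>\<^bsub>F\<^esub> (e (x, y) \<oplus>\<^bsub>F\<^esub> e (x', y)) |x x' y.
           x \<in> carrier M \<and> x' \<in> carrier M \<and> y \<in> carrier N} \<union>
        {e (x, y \<oplus>\<^bsub>N\<^esub> y') \<ominus>\<^bsub>F\<^esub> (e (x, y) \<oplus>\<^bsub>F\<^esub> e (x, y')) |x y y'.
           x \<in> carrier M \<and> y \<in> carrier N \<and> y' \<in> carrier N} \<union>
        {e (a \<odot>\<^bsub>M\<^esub> x, y) \<ominus>\<^bsub>F\<^esub> (a \<odot>\<^bsub>F\<^esub> e (x, y)) |a x y.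
           a \<in> carrier R \<and> x \<in> carrier M \<and> y \<in> carrier N} \<union>
        {e (x, a \<odot>\<^bsub>N\<^esub> y) \<ominus>\<^bsub>F\<^esub> (a \<odot>\<^bsub>F\<^esub> e (x, y)) |a x y.
           a \<in> carrier R \<and> x \<in> carrier M \<and> y \<in> carrier N})))"


section \<open>Total ring of fractions, rank and integral closure\<close>

definition nonzerodivisors :: "('a, 'c) ring_scheme \<Rightarrow> 'a set" where
  "nonzerodivisors R =
     {s \<in> carrier R. \<forall>x\<in>carrier R. s \<otimes>\<^bsub>R\<^esub> x = \<zero>\<^bsub>R\<^esub> \<longrightarrow> x = \<zero>\<^bsub>R\<^esub>}"

text \<open>
  \<open>Q\<close> is the total ring of fractions of \<open>R\<close>, where \<open>R\<close> is an actual subring of \<open>Q\<close>: the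
  nonzerodivisors of \<open>R\<close> become invertible, and every element of \<open>Q\<close> is a quotient of an element
  of \<open>R\<close> by a nonzerodivisor of \<open>R\<close>. This determines \<open>Q\<close> up to a unique \<open>R\<close>-isomorphism.
\<close>

definition total_fraction_ring :: "'a ring \<Rightarrow> 'a ring \<Rightarrow> bool" where
  "total_fraction_ring R Q \<longleftrightarrow>
     cring Q \<and> subring (carrier R) Q \<and> R = Q\<lparr>carrier := carrier R\<rparr> \<and>
     nonzerodivisors R \<subseteq> Units Q \<and>
     (\<forall>q\<in>carrier Q. \<exists>a\<in>carrier R. \<exists>s\<in>nonzerodivisors R. q = a \<otimes>\<^bsub>Q\<^esub> inv\<^bsub>Q\<^esub> s)"

text \<open>
  Isomorphism as \<open>R\<close>-modules suffices here: both sides are modules over the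
  localization \<open>Q\<close> of \<open>R\<close>, and every \<open>R\<close>-linear map between \<open>Q\<close>-modules is \<open>Q\<close>-linear.
\<close>

definition has_rank :: "'a ring \<Rightarrow> 'a ring \<Rightarrow> ('a, 'm, 'd) module_scheme \<Rightarrow> nat \<Rightarrow> bool" where
  "has_rank R Q M r \<longleftrightarrow>
     isomorphic_modules R (tensor_module R M (self_module Q)) (power_module (self_module Q) r)"

text \<open>A list of coefficients starts with the leading one, so \<open>hd p = 1\<close> means that \<open>p\<close> is monic.\<close>

definition integral_closure_in :: "'a ring \<Rightarrow> 'a ring \<Rightarrow> 'a set" where
  "integral_closure_in R Q = {x \<in> carrier Q. \<exists>p \<in> carrier (univ_poly Q (carrier R)).
     p \<noteq> [] \<and> hd p = \<one>\<^bsub>Q\<^esub> \<and> ring.eval Q p x = \<zero>\<^bsub>Q\<^esub>}"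

definition normalization :: "'a ring \<Rightarrow> 'a ring \<Rightarrow> 'a ring" where
  "normalization R Q = Q\<lparr>carrier := integral_closure_in R Q\<rparr>"

definition frac_colon :: "'a ring \<Rightarrow> 'a set \<Rightarrow> 'a set \<Rightarrow> 'a set" where
  "frac_colon Q I J = {\<alpha> \<in> carrier Q. \<forall>x\<in>J. \<alpha> \<otimes>\<^bsub>Q\<^esub> x \<in> I}"


section \<open>Cohen-Macaulay local rings\<close>

definition local_ring :: "('a, 'c) ring_scheme \<Rightarrow> bool" where
  "local_ring R \<longleftrightarrow> cring R \<and> (\<exists>!I. maximalideal I R)"

definition max_ideal :: "('a, 'c) ring_scheme \<Rightarrow> 'a set" where
  "max_ideal R = (THE I. maximalideal I R)"

definition krull_dim :: "('a, 'c) ring_scheme \<Rightarrow> enat" where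
  "krull_dim R = Sup {enat n |n. \<exists>P :: nat \<Rightarrow> 'a set.
     (\<forall>i\<le>n. primeideal (P i) R) \<and> (\<forall>i<n. P i \<subset> P (Suc i))}"

text \<open>Each \<open>xs ! i\<close> is a nonzerodivisor on \<open>R\<close> modulo the preceding elements.\<close>

definition regular_sequence :: "('a, 'c) ring_scheme \<Rightarrow> 'a list \<Rightarrow> bool" where
  "regular_sequence R xs \<longleftrightarrow> set xs \<subseteq> carrier R \<and>
     (\<forall>i<length xs. \<forall>y\<in>carrier R.
        xs ! i \<otimes>\<^bsub>R\<^esub> y \<in> Idl\<^bsub>R\<^esub> (set (take i xs)) \<longrightarrow> y \<in> Idl\<^bsub>R\<^esub> (set (take i xs))) \<and>
     Idl\<^bsub>R\<^esub> (set xs) \<noteq> carrier R"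

definition ring_depth :: "('a, 'c) ring_scheme \<Rightarrow> enat" where
  "ring_depth R = Sup {enat (length xs) |xs. set xs \<subseteq> max_ideal R \<and> regular_sequence R xs}"

definition CM_local_ring :: "('a, 'c) ring_scheme \<Rightarrow> bool" where
  "CM_local_ring R \<longleftrightarrow> local_ring R \<and> noetherian_ring R \<and> ring_depth R = krull_dim R"


section \<open>Ext and canonical modules\<close>

text \<open>
  \<open>\<dots> \<rightarrow> R^(n 2) \<rightarrow> R^(n 1) \<rightarrow> R^(n 0) \<rightarrow> N \<rightarrow> 0\<close> is exact, with differentials
  \<open>d i : R^(n (i + 1)) \<rightarrow> R^(n i)\<close> and augmentation \<open>\<epsilon>\<close>.
\<close>

definition free_resolution :: "('a, 'c) ring_scheme \<Rightarrow> ('a, 'n, 'd) module_scheme \<Rightarrow>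
    (nat \<Rightarrow> nat) \<Rightarrow> (nat \<Rightarrow> (nat \<Rightarrow> 'a) \<Rightarrow> nat \<Rightarrow> 'a) \<Rightarrow> ((nat \<Rightarrow> 'a) \<Rightarrow> 'n) \<Rightarrow> bool" where
  "free_resolution R N n d \<epsilon> \<longleftrightarrow>
    (let F = (\<lambda>i. power_module (self_module R) (n i)) in
     \<epsilon> \<in> lin_maps R (F 0) N \<and> \<epsilon> ` carrier (F 0) = carrier N \<and>
     (\<forall>i. d i \<in> lin_maps R (F (Suc i)) (F i)) \<and>
     d 0 ` carrier (F 1) = {u \<in> carrier (F 0). \<epsilon> u = \<zero>\<^bsub>N\<^esub>} \<and>
     (\<forall>i. d (Suc i) ` carrier (F (Suc (Suc i))) =
        {u \<in> carrier (F (Suc i)). d i u = \<zero>\<^bsub>F i\<^esub>}))"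

text \<open>
  \<open>Ext_module R i N M\<close> is the \<open>i\<close>-th cohomology of the complex of modules \<open>Hom (R^(n i)) M\<close> for a
  chosen resolution of \<open>N\<close>. It is meant for Noetherian \<open>R\<close> and finitely generated \<open>N\<close>,
  where a resolution by free modules of finite rank exists; up to isomorphism, the result
  does not depend on the choice.
\<close>

definition Ext_module :: "('a, 'c) ring_scheme \<Rightarrow> nat \<Rightarrow> ('a, 'n, 'd) module_scheme \<Rightarrow>
    ('a, 'm, 'e) module_scheme \<Rightarrow> ('a, ((nat \<Rightarrow> 'a) \<Rightarrow> 'm) set) module" where
  "Ext_module R i N M =
    (let (n, d) = (SOME (n, d). \<exists>\<epsilon>. free_resolution R N n d \<epsilon>);
         F = (\<lambda>j. power_module (self_module R) (n j));
         H = (\<lambda>j. Hom_module R (F j) M);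
         \<delta> = (\<lambda>j f. compose (carrier (F (Suc j))) f (d j));
         Z = {f \<in> carrier (H i). \<delta> i f = \<zero>\<^bsub>H (Suc i)\<^esub>};
         B = (case i of 0 \<Rightarrow> {\<zero>\<^bsub>H 0\<^esub>} | Suc j \<Rightarrow> \<delta> j ` carrier (H j))
     in quot_module ((H i)\<lparr>carrier := Z\<rparr>) B)"

definition residue_module :: "('a, 'c) ring_scheme \<Rightarrow> ('a, 'a set) module" where
  "residue_module R = quot_module (self_module R) (max_ideal R)"

text \<open>
  For a Cohen-Macaulay local ring \<open>R\<close> of dimension \<open>d\<close> with residue field \<open>k\<close>, a
  canonical module is a finitely generated module \<open>W\<close> such that \<open>Ext^i (k, W)\<close> is \<open>k\<close> for \<open>i = d\<close>
  and vanishes for \<open>i \<noteq> d\<close>. (Equivalently, \<open>W\<close> is maximal Cohen-Macaulay of type 1 and of finite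
  injective dimension: depth, type and injective dimension are read off from \<open>Ext^i (k, W)\<close>.)
\<close>

definition canonical_module :: "('a, 'c) ring_scheme \<Rightarrow> ('a, 'w, 'd) module_scheme \<Rightarrow> bool" where
  "canonical_module R W \<longleftrightarrow> module R W \<and> fin_gen_module R W \<and>
     (\<forall>i. if enat i = krull_dim R
          then isomorphic_modules R (Ext_module R i (residue_module R) W) (residue_module R)
          else carrier (Ext_module R i (residue_module R) W) =
               {\<zero>\<^bsub>Ext_module R i (residue_module R) W\<^esub>})"

text \<open>
  \<open>W\<close> is a canonical module of \<open>R\<close>; being unique up to isomorphism, its trace ideal
  depends on \<open>R\<close> only.
\<close>

definition far_flung_Gorenstein :: "'a ring \<Rightarrow> 'a ring \<Rightarrow> ('a, 'w, 'd) module_scheme \<Rightarrow> bool" where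
  "far_flung_Gorenstein R Q W \<longleftrightarrow>
     trace_ideal R W = frac_colon Q (carrier R) (integral_closure_in R Q)"

end

theory Submission
  imports Defs
begin

text \<open>
  Write \<open>V\<close> for the integral closure of \<open>R\<close> and \<open>C\<close> for the copy of \<open>\<omega>\<close> between \<open>R\<close> and \<open>V\<close>.
  Since \<open>R : C\<close> is contained in the trace ideal of \<open>\<omega>\<close>, which is \<open>R : V\<close> by hypothesis, every
  \<open>\<alpha> \<in> Q\<close> with \<open>\<alpha> C \<subseteq> R\<close> satisfies \<open>\<alpha> V \<subseteq> R\<close>. A reflexive module \<open>M\<close> of rank \<open>r\<close> is a lattice \<open>L\<close> in
  \<open>Q^r\<close> cut out by the functionals that are \<open>R\<close>-valued on \<open>L\<close>, and \<open>Hom(\<omega>, M)\<close> is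
  \<open>H = {v. C v \<subseteq> L}\<close>. Testing with functionals shows that \<open>V H \<subseteq> H\<close>. Finally \<open>V\<close> is a discrete
  valuation ring with field of fractions \<open>Q\<close> (it is local and finite over \<open>R\<close>), so that \<open>H\<close>, a bounded
  \<open>V\<close>-submodule of \<open>Q^r\<close> of full rank, is free of rank \<open>r\<close>.
\<close>

section \<open>Local rings of dimension at most one\<close>

text \<open>The obstacle is that nothing says outright that \<open>Q\<close> is a field, or even
  that \<open>R\<close> is reduced. Both are extracted from bounded denominators: as
  \<open>V\<close> is finite over \<open>R\<close>, some nonzerodivisor \<open>c\<close> of
  \<open>R\<close> satisfies \<open>c V \<subseteq> R\<close>. Nilpotents and idempotents of
  \<open>Q\<close> are always integral. A nilpotent stays integral after division by any power of a
  regular \<open>t\<close> in the maximal ideal, so its multiple by \<open>c\<close> is divisible by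
  all powers of \<open>t\<close> inside \<open>R\<close> and must vanish. Idempotents are trivial
  because \<open>V\<close> is local. Dimension at most one enters as an elementary identity
  \<open>x^n (t^i - x z) = 0\<close>; it forces some power of each \<open>x\<close> in
  \<open>R\<close> to be governed by an idempotent, so a nonzero \<open>x\<close> is invertible in
  \<open>Q\<close>. The same element \<open>c\<close> carries ideals of \<open>V\<close> to ideals
  of \<open>R\<close>, so that chain conditions are only ever applied in \<open>R\<close>. Once a
  uniformizer is found, valuations are handled as exponents of it, and freeness of a lattice is an
  induction that splits off one coordinate at a time.\<close>

lemma (in cring) exists_ideal_maximal_disjoint:
  assumes "ideal I R" "I \<inter> S = {}"
  obtains J where "ideal J R" "I \<subseteq> J" "J \<inter> S = {}"
    "\<And>K. ideal K R \<Longrightarrow> J \<subseteq> K \<Longrightarrow> K \<inter> S = {} \<Longrightarrow> K = J"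
proof -
  define F where "F = {J. ideal J R \<and> I \<subseteq> J \<and> J \<inter> S = {}}"
  have "\<exists>U\<in>F. \<forall>K\<in>Y. K \<subseteq> U" if Y: "subset.chain F Y" for Y
  proof (cases "Y = {}")
    case True
    then show ?thesis using assms F_def by auto
  next
    case False
    have "subset.chain {J. ideal J R} Y"
      using Y unfolding F_def pred_on.chain_def by blast
    then have "ideal (\<Union>Y) R"
      using chain_Union_is_ideal[of Y] False by simp
    moreover have "I \<subseteq> \<Union>Y" "\<Union>Y \<inter> S = {}"
      using Y False unfolding F_def pred_on.chain_def by blast+
    ultimately show ?thesis unfolding F_def by blast
  qed
  then obtain J where J: "J \<in> F" "\<forall>K\<in>F. J \<subseteq> K \<longrightarrow> K = J"
    using subset_Zorn[of F] by blast
  show thesis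
  proof (rule that[of J])
    show "ideal J R" "I \<subseteq> J" "J \<inter> S = {}" using J(1) by (auto simp: F_def)
    then show "K = J" if "ideal K R" "J \<subseteq> K" "K \<inter> S = {}" for K
      using J(2) that unfolding F_def by (metis (mono_tags, lifting) mem_Collect_eq order_trans)
  qed
qed

lemma (in cring) set_add_PIdl:
  assumes "ideal J R" "a \<in> carrier R"
  shows "ideal (J <+>\<^bsub>R\<^esub> PIdl a) R" "J \<subseteq> J <+>\<^bsub>R\<^esub> PIdl a" "a \<in> J <+>\<^bsub>R\<^esub> PIdl a"
    and "x \<in> J <+>\<^bsub>R\<^esub> PIdl a \<Longrightarrow> \<exists>j\<in>J. \<exists>z\<in>carrier R. x = j \<oplus> z \<otimes> a"
proof -
  show "ideal (J <+>\<^bsub>R\<^esub> PIdl a) R"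
    using add_ideals[OF assms(1) cgenideal_ideal[OF assms(2)]] .
  interpret J: ideal J R by fact
  have "\<zero> \<in> PIdl a" "a \<in> PIdl a"
    using assms(2) cgenideal_self additive_subgroup.zero_closed ideal.axioms(1) cgenideal_ideal
    by blast+
  then have "j \<oplus> \<zero> \<in> J <+>\<^bsub>R\<^esub> PIdl a" "\<zero> \<oplus> a \<in> J <+>\<^bsub>R\<^esub> PIdl a" if "j \<in> J" for j
    unfolding set_add_def' using J.zero_closed that by blast+
  note mem = this
  show "J \<subseteq> J <+>\<^bsub>R\<^esub> PIdl a"
  proof
    fix j assume "j \<in> J"
    then show "j \<in> J <+>\<^bsub>R\<^esub> PIdl a" using mem(1)[of j] J.a_Hcarr by simp
  qed
  show "a \<in> J <+>\<^bsub>R\<^esub> PIdl a"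
    using mem(2)[OF J.zero_closed] assms(2) by simp
  show "x \<in> J <+>\<^bsub>R\<^esub> PIdl a \<Longrightarrow> \<exists>j\<in>J. \<exists>z\<in>carrier R. x = j \<oplus> z \<otimes> a"
    unfolding set_add_def' cgenideal_def by blast
qed

text \<open>Two elements \<open>a\<close>, \<open>b\<close> outside an ideal \<open>J\<close> that
  is maximal among those avoiding \<open>S\<close> give elements of \<open>S\<close> in
  \<open>J + (a)\<close> and in \<open>J + (b)\<close>. Their product lies in \<open>S\<close> and
  in \<open>J + (a b)\<close>, so \<open>a b\<close> cannot lie in \<open>J\<close>.\<close>

lemma (in cring) exists_primeideal_disjoint:
  assumes "ideal I R" "I \<inter> S = {}" "submonoid S R"
  obtains P where "primeideal P R" "I \<subseteq> P" "P \<inter> S = {}"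
proof -
  obtain J where J: "ideal J R" "I \<subseteq> J" "J \<inter> S = {}"
    "\<And>K. ideal K R \<Longrightarrow> J \<subseteq> K \<Longrightarrow> K \<inter> S = {} \<Longrightarrow> K = J"
    using exists_ideal_maximal_disjoint[OF assms(1,2)] by blast
  interpret S: submonoid S R by fact
  interpret J: ideal J R by fact
  have ex: "\<exists>s\<in>S. \<exists>j\<in>J. \<exists>z\<in>carrier R. s = j \<oplus> z \<otimes> a" if a: "a \<in> carrier R" "a \<notin> J" for a
  proof -
    have "(J <+>\<^bsub>R\<^esub> PIdl a) \<inter> S \<noteq> {}"
      using J(4)[OF set_add_PIdl(1,2)[OF J(1) a(1)]] set_add_PIdl(3)[OF J(1) a(1)] a(2) by metis
    then show ?thesis using set_add_PIdl(4)[OF J(1) a(1)] by blast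
  qed
  have "primeideal J R"
  proof (rule primeidealI)
    show "carrier R \<noteq> J" using J(3) S.one_closed by auto
    fix a b assume ab: "a \<in> carrier R" "b \<in> carrier R" "a \<otimes> b \<in> J"
    show "a \<in> J \<or> b \<in> J"
    proof (rule ccontr)
      assume "\<not> ?thesis"
      then obtain s s' j j' z z' where
        s: "s \<in> S" "j \<in> J" "z \<in> carrier R" "s = j \<oplus> z \<otimes> a" and
        s': "s' \<in> S" "j' \<in> J" "z' \<in> carrier R" "s' = j' \<oplus> z' \<otimes> b"
        using ex[OF ab(1)] ex[OF ab(2)] by blast
      have c: "j \<in> carrier R" "j' \<in> carrier R" using s s' J.a_subset by auto
      have "s \<otimes> s' = j \<otimes> s' \<oplus> (j' \<otimes> (z \<otimes> a) \<oplus> z \<otimes> z' \<otimes> (a \<otimes> b))"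
        using s s' c ab by algebra
      moreover have "\<dots> \<in> J"
        using s s' c ab S.mem_carrier[OF s'(1)]
        by (intro J.a_closed J.I_r_closed[OF s(2)] J.I_r_closed[OF s'(2)] J.I_l_closed[OF ab(3)])
          simp_all
      ultimately show False using J(3) S.m_closed[OF s(1) s'(1)] by auto
    qed
  qed (use J is_cring in auto)
  then show thesis using that J by blast
qed

text \<open>For an ideal, avoiding the one-element set of the unit means being proper, so an ideal
  maximal among those avoiding it is a maximal ideal.\<close>

lemma (in cring) nonunit_in_maximalideal:
  assumes "a \<in> carrier R" "a \<notin> Units R"
  obtains P where "maximalideal P R" "a \<in> P"
proof -
  have "\<one> \<notin> PIdl a"
  proof
    assume "\<one> \<in> PIdl a"
    then obtain z where "z \<in> carrier R" "\<one> = z \<otimes> a" unfolding cgenideal_def by auto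
    then show False using assms m_comm[of z a] unfolding Units_def by auto
  qed
  then obtain J where J: "ideal J R" "PIdl a \<subseteq> J" "J \<inter> {\<one>} = {}"
    "\<And>K. ideal K R \<Longrightarrow> J \<subseteq> K \<Longrightarrow> K \<inter> {\<one>} = {} \<Longrightarrow> K = J"
    using exists_ideal_maximal_disjoint[OF cgenideal_ideal[OF assms(1)], of "{\<one>}"] by blast
  interpret J: ideal J R by fact
  have "maximalideal J R"
  proof (rule maximalidealI[OF J(1)])
    show "carrier R \<noteq> J" using J(3) by auto
    fix K assume K: "ideal K R" "J \<subseteq> K" "K \<subseteq> carrier R"
    show "K = J \<or> K = carrier R"
    proof (cases "\<one> \<in> K")
      case True
      then show ?thesis using ideal.one_imp_carrier[OF K(1)] by simp
    next
      case False
      then show ?thesis using J(4)[OF K(1,2)] by simp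
    qed
  qed
  then show thesis using that J(2) cgenideal_self[OF assms(1)] by blast
qed

locale local_cring = cring +
  assumes local: "local_ring R"
begin

lemma max_ideal: "maximalideal (max_ideal R) R"
  using local theI'[of "\<lambda>I. maximalideal I R"] unfolding local_ring_def max_ideal_def by simp

lemma max_ideal_unique: "maximalideal I R \<Longrightarrow> I = max_ideal R"
  using local max_ideal unfolding local_ring_def by auto

lemma in_max_ideal_iff: "a \<in> max_ideal R \<longleftrightarrow> a \<in> carrier R \<and> a \<notin> Units R"
proof
  interpret m: maximalideal "max_ideal R" R by (rule max_ideal)
  assume a: "a \<in> max_ideal R"
  moreover have "a \<notin> Units R"
  proof
    assume "a \<in> Units R"
    then have "\<one> \<in> max_ideal R" using m.I_r_closed[OF a, of "inv a"] by simp
    then show False using m.one_imp_carrier m.I_notcarr by auto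
  qed
  ultimately show "a \<in> carrier R \<and> a \<notin> Units R" using m.a_subset by auto
next
  assume "a \<in> carrier R \<and> a \<notin> Units R"
  then show "a \<in> max_ideal R"
    using nonunit_in_maximalideal max_ideal_unique by metis
qed

lemma ideal_subset_max_ideal:
  assumes "ideal I R" "I \<noteq> carrier R"
  shows "I \<subseteq> max_ideal R"
proof
  interpret I: ideal I R by fact
  fix x assume x: "x \<in> I"
  have "x \<notin> Units R"
  proof
    assume "x \<in> Units R"
    then have "\<one> \<in> I" using I.I_r_closed[OF x, of "inv x"] by simp
    then show False using I.one_imp_carrier assms by auto
  qed
  then show "x \<in> max_ideal R" using x I.a_subset in_max_ideal_iff by auto
qed

lemma max_ideal_ideal: "ideal (max_ideal R) R"
  using max_ideal maximalideal.axioms(1) by blast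

lemma one_notin_max_ideal: "\<one> \<notin> max_ideal R"
  by (simp add: in_max_ideal_iff)

text \<open>Otherwise a prime \<open>P\<close> avoiding the set of all elements \<open>x^n (t^i - x z)\<close> and
  a prime above \<open>P + (x)\<close> avoiding the powers of \<open>t\<close> would
  give a chain of primes of length two.\<close>

lemma krull_dim_le_1_power_mult:
  assumes dim: "krull_dim R \<le> 1" and t: "t \<in> max_ideal R" and x: "x \<in> carrier R"
  shows "\<exists>(n::nat) (i::nat). \<exists>z\<in>carrier R. x [^] n \<otimes> (t [^] i \<ominus> x \<otimes> z) = \<zero>"
proof (rule ccontr)
  assume "\<not> ?thesis"
  then have no: "x [^] n \<otimes> (t [^] i \<ominus> x \<otimes> z) \<noteq> \<zero>" if "z \<in> carrier R" for n i :: nat and z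
    using that by blast
  have tc: "t \<in> carrier R" using t in_max_ideal_iff by simp
  define S where "S = {x [^] n \<otimes> (t [^] i \<ominus> x \<otimes> z) |(n::nat) (i::nat) z. z \<in> carrier R}"
  have S: "submonoid S R"
  proof
    show "S \<subseteq> carrier R" using x tc unfolding S_def by auto
    have "\<one> = x [^] (0::nat) \<otimes> (t [^] (0::nat) \<ominus> x \<otimes> \<zero>)" using x tc by (simp add: a_minus_def)
    then show "\<one> \<in> S" unfolding S_def by blast
    fix a b assume "a \<in> S" "b \<in> S"
    then obtain n i z n' i' z' where
      a: "z \<in> carrier R" "a = x [^] (n::nat) \<otimes> (t [^] (i::nat) \<ominus> x \<otimes> z)" and
      b: "z' \<in> carrier R" "b = x [^] (n'::nat) \<otimes> (t [^] (i'::nat) \<ominus> x \<otimes> z')"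
      unfolding S_def by blast
    \<comment> \<open>Multiplying out \<open>(t^i - x z) (t^i' - x z')\<close> and collecting the
      multiples of \<open>x\<close> gives \<open>t^(i + i') - x w\<close>.\<close>
    define w where "w = t [^] i \<otimes> z' \<oplus> t [^] i' \<otimes> z \<ominus> x \<otimes> (z \<otimes> z')"
    have "x [^] n \<in> carrier R" "x [^] n' \<in> carrier R" "t [^] i \<in> carrier R" "t [^] i' \<in> carrier R"
      using x tc by auto
    then have "a \<otimes> b = (x [^] n \<otimes> x [^] n') \<otimes> ((t [^] i \<otimes> t [^] i') \<ominus> x \<otimes> w)"
      unfolding a b w_def using a(1) b(1) x tc by algebra
    also have "\<dots> = x [^] (n + n') \<otimes> (t [^] (i + i') \<ominus> x \<otimes> w)"
      using x tc nat_pow_mult by simp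
    finally show "a \<otimes> b \<in> S" unfolding S_def
      using a(1) b(1) x tc w_def by blast
  qed
  have zero_S: "{\<zero>} \<inter> S = {}" using no unfolding S_def by force
  obtain P where P: "primeideal P R" "P \<inter> S = {}"
    by (rule exists_primeideal_disjoint[OF zeroideal zero_S S])
  interpret P: primeideal P R by fact
  define T where "T = {t [^] (i::nat) |i. True}"
  have T: "submonoid T R"
  proof
    show "T \<subseteq> carrier R" using tc unfolding T_def by auto
    have "\<one> = t [^] (0::nat)" by simp
    then show "\<one> \<in> T" unfolding T_def by blast
    fix a b assume "a \<in> T" "b \<in> T"
    then show "a \<otimes> b \<in> T" unfolding T_def using nat_pow_mult[OF tc] by auto
  qed
  \<comment> \<open>An equation \<open>t^i = p + z x\<close> with \<open>p\<close> in
    \<open>P\<close> would make \<open>p = x^0 (t^i - x z)\<close> an element of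
    \<open>S\<close>.\<close>
  have disj: "(P <+>\<^bsub>R\<^esub> PIdl x) \<inter> T = {}"
  proof (rule ccontr)
    assume "\<not> ?thesis"
    then obtain i p z where p: "p \<in> P" "z \<in> carrier R" "t [^] (i::nat) = p \<oplus> z \<otimes> x"
      using set_add_PIdl(4)[OF P.is_ideal x] unfolding T_def by blast
    have "p \<in> carrier R" using P.a_subset p(1) by blast
    with p have "p = x [^] (0::nat) \<otimes> (t [^] i \<ominus> x \<otimes> z)"
      using x tc by (simp add: a_minus_def m_comm a_assoc r_neg)
    then have "p \<in> S" unfolding S_def using p(2) by blast
    then show False using P(2) p(1) by auto
  qed
  obtain P' where P': "primeideal P' R" "P <+>\<^bsub>R\<^esub> PIdl x \<subseteq> P'" "P' \<inter> T = {}"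
    by (rule exists_primeideal_disjoint[OF set_add_PIdl(1)[OF P.is_ideal x] disj T])
  interpret P': primeideal P' R by fact
  \<comment> \<open>The choice \<open>n = 1\<close>, \<open>i = 0\<close>, \<open>z = 0\<close>
    shows that \<open>x\<close> itself lies in \<open>S\<close>. Hence \<open>P\<close> misses
    \<open>x\<close> while \<open>P'\<close> contains it; in the same way \<open>t\<close> separates
    \<open>P'\<close> from the maximal ideal, so both inclusions are strict.\<close>
  have "x = x [^] (1::nat) \<otimes> (t [^] (0::nat) \<ominus> x \<otimes> \<zero>)" using x tc by (simp add: a_minus_def)
  then have "x \<in> S" unfolding S_def by blast
  then have "x \<notin> P" using P(2) by auto
  then have PP': "P \<subset> P'" using P'(2) set_add_PIdl(2,3)[OF P.is_ideal x] by blast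
  have "t = t [^] (1::nat)" using tc by simp
  then have "t \<in> T" unfolding T_def by blast
  then have "t \<notin> P'" using P'(3) by auto
  then have P'm: "P' \<subset> max_ideal R"
    using ideal_subset_max_ideal[OF P'.is_ideal] P'.I_notcarr t by auto
  define G where "G = (\<lambda>i::nat. if i = 0 then P else if i = 1 then P' else max_ideal R)"
  have "\<forall>i\<le>2. primeideal (G i) R"
    using P(1) P'(1) maximalideal_prime[OF max_ideal] unfolding G_def by simp
  moreover have "\<forall>i<2. G i \<subset> G (Suc i)"
    using PP' P'm by (auto simp: G_def less_2_cases_iff)
  ultimately have "enat 2 \<le> krull_dim R"
    unfolding krull_dim_def by (intro Sup_upper) blast
  then have "enat 2 \<le> 1" using dim by (rule order_trans)
  then show False by (simp add: one_enat_def)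
qed

text \<open>Positive depth provides a nonempty regular sequence. Its first entry is regular modulo
  the ideal generated by the empty set, and that ideal is zero.\<close>

lemma depth_pos_nonzerodivisor:
  assumes "ring_depth R \<noteq> 0"
  obtains t where "t \<in> max_ideal R" "t \<in> nonzerodivisors R"
proof -
  have "\<exists>xs. set xs \<subseteq> max_ideal R \<and> regular_sequence R xs \<and> xs \<noteq> []"
  proof (rule ccontr)
    assume "\<not> ?thesis"
    then have "ring_depth R \<le> 0"
      unfolding ring_depth_def by (intro Sup_least) (auto simp: zero_enat_def)
    then show False using assms by simp
  qed
  then obtain t xs where xs: "t \<in> max_ideal R" "regular_sequence R (t # xs)"
    by (metis list.set_intros(1) neq_Nil_conv subset_eq)
  have "Idl {} \<subseteq> {\<zero>}" by (intro genideal_minimal zeroideal) simp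
  moreover have "ideal (Idl {}) R" by (rule genideal_ideal) simp
  ultimately have I: "Idl {} = {\<zero>}" using additive_subgroup.zero_closed[OF ideal.axioms(1)] by blast
  have "t \<in> nonzerodivisors R"
    using xs(2) I unfolding regular_sequence_def nonzerodivisors_def by force
  then show thesis using that xs(1) by blast
qed

end

text \<open>A nonempty chain of ideals in a Noetherian ring contains its own union, so every chain
  in the family has an upper bound there and Zorn's lemma applies. This is the form in which the
  ascending chain condition is used below.\<close>

lemma (in noetherian_ring) exists_maximal_ideal_in:
  assumes "F \<noteq> {}" "\<And>I. I \<in> F \<Longrightarrow> ideal I R"
  shows "\<exists>J\<in>F. \<forall>K\<in>F. J \<subseteq> K \<longrightarrow> K = J"
proof -
  have "\<exists>U\<in>F. \<forall>K\<in>Y. K \<subseteq> U" if Y: "subset.chain F Y" for Y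
  proof (cases "Y = {}")
    case True
    then show ?thesis using assms by auto
  next
    case False
    have "subset.chain {J. ideal J R} Y"
      using Y assms(2) unfolding pred_on.chain_def by blast
    then have "\<Union>Y \<in> Y" using ideal_chain_is_trivial[OF False] by blast
    moreover have "Y \<subseteq> F" using Y unfolding pred_on.chain_def by simp
    ultimately show ?thesis by (intro bexI[of _ "\<Union>Y"]) auto
  qed
  then show ?thesis using subset_Zorn[of F] by blast
qed

section \<open>The integral closure as a discrete valuation ring\<close>

lemma self_module_simps [simp]:
  "carrier (self_module S) = carrier S" "ring.add (self_module S) = ring.add S"
  "ring.zero (self_module S) = ring.zero S" "smult (self_module S) = monoid.mult S"
  by (simp_all add: self_module_def)

lemma (in ring) eval_map_smult:
  assumes "set q \<subseteq> carrier R" "b \<in> carrier R" "x \<in> carrier R"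
  shows "eval (map (\<lambda>c. b \<otimes> c) q) x = b \<otimes> eval q x"
  using assms by (induction q) (auto simp: r_distr m_assoc eval_in_carrier)

section \<open>Denominators and elements integral over \<open>R\<close>\<close>

locale fraction_pair = cring Q for Q :: "'a ring" (structure) +
  fixes R :: "'a ring"
  assumes total_fraction: "total_fraction_ring R Q" and one_not_zero: "\<one> \<noteq> \<zero>"
begin

abbreviation "A \<equiv> carrier R"
abbreviation "V \<equiv> integral_closure_in R Q"
abbreviation "N \<equiv> normalization R Q"

lemma A_subring: "subring A Q"
  using total_fraction unfolding total_fraction_ring_def by blast

lemma R_eq: "R = Q\<lparr>carrier := A\<rparr>"
  using total_fraction unfolding total_fraction_ring_def by blast

lemma R_ops [simp]:
  "monoid.mult R = monoid.mult Q" "monoid.one R = monoid.one Q" "ring.add R = ring.add Q"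
  "ring.zero R = ring.zero Q"
  by (subst R_eq; simp)+

lemma A_sub: "a \<in> A \<Longrightarrow> a \<in> carrier Q"
  using subringE(1)[OF A_subring] by blast

lemma A_closed [simp]:
  "\<zero> \<in> A" "\<one> \<in> A" "a \<in> A \<Longrightarrow> b \<in> A \<Longrightarrow> a \<oplus> b \<in> A" "a \<in> A \<Longrightarrow> b \<in> A \<Longrightarrow> a \<otimes> b \<in> A"
  "a \<in> A \<Longrightarrow> \<ominus> a \<in> A"
  using subringE[OF A_subring] by auto

lemma R_cring: "cring R"
  using subcring_iff[of A] subcringI'[OF A_subring] A_sub R_eq by auto

lemma R_pow [simp]: "x [^]\<^bsub>R\<^esub> (n::nat) = x [^] n"
  by (subst R_eq) (rule nat_pow_consistent[symmetric])

lemma R_minus: "a \<in> A \<Longrightarrow> \<ominus>\<^bsub>R\<^esub> a = \<ominus> a"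
  by (metis A_closed(5) A_sub R_cring R_ops(3,4) abelian_group.minus_equality cring.axioms(1) l_neg ring_def)

text \<open>Cancelling a unit of \<open>Q\<close> gives the converse of the defining property of the
  total ring of fractions. From here on arguments about regular elements of \<open>R\<close> become
  cancellations of units of \<open>Q\<close>.\<close>

lemma nonzerodivisors_iff: "s \<in> nonzerodivisors R \<longleftrightarrow> s \<in> A \<and> s \<in> Units Q"
proof
  show "s \<in> nonzerodivisors R \<Longrightarrow> s \<in> A \<and> s \<in> Units Q"
    using total_fraction unfolding total_fraction_ring_def by (auto simp: nonzerodivisors_def)
  assume s: "s \<in> A \<and> s \<in> Units Q"
  have "x = \<zero>" if "x \<in> A" "s \<otimes> x = \<zero>" for x
    using s that A_sub by (metis Units_closed Units_inv_closed Units_l_inv l_one m_assoc r_null)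
  then show "s \<in> nonzerodivisors R" using s by (auto simp: nonzerodivisors_def)
qed

lemma nonzerodivisors_mult:
  "s \<in> nonzerodivisors R \<Longrightarrow> s' \<in> nonzerodivisors R \<Longrightarrow> s \<otimes> s' \<in> nonzerodivisors R"
  by (simp add: nonzerodivisors_iff)

lemma one_nonzerodivisors: "\<one> \<in> nonzerodivisors R"
  by (simp add: nonzerodivisors_iff)

lemma denominator:
  assumes "q \<in> carrier Q"
  obtains s where "s \<in> nonzerodivisors R" "s \<otimes> q \<in> A"
proof -
  obtain a s where as: "a \<in> A" "s \<in> nonzerodivisors R" "q = a \<otimes> inv s"
    using assms total_fraction unfolding total_fraction_ring_def by blast
  then have "s \<otimes> q = a"
    using A_sub unfolding nonzerodivisors_iff
    by (metis Units_closed Units_inv_closed Units_r_inv m_lcomm r_one)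
  then show thesis using that as by blast
qed

lemma common_denominator:
  assumes "finite B" "B \<subseteq> carrier Q"
  obtains s where "s \<in> nonzerodivisors R" "\<And>b. b \<in> B \<Longrightarrow> s \<otimes> b \<in> A"
proof -
  have "\<exists>s\<in>nonzerodivisors R. \<forall>b\<in>B. s \<otimes> b \<in> A"
    using assms
  proof (induction B rule: finite_induct)
    case empty
    then show ?case using one_nonzerodivisors by blast
  next
    case (insert b B)
    then obtain s where s: "s \<in> nonzerodivisors R" "\<forall>b\<in>B. s \<otimes> b \<in> A" by auto
    obtain s' where s': "s' \<in> nonzerodivisors R" "s' \<otimes> b \<in> A"
      using denominator insert.prems by auto
    have c: "s \<in> A" "s' \<in> A" "s \<in> carrier Q" "s' \<in> carrier Q"
      using s s' A_sub by (auto simp: nonzerodivisors_iff)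
    have "s \<otimes> s' \<otimes> x \<in> A" if "x \<in> insert b B" for x
    proof (cases "x = b")
      case True
      then show ?thesis using c s' insert.prems m_assoc by simp
    next
      case False
      then have "x \<in> B" "x \<in> carrier Q" using that insert.prems by auto
      then show ?thesis using c s m_lcomm m_assoc by (metis A_closed(4))
    qed
    then show ?case using nonzerodivisors_mult[OF s(1) s'(1)] by blast
  qed
  then show thesis using that by blast
qed

lemma V_sub: "v \<in> V \<Longrightarrow> v \<in> carrier Q"
  by (simp add: integral_closure_in_def)

text \<open>Monic equations are presented as \<open>\<one> # q\<close> with an arbitrary tail
  \<open>q\<close>, which may begin with zeros; \<open>one_not_zero\<close> makes the leading
  coefficient admissible for \<open>polynomial\<close>.\<close>

lemma V_I:
  assumes "x \<in> carrier Q" "set q \<subseteq> A" "eval (\<one> # q) x = \<zero>"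
  shows "x \<in> V"
proof -
have "polynomial A (\<one> # q)" using assms(2) one_not_zero by (auto simp: polynomial_def)
  then have "\<one> # q \<in> carrier (univ_poly Q A)" using univ_poly_carrier by blast
  then show ?thesis using assms unfolding integral_closure_in_def
    by (intro CollectI conjI bexI[of _ "\<one> # q"]) auto
qed

lemma V_E:
  assumes "x \<in> V"
  obtains q where "set q \<subseteq> A" "eval (\<one> # q) x = \<zero>"
proof -
  obtain p where p: "p \<in> carrier (univ_poly Q A)" "p \<noteq> []" "hd p = \<one>" "eval p x = \<zero>"
    using assms unfolding integral_closure_in_def by blast
  then have "polynomial A p" using univ_poly_carrier by blast
  then have "set p \<subseteq> A" using polynomial_incl by blast
  then show thesis using that[of "tl p"] p by (cases p) auto
qed

lemma A_sub_V: "a \<in> A \<Longrightarrow> a \<in> V"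
  by (rule V_I[of _ "[\<ominus> a]"]) (auto simp: A_sub r_neg)

text \<open>The monic equation is \<open>X^n\<close>. It is meant for all quotients of one nilpotent
  element by the powers of a regular element at once.\<close>

lemma V_nilpotent:
  assumes "x \<in> carrier Q" "x [^] (n::nat) = \<zero>"
  shows "x \<in> V"
proof (rule V_I[of _ "replicate n \<zero>"])
  show "eval (\<one> # replicate n \<zero>) x = \<zero>"
    using assms eval_replicate[of "[]" x n] by simp
qed (use assms in auto)

lemma V_idempotent:
  assumes "e \<in> carrier Q" "e \<otimes> e = e"
  shows "e \<in> V"
proof (rule V_I[of _ "[\<ominus> \<one>, \<zero>]"])
  show "eval [\<one>, \<ominus> \<one>, \<zero>] e = \<zero>"
    using assms by (simp add: numeral_2_eq_2 l_minus r_neg)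
qed (use assms in auto)

text \<open>By the ascending chain condition, some \<open>e x^k\<close> lies in the \<open>R\<close>-module generated by
  the \<open>e x^i\<close> with \<open>i < k\<close>; cancelling \<open>e\<close> gives a monic equation for \<open>x\<close>.\<close>

lemma almost_integral:
  assumes noeth: "noetherian_ring R" and x: "x \<in> carrier Q" and e: "e \<in> Units Q"
    and ex: "\<And>j::nat. e \<otimes> x [^] j \<in> A"
  shows "x \<in> V"
proof -
  interpret R: noetherian_ring R by fact
  have ec: "e \<in> carrier Q" using e by blast
  \<comment> \<open>The coefficient lists have length exactly \<open>k\<close> and may start with
    zeros. Entrywise sums then stay in \<open>D k\<close>, and prefixing a zero embeds
    \<open>D k\<close> in \<open>D (Suc k)\<close>.\<close>
  define D where "D = (\<lambda>k. {e \<otimes> eval q x |q. set q \<subseteq> A \<and> length q = k})"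
  have D_carr: "set q \<subseteq> carrier Q" if "set q \<subseteq> A" for q
    using that A_sub by blast
  have D_A: "D k \<subseteq> A" for k
  proof -
    have "e \<otimes> eval q x \<in> A" if "set q \<subseteq> A" for q
      using that
    proof (induction q)
      case Nil
      then show ?case using ec by simp
    next
      case (Cons a q)
      have c: "a \<in> carrier Q" "eval q x \<in> carrier Q"
        using Cons.prems A_sub eval_in_carrier[OF D_carr x] by auto
      have "e \<otimes> eval (a # q) x = a \<otimes> (e \<otimes> x [^] length q) \<oplus> e \<otimes> eval q x"
        using c ec x by (simp add: r_distr m_lcomm)
      then show ?case using Cons ex by simp
    qed
    then show ?thesis unfolding D_def by blast
  qed
  have ideal: "ideal (D k) R" for k
  proof (rule idealI)
    show "ring R" using R_cring cring.axioms(1) by blast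
    have mult: "a \<otimes> d \<in> D k" if "a \<in> A" "d \<in> D k" for a d
    proof -
      obtain q where q: "set q \<subseteq> A" "length q = k" "d = e \<otimes> eval q x"
        using \<open>d \<in> D k\<close> unfolding D_def by blast
      have "a \<otimes> d = e \<otimes> eval (map (\<lambda>c. a \<otimes> c) q) x"
        using q that(1) A_sub x ec eval_in_carrier[OF D_carr[OF q(1)] x]
        by (simp add: eval_map_smult D_carr m_lcomm)
      moreover have "set (map (\<lambda>c. a \<otimes> c) q) \<subseteq> A" using q that(1) by auto
      ultimately show ?thesis using q(2) unfolding D_def
        by (metis (mono_tags, lifting) length_map mem_Collect_eq)
    qed
    show "subgroup (D k) (add_monoid R)"
    proof
      show "D k \<subseteq> carrier (add_monoid R)" using D_A by simp
      have "e \<otimes> eval (replicate k \<zero>) x = \<zero>" using eval_replicate[of "[]" x k] x ec by simp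
      moreover have "set (replicate k \<zero>) \<subseteq> A" by auto
      ultimately show "\<one>\<^bsub>add_monoid R\<^esub> \<in> D k"
        unfolding D_def by (simp, metis length_replicate)
      fix d d' assume d: "d \<in> D k" "d' \<in> D k"
      then obtain q q' where q: "set q \<subseteq> A" "length q = k" "d = e \<otimes> eval q x"
        "set q' \<subseteq> A" "length q' = k" "d' = e \<otimes> eval q' x"
        unfolding D_def by blast
      have sum_A: "set (map2 (\<oplus>) q q') \<subseteq> A"
        using q(1,4) by (auto intro!: A_closed(3) dest: set_zip_leftD set_zip_rightD)
      have "d \<oplus> d' = e \<otimes> eval (map2 (\<oplus>) q q') x"
        using eval_poly_add_aux[of q q' x] eval_normalize[OF D_carr[OF sum_A] x]
          q x ec eval_in_carrier[OF D_carr x]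
        by (simp add: D_carr r_distr)
      moreover have "length (map2 (\<oplus>) q q') = k" using q by simp
      ultimately show "d \<otimes>\<^bsub>add_monoid R\<^esub> d' \<in> D k" using sum_A unfolding D_def by (simp, blast)
      have dA: "d \<in> A" using D_A d by blast
      then have "\<ominus> d = (\<ominus> \<one>) \<otimes> d" using A_sub by (simp add: l_minus)
      then have "\<ominus>\<^bsub>R\<^esub> d \<in> D k" using mult[of "\<ominus> \<one>" d] d(1) dA by (simp add: R_minus)
      then show "inv\<^bsub>add_monoid R\<^esub> d \<in> D k" by (simp add: a_inv_def)
    qed
    show "a \<otimes>\<^bsub>R\<^esub> d \<in> D k" "d \<otimes>\<^bsub>R\<^esub> a \<in> D k" if "d \<in> D k" "a \<in> A" for a d
    proof -
      have "d \<in> carrier Q" "a \<in> carrier Q" using that D_A A_sub by blast+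
      then show "a \<otimes>\<^bsub>R\<^esub> d \<in> D k" "d \<otimes>\<^bsub>R\<^esub> a \<in> D k"
        using mult[OF that(2,1)] m_comm[of a d] by auto
    qed
  qed
  have mono: "D k \<subseteq> D (Suc k)" for k
  proof
    fix d assume "d \<in> D k"
    then obtain q where q: "set q \<subseteq> A" "length q = k" "d = e \<otimes> eval q x"
      unfolding D_def by blast
    then have "d = e \<otimes> eval (\<zero> # q) x" using x eval_in_carrier[OF D_carr x] by simp
    then show "d \<in> D (Suc k)" using q unfolding D_def
      by (intro CollectI exI[of _ "\<zero> # q"]) auto
  qed
  have "\<exists>J\<in>range D. \<forall>K\<in>range D. J \<subseteq> K \<longrightarrow> K = J"
    by (rule R.exists_maximal_ideal_in) (use ideal in auto)
  then obtain J where J: "J \<in> range D" "\<forall>K\<in>range D. J \<subseteq> K \<longrightarrow> K = J"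
    by blast
  then obtain k where "J = D k" by blast
  then have k: "D (Suc k) = D k" using J(2) mono[of k] by simp
  \<comment> \<open>The monic list puts \<open>e x^k\<close> into \<open>D (Suc k)\<close>, which
    equals \<open>D k\<close> and so contains only combinations of lower powers of
    \<open>x\<close>.\<close>
  have "e \<otimes> x [^] k = e \<otimes> eval (\<one> # replicate k \<zero>) x"
    using eval_replicate[of "[]" x k] x by simp
  then have "e \<otimes> x [^] k \<in> D (Suc k)" unfolding D_def
    by (intro CollectI exI[of _ "\<one> # replicate k \<zero>"]) auto
  then obtain q where q: "set q \<subseteq> A" "length q = k" "e \<otimes> x [^] k = e \<otimes> eval q x"
    unfolding k unfolding D_def by blast
  then have eq: "x [^] k = eval q x"
    using Units_l_cancel[OF e, of "x [^] k" "eval q x"] x eval_in_carrier[OF D_carr x] by auto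
  show ?thesis
  proof (rule V_I[OF x, of "map (\<lambda>c. \<ominus> \<one> \<otimes> c) q"])
    show "set (map (\<lambda>c. \<ominus> \<one> \<otimes> c) q) \<subseteq> A" using q by auto
    have "eval (map (\<lambda>c. \<ominus> \<one> \<otimes> c) q) x = \<ominus> \<one> \<otimes> x [^] k"
      using eval_map_smult[of q "\<ominus> \<one>" x] q x D_carr eq by simp
    then show "eval (\<one> # map (\<lambda>c. \<ominus> \<one> \<otimes> c) q) x = \<zero>"
      using q x by (simp add: l_minus r_neg)
  qed
qed

end

section \<open>Conductor elements and bounded denominators\<close>

locale finite_normalization = fraction_pair +
  assumes noetherian: "noetherian_ring R"
    and N_cring: "cring N"
    and N_fin_gen: "fin_gen_module R (self_module N)"
begin

lemma N_simps [simp]: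
  "carrier N = V" "monoid.mult N = monoid.mult Q" "monoid.one N = \<one>" "ring.add N = ring.add Q"
  "ring.zero N = \<zero>"
  by (simp_all add: normalization_def)

text \<open>That sums and products of integral elements are integral is read off from
  \<open>cring N\<close>, which is part of the hypothesis that the integral closure is a local
  ring.\<close>

lemma V_subring: "subring V Q"
  using N_cring V_sub ring_incl_imp_subring[of V] unfolding normalization_def cring_def by auto

lemma V_closed [simp]:
  "\<zero> \<in> V" "\<one> \<in> V" "a \<in> V \<Longrightarrow> b \<in> V \<Longrightarrow> a \<oplus> b \<in> V" "a \<in> V \<Longrightarrow> b \<in> V \<Longrightarrow> a \<otimes> b \<in> V"
  "a \<in> V \<Longrightarrow> \<ominus> a \<in> V"
  using subringE[OF V_subring] by auto

lemma N_module: "module R (self_module N)"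
proof (rule moduleI)
  show "abelian_group (self_module N)"
  proof (rule abelian_groupI)
    show "\<exists>y\<in>carrier (self_module N). y \<oplus>\<^bsub>self_module N\<^esub> x = \<zero>\<^bsub>self_module N\<^esub>"
      if "x \<in> carrier (self_module N)" for x
      using that V_sub by (intro bexI[of _ "\<ominus> x"]) (auto simp: l_neg)
  qed (use V_sub in \<open>auto simp: a_ac\<close>)
qed (use R_cring A_sub_V A_sub V_sub in \<open>auto simp: l_distr r_distr m_assoc\<close>)

text \<open>A common denominator \<open>c\<close> of finitely many generators of \<open>V\<close>
  works for all of \<open>V\<close>, since the elements that \<open>c\<close> carries into
  \<open>A\<close> form an \<open>R\<close>-submodule.\<close>

lemma conductor:
  "\<exists>c\<in>nonzerodivisors R. \<forall>v\<in>V. c \<otimes> v \<in> A"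
proof -
  obtain B where B: "finite B" "B \<subseteq> V" "module_span R (self_module N) B = V"
    using N_fin_gen unfolding fin_gen_module_def by auto
  obtain c where c: "c \<in> nonzerodivisors R" "\<And>b. b \<in> B \<Longrightarrow> c \<otimes> b \<in> A"
    using common_denominator[OF B(1)] B(2) V_sub by blast
  have cc: "c \<in> A" "c \<in> carrier Q" using c(1) A_sub by (auto simp: nonzerodivisors_iff)
  interpret N: module R "self_module N" by (rule N_module)
  have "submodule {v \<in> V. c \<otimes> v \<in> A} R (self_module N)"
  proof (rule N.submoduleI)
    fix a assume a: "a \<in> {v \<in> V. c \<otimes> v \<in> A}"
    have "\<ominus>\<^bsub>self_module N\<^esub> a = \<ominus> a"
      using a V_sub by (intro N.minus_equality) (auto simp: l_neg)
    then show "\<ominus>\<^bsub>self_module N\<^esub> a \<in> {v \<in> V. c \<otimes> v \<in> A}"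
      using a V_sub cc by (auto simp: r_minus)
  qed (use cc V_sub A_sub A_sub_V in \<open>auto simp: r_distr m_lcomm\<close>)
  then have "module_span R (self_module N) B \<subseteq> {v \<in> V. c \<otimes> v \<in> A}"
    unfolding module_span_def using B(2) c(2) by blast
  then show ?thesis using c(1) B(3) by blast
qed

text \<open>For a conductor element \<open>c\<close> the unit \<open>c d\<close> carries all powers
  of \<open>x\<close> into \<open>R\<close>, which is the situation of
  \<open>almost_integral\<close>.\<close>

lemma completely_integrally_closed:
  assumes x: "x \<in> carrier Q" and d: "d \<in> Units Q" and dx: "\<And>j::nat. d \<otimes> x [^] j \<in> V"
  shows "x \<in> V"
proof -
  obtain c where c: "c \<in> nonzerodivisors R" "\<And>v. v \<in> V \<Longrightarrow> c \<otimes> v \<in> A"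
    using conductor by blast
  have "c \<in> Units Q" using c(1) nonzerodivisors_iff by blast
  then show ?thesis
    using almost_integral[OF noetherian x, of "c \<otimes> d"] c(2)[OF dx] d x
    by (simp add: m_assoc Units_closed)
qed

end

section \<open>The local case: \<open>Q\<close> is a field and \<open>V\<close> a discrete valuation
  ring\<close>

locale finite_local_normalization = finite_normalization +
  assumes R_local: "local_ring R" and dim_R: "krull_dim R \<le> 1"
    and regular_element: "\<exists>t\<in>max_ideal R. t \<in> nonzerodivisors R"
    and N_local: "local_ring N"
begin

sublocale R: local_cring R
  using R_cring R_local by (simp add: local_cring_def local_cring_axioms_def)

sublocale N: local_cring N
  using N_cring N_local by (simp add: local_cring_def local_cring_axioms_def)

abbreviation "m \<equiv> max_ideal R"
abbreviation "n \<equiv> max_ideal N"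

lemma m_sub: "a \<in> m \<Longrightarrow> a \<in> A"
  using R.in_max_ideal_iff by blast

lemma n_sub: "v \<in> n \<Longrightarrow> v \<in> V"
  using N.in_max_ideal_iff by simp

lemma unit_if_notin_n: "v \<in> V \<Longrightarrow> v \<notin> n \<Longrightarrow> \<exists>w\<in>V. v \<otimes> w = \<one>"
  using N.in_max_ideal_iff[of v] unfolding Units_def by auto

lemma n_mult: "v \<in> n \<Longrightarrow> w \<in> V \<Longrightarrow> v \<otimes> w \<in> n"
  using ideal.I_r_closed[OF N.max_ideal_ideal, of v w] by simp

lemma n_add: "v \<in> n \<Longrightarrow> w \<in> n \<Longrightarrow> v \<oplus> w \<in> n"
  using additive_subgroup.a_closed[OF ideal.axioms(1)[OF N.max_ideal_ideal], of v w] by simp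

lemma one_notin_n: "\<one> \<notin> n"
  using N.one_notin_max_ideal by simp

text \<open>The ideals generated by \<open>y\<close>, \<open>y / t\<close>, \<open>y / t^2\<close>
  and so on increase, so \<open>y / t^(k+1) = a y / t^k\<close> for some \<open>k\<close>, and the
  power of \<open>t\<close> cancels. The outcome \<open>(1 - a t) y = 0\<close> is read in two ways:
  if \<open>t\<close> lies in the maximal ideal, then \<open>y\<close> vanishes; if \<open>y\<close>
  is a unit of \<open>Q\<close>, then \<open>t\<close> is a unit of \<open>R\<close>.\<close>

lemma divisible_by_powers:
  assumes y: "y \<in> A" and t: "t \<in> nonzerodivisors R" and yt: "\<And>k::nat. y \<otimes> inv t [^] k \<in> A"
  shows "\<exists>a\<in>A. y = a \<otimes> t \<otimes> y"
proof -
  interpret noetherian_ring R by (rule noetherian)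
  have t: "t \<in> A" "t \<in> Units Q" using t nonzerodivisors_iff by auto
  define D where "D = (\<lambda>k. PIdl\<^bsub>R\<^esub> (y \<otimes> inv t [^] (k::nat)))"
  have c: "y \<in> carrier Q" "t \<in> carrier Q" "inv t \<in> carrier Q" using y t A_sub by auto
  have step: "y \<otimes> inv t [^] k = t \<otimes> (y \<otimes> inv t [^] Suc k)" for k :: nat
  proof -
    have "t \<otimes> (y \<otimes> inv t [^] Suc k) = (t \<otimes> inv t) \<otimes> (y \<otimes> inv t [^] k)"
      using c by (simp add: m_ac)
    then show ?thesis using t(2) c by simp
  qed
  have I: "\<And>I. I \<in> range D \<Longrightarrow> ideal I R"
    unfolding D_def using R.cgenideal_ideal yt by blast
  have "\<exists>J\<in>range D. \<forall>K\<in>range D. J \<subseteq> K \<longrightarrow> K = J"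
    by (rule exists_maximal_ideal_in) (use I in auto)
  then obtain J where J: "J \<in> range D" "\<forall>K\<in>range D. J \<subseteq> K \<longrightarrow> K = J"
    by blast
  then obtain k where k: "J = D k" by blast
  have "D k \<subseteq> D (Suc k)"
  proof -
    have "y \<otimes> inv t [^] k \<in> D (Suc k)"
      using step[of k] t(1) unfolding D_def cgenideal_def by (simp only: R_ops) blast
    moreover have "ideal (D (Suc k)) R" using I by blast
    moreover have "D k = PIdl\<^bsub>R\<^esub> (y \<otimes> inv t [^] k)" by (simp only: D_def)
    ultimately show ?thesis using R.cgenideal_minimal by simp
  qed
  then have "D (Suc k) = D k" using J(2) k by simp
  moreover have "y \<otimes> inv t [^] Suc k \<in> D (Suc k)"
    unfolding D_def by (rule R.cgenideal_self[OF yt])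
  ultimately have "y \<otimes> inv t [^] Suc k \<in> D k" by simp
  then obtain a where a: "a \<in> A" "y \<otimes> inv t [^] Suc k = a \<otimes> (y \<otimes> inv t [^] k)"
    unfolding D_def cgenideal_def by auto
  have inv_pow: "inv t [^] k \<in> Units Q" using t(2) by (induction k) auto
  have "inv t [^] k \<otimes> y = y \<otimes> inv t [^] k"
    using c by (simp add: m_comm)
  also have "\<dots> = t \<otimes> (a \<otimes> (y \<otimes> inv t [^] k))"
    unfolding a(2)[symmetric] by (rule step)
  also have "\<dots> = inv t [^] k \<otimes> (a \<otimes> t \<otimes> y)"
    using c A_sub[OF a(1)] by (simp add: m_ac)
  finally have "y = a \<otimes> t \<otimes> y"
    using Units_l_cancel[OF inv_pow, of y "a \<otimes> t \<otimes> y"] c A_sub[OF a(1)] by simp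
  then show ?thesis using a(1) by blast
qed

text \<open>Dividing \<open>x\<close> by powers of \<open>t\<close> keeps it nilpotent, hence
  integral, so \<open>c x\<close> is divisible by every power of \<open>t\<close> in
  \<open>R\<close>. This gives \<open>(1 - a t) c x = 0\<close>, where \<open>1 - a t\<close> is a
  unit of \<open>R\<close> because \<open>t\<close> lies in the maximal ideal.\<close>

lemma nilpotent_zero:
  assumes x: "x \<in> carrier Q" "x [^] (k::nat) = \<zero>"
  shows "x = \<zero>"
proof -
  obtain t where t: "t \<in> m" "t \<in> nonzerodivisors R" using regular_element by blast
  obtain c where c: "c \<in> nonzerodivisors R" "\<forall>v\<in>V. c \<otimes> v \<in> A" using conductor by blast
  have u: "t \<in> Units Q" "c \<in> Units Q" "t \<in> carrier Q" "c \<in> carrier Q"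
    using t(2) c(1) A_sub by (auto simp: nonzerodivisors_iff)
  have "(x \<otimes> inv t [^] j) [^] k = \<zero>" for j :: nat
    using x u by (simp add: nat_pow_distrib)
  then have "x \<otimes> inv t [^] j \<in> V" for j :: nat
    using V_nilpotent[of "x \<otimes> inv t [^] j" k] x(1) u by simp
  then have "c \<otimes> x \<otimes> inv t [^] j \<in> A" for j :: nat
    using c(2) u x(1) by (simp add: m_assoc)
  moreover from this[of 0] have "c \<otimes> x \<in> A" using u x(1) by simp
  ultimately obtain a where a: "a \<in> A" "c \<otimes> x = a \<otimes> t \<otimes> (c \<otimes> x)"
    using divisible_by_powers[OF _ t(2)] by blast
  define w where "w = \<one> \<ominus> a \<otimes> t"
  have ac: "a \<in> carrier Q" using a(1) A_sub by blast
  have at: "a \<otimes> t \<in> m"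
    using ideal.I_l_closed[OF R.max_ideal_ideal t(1) a(1)] by simp
  have wA: "w \<in> A" using a(1) m_sub[OF t(1)] unfolding w_def a_minus_def by simp
  have "w \<notin> m"
  proof
    assume "w \<in> m"
    then have "w \<oplus> a \<otimes> t \<in> m"
      using additive_subgroup.a_closed[OF ideal.axioms(1)[OF R.max_ideal_ideal] _ at] by simp
    moreover have "w \<oplus> a \<otimes> t = \<one>" unfolding w_def using ac u by algebra
    ultimately show False using R.one_notin_max_ideal by simp
  qed
  then obtain w' where w': "w' \<in> A" "w' \<otimes> w = \<one>"
    using wA R.in_max_ideal_iff[of w] unfolding Units_def by auto
  have wc: "w \<in> carrier Q" "w' \<in> carrier Q" using wA w' A_sub by auto
  have "w \<otimes> (c \<otimes> x) = c \<otimes> x \<ominus> a \<otimes> t \<otimes> (c \<otimes> x)"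
    unfolding w_def using ac u x by algebra
  also have "\<dots> = \<zero>" using a(2) u x(1) by (simp add: a_minus_def r_neg)
  finally have "w' \<otimes> w \<otimes> (c \<otimes> x) = \<zero>" using wc u x(1) by (simp add: m_assoc)
  then have "c \<otimes> x = \<zero>" using w'(2) u x(1) by simp
  then show "x = \<zero>" using u x(1) Units_l_cancel[of c x \<zero>] by simp
qed

text \<open>If \<open>inv a\<close> is in \<open>V\<close>, so are its powers, and a conductor
  element \<open>c\<close> is divisible by every power of \<open>a\<close> in \<open>R\<close>. Then
  \<open>c = b a c\<close>, so \<open>b a = 1\<close>. In other words, a regular element of
  \<open>m\<close> stays a nonunit in \<open>V\<close>.\<close>

lemma A_unit_if_V_unit:
  assumes "a \<in> nonzerodivisors R" "inv a \<in> V"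
  shows "a \<notin> m"
proof
  assume am: "a \<in> m"
  obtain c where c: "c \<in> nonzerodivisors R" "\<forall>v\<in>V. c \<otimes> v \<in> A" using conductor by blast
  have u: "a \<in> Units Q" "c \<in> Units Q" "a \<in> carrier Q" "c \<in> carrier Q" "c \<in> A"
    using assms(1) c(1) A_sub by (auto simp: nonzerodivisors_iff)
  have "inv a [^] k \<in> V" for k :: nat
    using assms(2) by (induction k) auto
  then obtain b where b: "b \<in> A" "c = b \<otimes> a \<otimes> c"
    using divisible_by_powers[OF u(5) assms(1)] c(2) by blast
  have "b \<in> carrier Q" using b(1) A_sub by blast
  then have "c \<otimes> \<one> = c \<otimes> (b \<otimes> a)" using b(2) u m_comm by (metis m_closed r_one)
  then have "\<one> = b \<otimes> a"
    using Units_l_cancel[OF u(2), of \<one> "b \<otimes> a"] \<open>b \<in> carrier Q\<close> u by simp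
  moreover have "b \<otimes> a \<in> m"
    using ideal.I_l_closed[OF R.max_ideal_ideal am b(1)] by simp
  ultimately show False using R.one_notin_max_ideal by simp
qed

text \<open>Both \<open>e\<close> and \<open>1 - e\<close> are integral and add up to one, so one of
  them is a unit of the local ring \<open>V\<close>, while their product is zero.\<close>

lemma idempotent_trivial:
  assumes e: "e \<in> carrier Q" "e \<otimes> e = e"
  shows "e = \<zero> \<or> e = \<one>"
proof -
  have V: "e \<in> V" "\<one> \<ominus> e \<in> V"
    using V_idempotent[OF e] by (simp_all add: a_minus_def)
  have z: "e \<otimes> (\<one> \<ominus> e) = \<zero>" using e by (simp add: a_minus_def r_distr r_minus r_neg)
  have c: "\<one> \<ominus> e \<in> carrier Q" using e(1) by simp
  have "e \<notin> n \<or> \<one> \<ominus> e \<notin> n"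
  proof (rule ccontr)
    assume "\<not> ?thesis"
    then have "e \<oplus> (\<one> \<ominus> e) \<in> n" using n_add by blast
    moreover have "e \<oplus> (\<one> \<ominus> e) = \<one>" using e(1) by algebra
    ultimately show False using one_notin_n by simp
  qed
  then show ?thesis
  proof
    assume "e \<notin> n"
    then obtain w where w: "w \<in> V" "e \<otimes> w = \<one>" using unit_if_notin_n V by blast
    have wc: "w \<in> carrier Q" using w V_sub by blast
    have "e = e \<otimes> (e \<otimes> w)" using w(2) e(1) by simp
    also have "\<dots> = \<one>" using m_assoc[of e e w] e w(2) wc by simp
    finally show ?thesis by simp
  next
    assume "\<one> \<ominus> e \<notin> n"
    then obtain w where w: "w \<in> V" "(\<one> \<ominus> e) \<otimes> w = \<one>" using unit_if_notin_n V by blast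
    have wc: "w \<in> carrier Q" using w V_sub by blast
    have "e = e \<otimes> ((\<one> \<ominus> e) \<otimes> w)" using w(2) e(1) by simp
    also have "\<dots> = \<zero>" using m_assoc[of e "\<one> \<ominus> e" w] e c wc z by simp
    finally show ?thesis by simp
  qed
qed

text \<open>With \<open>w = z / t^i\<close> the identity for dimension at most one reads
  \<open>x^k = x^k (x w)\<close>, so \<open>e = (x w)^k\<close> is an idempotent with
  \<open>x^k e = x^k\<close>. If \<open>e = 0\<close>, then \<open>x\<close> is nilpotent and hence
  zero; if \<open>e = 1\<close>, then \<open>e = x w e\<close> shows \<open>x w = 1\<close>.\<close>

lemma A_nonzero_unit:
  assumes x: "x \<in> A" "x \<noteq> \<zero>"
  shows "x \<in> Units Q"
proof -
  obtain t where t: "t \<in> m" "t \<in> nonzerodivisors R" using regular_element by blast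
  have u: "t \<in> Units Q" "t \<in> A" "t \<in> carrier Q" "x \<in> carrier Q"
    using t(2) A_sub x by (auto simp: nonzerodivisors_iff)
  obtain k i z where z: "z \<in> A" "x [^] (k::nat) \<otimes> (t [^] (i::nat) \<ominus>\<^bsub>R\<^esub> x \<otimes> z) = \<zero>"
    using R.krull_dim_le_1_power_mult[OF dim_R t(1) x(1)] by auto
  have zc: "z \<in> carrier Q" using z A_sub by blast
  have tp: "t [^] i \<in> Units Q" using u(1) by (induction i) auto
  define w where "w = z \<otimes> inv (t [^] i)"
  have wc: "w \<in> carrier Q" using zc tp unfolding w_def by simp
  have "t [^] i \<ominus>\<^bsub>R\<^esub> x \<otimes> z = t [^] i \<ominus> x \<otimes> z"
    using z(1) x(1) by (simp add: a_minus_def R_minus)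
  then have "x [^] k \<otimes> t [^] i \<ominus> x [^] k \<otimes> (x \<otimes> z) = \<zero>"
    using z(2) u zc by (simp add: a_minus_def r_distr r_minus)
  then have "x [^] k \<otimes> t [^] i = x [^] k \<otimes> (x \<otimes> z)"
    using u zc by (simp add: r_right_minus_eq)
  then have "x [^] k \<otimes> t [^] i \<otimes> inv (t [^] i) = x [^] k \<otimes> (x \<otimes> z) \<otimes> inv (t [^] i)" by simp
  then have xk: "x [^] k = x [^] k \<otimes> (x \<otimes> w)"
    using u tp zc unfolding w_def by (simp add: m_assoc)
  have xkj: "x [^] k = x [^] k \<otimes> (x \<otimes> w) [^] j" for j :: nat
  proof (induction j)
    case (Suc j)
    have "x [^] k \<otimes> (x \<otimes> w) [^] Suc j = (x [^] k \<otimes> (x \<otimes> w) [^] j) \<otimes> (x \<otimes> w)"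
      using u wc by (simp add: m_assoc)
    then show ?case using Suc xk by simp
  qed (use u in simp)
  define e where "e = (x \<otimes> w) [^] k"
  have ec: "e \<in> carrier Q" using u wc unfolding e_def by simp
  have ex: "e = x [^] k \<otimes> w [^] k" unfolding e_def using u wc by (simp add: nat_pow_distrib)
  have xe: "x [^] k \<otimes> e = x [^] k" using xkj[of k] unfolding e_def by simp
  have "e \<otimes> e = (x [^] k \<otimes> e) \<otimes> w [^] k"
    using u wc ec unfolding ex by (simp add: m_ac)
  then have "e \<otimes> e = e" using xe ex by simp
  then consider "e = \<zero>" | "e = \<one>" using idempotent_trivial ec by blast
  then show ?thesis
  proof cases
    case 1
    then have "x [^] k = \<zero>" using xe u by simp
    then show ?thesis using nilpotent_zero u x(2) by blast
  next
    case 2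
    have "e = (x [^] k \<otimes> (x \<otimes> w)) \<otimes> w [^] k" using ex xk by simp
    also have "\<dots> = x \<otimes> w \<otimes> e" using u wc unfolding ex by (simp add: m_ac)
    finally have "x \<otimes> w = \<one>" using 2 u wc by simp
    then show ?thesis using u wc m_comm[of x w] unfolding Units_def by auto
  qed
qed

lemma Q_field: "q \<in> carrier Q \<Longrightarrow> q \<noteq> \<zero> \<Longrightarrow> q \<in> Units Q"
proof -
  assume q: "q \<in> carrier Q" "q \<noteq> \<zero>"
  obtain s where s: "s \<in> nonzerodivisors R" "s \<otimes> q \<in> A" using denominator[OF q(1)] by blast
  have su: "s \<in> Units Q" using s(1) nonzerodivisors_iff by blast
  then have "s \<otimes> q \<noteq> \<zero>" using q Units_l_cancel[of s q \<zero>] Units_closed by force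
  then have "s \<otimes> q \<in> Units Q" using A_nonzero_unit s(2) by blast
  then show "q \<in> Units Q" using unit_factor[of q s] su q(1) m_comm Units_closed by metis
qed

sublocale field Q
  by (rule cring_fieldI) (use Q_field one_not_zero in \<open>auto simp: Units_def\<close>)

lemma nonzerodivisors_eq: "s \<in> nonzerodivisors R \<longleftrightarrow> s \<in> A \<and> s \<noteq> \<zero>"
  using nonzerodivisors_iff A_nonzero_unit field_Units by blast

text \<open>The colon ideal \<open>t V : b\<close>, that is, the annihilator of the class of
  \<open>b\<close> in \<open>V / t V\<close>. A prime of this form is an associated prime of
  \<open>t V\<close>.\<close>

definition transporter :: "'a \<Rightarrow> 'a \<Rightarrow> 'a set" where
  "transporter t b = {v \<in> V. \<exists>w\<in>V. v \<otimes> b = t \<otimes> w}"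

lemma transporter_mult:
  assumes "t \<in> V" "b \<in> V" "x \<in> transporter t b" "v \<in> V"
  shows "x \<otimes> v \<in> transporter t b"
proof -
  obtain w where w: "x \<in> V" "w \<in> V" "x \<otimes> b = t \<otimes> w"
    using assms unfolding transporter_def by blast
  have c: "x \<in> carrier Q" "w \<in> carrier Q" "v \<in> carrier Q" "t \<in> carrier Q" "b \<in> carrier Q"
    using w assms V_sub by auto
  have "x \<otimes> v \<otimes> b = v \<otimes> (x \<otimes> b)" using c by (simp add: m_ac)
  also have "\<dots> = t \<otimes> (v \<otimes> w)" unfolding w(3) using c by (simp add: m_ac)
  finally show ?thesis unfolding transporter_def using w assms by auto
qed

lemma transporter_add:
  assumes "t \<in> V" "b \<in> V" "x \<in> transporter t b" "y \<in> transporter t b"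
  shows "x \<oplus> y \<in> transporter t b"
proof -
  obtain w w' where w: "x \<in> V" "w \<in> V" "x \<otimes> b = t \<otimes> w" "y \<in> V" "w' \<in> V" "y \<otimes> b = t \<otimes> w'"
    using assms unfolding transporter_def by blast
  have c: "x \<in> carrier Q" "w \<in> carrier Q" "y \<in> carrier Q" "w' \<in> carrier Q"
    "t \<in> carrier Q" "b \<in> carrier Q"
    using w assms V_sub by auto
  have "(x \<oplus> y) \<otimes> b = t \<otimes> (w \<oplus> w')" using c w by (simp add: l_distr r_distr)
  then show ?thesis unfolding transporter_def using w by auto
qed

text \<open>A maximal element among the proper ideals \<open>t V : b\<close> is prime; the conductor turns them into
  ideals of \<open>R\<close>, so that \<open>R\<close> being Noetherian suffices.\<close>

lemma exists_prime_transporter: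
  assumes t: "t \<in> V" "inv t \<notin> V" "t \<noteq> \<zero>"
  shows "\<exists>b\<in>V. \<one> \<notin> transporter t b \<and>
    (\<forall>y\<in>V. \<forall>z\<in>V. y \<otimes> z \<in> transporter t b \<longrightarrow> y \<in> transporter t b \<or> z \<in> transporter t b)"
proof -
  interpret noetherian_ring R by (rule noetherian)
  obtain c where c: "c \<in> nonzerodivisors R" "\<forall>v\<in>V. c \<otimes> v \<in> A" using conductor by blast
  have cu: "c \<in> Units Q" "c \<in> A" "c \<in> carrier Q"
    using c(1) A_sub by (auto simp: nonzerodivisors_iff)
  have tc: "t \<in> carrier Q" "t \<in> Units Q" using t V_sub Q_field by auto
  define F where "F = {(\<lambda>v. c \<otimes> v) ` transporter t b |b. b \<in> V \<and> \<one> \<notin> transporter t b}"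
  have sub: "transporter t b \<subseteq> V" for b unfolding transporter_def by blast
  have ideal: "ideal I R" if IF: "I \<in> F" for I
  proof -
    obtain b where b: "b \<in> V" "I = (\<lambda>v. c \<otimes> v) ` transporter t b" using IF F_def by blast
    have mult: "a \<otimes> x \<in> I" if ax: "a \<in> A" "x \<in> I" for a x
    proof -
      obtain v where v: "v \<in> transporter t b" "x = c \<otimes> v" using ax b by blast
      have "a \<otimes> x = c \<otimes> (v \<otimes> a)"
        using v sub V_sub ax A_sub cu by (simp add: m_ac subset_iff)
      then show ?thesis using transporter_mult[OF t(1) b(1) v(1) A_sub_V[OF ax(1)]] b(2) by blast
    qed
    have IA: "I \<subseteq> A" using b sub c(2) by blast
    show ?thesis
    proof (rule idealI)
      show "ring R" using R_cring cring.axioms(1) by blast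
      show "subgroup I (add_monoid R)"
      proof
        show "I \<subseteq> carrier (add_monoid R)" using IA by simp
        have "\<zero> \<in> transporter t b" unfolding transporter_def
          using b(1) tc V_sub by (auto intro!: bexI[of _ \<zero>])
        then show "\<one>\<^bsub>add_monoid R\<^esub> \<in> I" using b(2) cu by force
        fix x y assume "x \<in> I" "y \<in> I"
        then obtain v w where v: "v \<in> transporter t b" "x = c \<otimes> v" "w \<in> transporter t b" "y = c \<otimes> w"
          using b by blast
        then have "x \<oplus> y = c \<otimes> (v \<oplus> w)"
          using sub V_sub cu by (simp add: r_distr subset_iff)
        then show "x \<otimes>\<^bsub>add_monoid R\<^esub> y \<in> I"
          using transporter_add[OF t(1) b(1) v(1,3)] b(2) by simp
        have "x \<in> A" using \<open>x \<in> I\<close> IA by blast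
        then have "\<ominus>\<^bsub>R\<^esub> x \<in> I"
          using mult[of "\<ominus> \<one>" x] \<open>x \<in> I\<close> by (simp add: R_minus l_minus A_sub)
        then show "inv\<^bsub>add_monoid R\<^esub> x \<in> I" by (simp add: a_inv_def)
      qed
      fix x a assume xa: "x \<in> I" "a \<in> A"
      have "x \<in> carrier Q" "a \<in> carrier Q" using xa IA A_sub by blast+
      then show "a \<otimes>\<^bsub>R\<^esub> x \<in> I" "x \<otimes>\<^bsub>R\<^esub> a \<in> I"
        using mult[OF xa(2,1)] m_comm[of a x] by auto
    qed
  qed
  \<comment> \<open>For \<open>b = 1\<close> the colon ideal is \<open>t V\<close>, which is proper
    because \<open>inv t\<close> is not in \<open>V\<close>; so the family is not empty.\<close>
  have "\<one> \<notin> transporter t \<one>"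
  proof
    assume "\<one> \<in> transporter t \<one>"
    then obtain w where w: "w \<in> V" "\<one> = t \<otimes> w" unfolding transporter_def by auto
    have "w = inv t"
      using w V_sub tc comm_inv_char[of t w] by simp
    then show False using w t(2) by simp
  qed
  then have ne: "F \<noteq> {}" unfolding F_def using V_closed(2) by blast
  have "\<exists>J\<in>F. \<forall>K\<in>F. J \<subseteq> K \<longrightarrow> K = J"
    by (rule exists_maximal_ideal_in[OF ne]) (use ideal in auto)
  then obtain J where J: "J \<in> F" "\<forall>K\<in>F. J \<subseteq> K \<longrightarrow> K = J" by blast
  from J(1) obtain b where b: "b \<in> V" "\<one> \<notin> transporter t b"
    and Jb: "J = (\<lambda>v. c \<otimes> v) ` transporter t b"
    unfolding F_def by blast
  have max: "(\<lambda>v. c \<otimes> v) ` transporter t b' = (\<lambda>v. c \<otimes> v) ` transporter t b"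
    if b': "b' \<in> V" "\<one> \<notin> transporter t b'" "transporter t b \<subseteq> transporter t b'" for b'
  proof -
    have "(\<lambda>v. c \<otimes> v) ` transporter t b' \<in> F" unfolding F_def using b' by blast
    moreover have "J \<subseteq> (\<lambda>v. c \<otimes> v) ` transporter t b'"
      unfolding Jb using b'(3) by (rule image_mono)
    ultimately show ?thesis using J(2) Jb by simp
  qed
  have bc: "b \<in> carrier Q" using b V_sub by blast
  have "y \<in> transporter t b"
    if yz: "y \<in> V" "z \<in> V" "y \<otimes> z \<in> transporter t b" "z \<notin> transporter t b" for y z
  proof -
    have yc: "y \<in> carrier Q" "z \<in> carrier Q" using yz V_sub by auto
    \<comment> \<open>The competitor in the maximality argument is \<open>b z\<close>: its colon
      ideal contains that of \<open>b\<close>, is proper because \<open>z\<close> lies outside the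
      colon ideal of \<open>b\<close>, and contains \<open>y\<close>.\<close>
    have bz: "b \<otimes> z \<in> V" using b(1) yz by simp
    have "\<one> \<notin> transporter t (b \<otimes> z)"
    proof
      assume "\<one> \<in> transporter t (b \<otimes> z)"
      then obtain w where "w \<in> V" "z \<otimes> b = t \<otimes> w"
        using bc yc m_comm unfolding transporter_def by auto
      then show False using yz(2,4) unfolding transporter_def by blast
    qed
    moreover have "transporter t b \<subseteq> transporter t (b \<otimes> z)"
    proof
      fix v assume v: "v \<in> transporter t b"
      then obtain w where w: "v \<in> V" "w \<in> V" "v \<otimes> b = t \<otimes> w" unfolding transporter_def by blast
      have "v \<otimes> (b \<otimes> z) = t \<otimes> (w \<otimes> z)"
        using w V_sub bc yc tc m_assoc[of v b z] m_assoc[of t w z] by simp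
      then show "v \<in> transporter t (b \<otimes> z)" using w yz unfolding transporter_def by auto
    qed
    ultimately have eq: "(\<lambda>v. c \<otimes> v) ` transporter t (b \<otimes> z) = (\<lambda>v. c \<otimes> v) ` transporter t b"
      using max[OF bz] by blast
    obtain w where w: "w \<in> V" "y \<otimes> z \<otimes> b = t \<otimes> w"
      using yz(3) unfolding transporter_def by blast
    have "y \<otimes> (b \<otimes> z) = t \<otimes> w" using w bc yc by (simp add: m_ac)
    then have "y \<in> transporter t (b \<otimes> z)" using yz(1) w(1) unfolding transporter_def by blast
    then have "c \<otimes> y \<in> (\<lambda>v. c \<otimes> v) ` transporter t b" using eq by blast
    then obtain v where v: "v \<in> transporter t b" "c \<otimes> y = c \<otimes> v" by blast
    have "v \<in> carrier Q" using v(1) sub V_sub by blast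
    then show ?thesis using v Units_l_cancel[OF cu(1) yc(1)] by simp
  qed
  then show ?thesis using b by blast
qed

text \<open>A prime \<open>P = t V : b\<close> turns out to be all of \<open>n\<close>, and the
  uniformizer is the inverse of the fraction \<open>x = b / t\<close>. This fraction is not in
  \<open>V\<close>, but \<open>x P \<subseteq> V\<close>. If \<open>x P\<close> stayed inside
  \<open>P\<close>, all \<open>t x^j\<close> would lie in \<open>V\<close>, which would force
  \<open>x\<close> into \<open>V\<close>. So \<open>x\<close> carries some element of
  \<open>P\<close> to a unit, whence \<open>1 / x\<close> lies in \<open>n\<close>, and
  \<open>z = (1 / x) (x z)\<close> for every \<open>z\<close> in \<open>n\<close>.\<close>

lemma uniformizer:
  obtains \<pi> where "\<pi> \<in> n" "\<pi> \<noteq> \<zero>" "\<And>z. z \<in> n \<Longrightarrow> \<exists>v\<in>V. z = \<pi> \<otimes> v"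
proof -
  obtain t where t: "t \<in> m" "t \<in> nonzerodivisors R" using regular_element by blast
  have tV: "t \<in> V" "t \<noteq> \<zero>" "t \<in> carrier Q" "t \<in> Units Q" "t \<in> A"
    using m_sub[OF t(1)] A_sub_V t(2) nonzerodivisors_eq nonzerodivisors_iff A_sub by auto
  have tinv: "inv t \<notin> V" using A_unit_if_V_unit[OF t(2)] t(1) by blast
  obtain b where b: "b \<in> V" "\<one> \<notin> transporter t b"
    "\<And>y z. y \<in> V \<Longrightarrow> z \<in> V \<Longrightarrow> y \<otimes> z \<in> transporter t b \<Longrightarrow> y \<in> transporter t b \<or> z \<in> transporter t b"
    using exists_prime_transporter[OF tV(1) tinv tV(2)] by blast
  define P where "P = transporter t b"
  have P: "\<one> \<notin> P" "\<And>y z. y \<in> V \<Longrightarrow> z \<in> V \<Longrightarrow> y \<otimes> z \<in> P \<Longrightarrow> y \<in> P \<or> z \<in> P"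
    "\<And>x v. x \<in> P \<Longrightarrow> v \<in> V \<Longrightarrow> x \<otimes> v \<in> P" "\<And>x y. x \<in> P \<Longrightarrow> y \<in> P \<Longrightarrow> x \<oplus> y \<in> P"
    using b transporter_mult[OF tV(1) b(1)] transporter_add[OF tV(1) b(1)] unfolding P_def by blast+
  have PV: "P \<subseteq> V" unfolding P_def transporter_def by blast
  have bc: "b \<in> carrier Q" using b V_sub by blast
  have tP: "t \<in> P" unfolding P_def transporter_def using b(1) tV by blast
  have PV_mult: "v \<otimes> x \<in> P" if "x \<in> P" "v \<in> V" for x v
    using P(3)[OF that] m_comm[of v x] that PV V_sub by auto
  have P_n: "P \<subseteq> n"
  proof
    fix z assume z: "z \<in> P"
    show "z \<in> n"
    proof (rule ccontr)
      assume "z \<notin> n"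
      then obtain w where "w \<in> V" "z \<otimes> w = \<one>" using unit_if_notin_n z PV by blast
      then show False using P(1) P(3)[OF z] by force
    qed
  qed
  \<comment> \<open>Dimension at most one makes some power of \<open>a\<close> a multiple of
    \<open>t\<close>, because \<open>t^k\<close> can be cancelled; \<open>P\<close> contains
    \<open>t\<close> and is prime.\<close>
  have m_P: "a \<in> P" if a: "a \<in> m" for a
  proof -
    have aA: "a \<in> A" "a \<in> V" using a m_sub A_sub_V by auto
    obtain k i z where z: "z \<in> A" "t [^] (k::nat) \<otimes> (a [^] (i::nat) \<ominus>\<^bsub>R\<^esub> t \<otimes> z) = \<zero>"
      using R.krull_dim_le_1_power_mult[OF dim_R a tV(5)] by auto
    have c: "a \<in> carrier Q" "z \<in> carrier Q" using aA z A_sub by auto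
    have "a [^] i \<ominus>\<^bsub>R\<^esub> t \<otimes> z = a [^] i \<ominus> t \<otimes> z"
      using z(1) tV by (simp add: a_minus_def R_minus)
    then have "t [^] k \<otimes> (a [^] i \<ominus> t \<otimes> z) = \<zero>" using z(2) by simp
    moreover have "t [^] k \<in> Units Q" using tV(4) by (induction k) auto
    ultimately have "a [^] i \<ominus> t \<otimes> z = \<zero>"
      using integral_iff[of "t [^] k" "a [^] i \<ominus> t \<otimes> z"] c tV field_Units by auto
    then have "a [^] i = t \<otimes> z" using c tV by (simp add: r_right_minus_eq)
    then have "a [^] i \<in> P" using P(3)[OF tP] A_sub_V z(1) by simp
    then show "a \<in> P"
    proof (induction i)
      case 0
      then show ?case using P(1) by simp
    next
      case (Suc i)
      moreover have "a [^] i \<in> V" using aA(2) by (induction i) auto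
      ultimately show ?case using P(2)[of "a [^] i" a] aA(2) by auto
    qed
  qed
  have n_P: "y \<in> P" if y: "y \<in> n" for y
  proof -
    have yV: "y \<in> V" "y \<in> carrier Q" using y n_sub V_sub by auto
    have eval_V: "eval p y \<in> V" if "set p \<subseteq> A" for p
      using that
    proof (induction p)
      case (Cons a p)
      have "y [^] k \<in> V" for k :: nat using yV(1) by (induction k) auto
      then show ?case using Cons A_sub_V by simp
    qed simp
    \<comment> \<open>If a monic expression \<open>f y + a\<close> lies in \<open>P\<close>, its
      constant term \<open>a\<close> lies in \<open>n\<close> together with \<open>y\<close>, hence
      in \<open>m\<close>, as units of \<open>R\<close> are units of \<open>V\<close>, and hence in
      \<open>P\<close>. So \<open>P\<close> contains \<open>f y\<close>, thus \<open>y\<close>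
      itself or the shorter monic expression \<open>f\<close>; the empty tail is excluded since one
      is not in \<open>P\<close>. Applied to a monic equation of \<open>y\<close>, this is the
      incomparability of primes over \<open>m\<close>.\<close>
    have main: "y \<in> P" if "set q \<subseteq> A" "eval (\<one> # q) y \<in> P" for q
      using that
    proof (induction q rule: rev_induct)
      case Nil
      then show ?case using P(1) by simp
    next
      case (snoc a q)
      have aA: "a \<in> A" "set q \<subseteq> A" using snoc.prems by auto
      have eqV: "eval (\<one> # q) y \<in> V" using eval_V[of "\<one> # q"] aA by simp
      have s: "set (\<one> # q) \<subseteq> carrier Q" using aA A_sub by auto
      have ev: "eval (\<one> # (q @ [a])) y = eval (\<one> # q) y \<otimes> y \<oplus> a"
        using eval_append_aux[OF s A_sub[OF aA(1)] yV(2)] by simp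
      define f where "f = eval (\<one> # q) y"
      have f: "f \<in> V" "f \<in> carrier Q" using eqV V_sub unfolding f_def by auto
      have ac: "a \<in> carrier Q" using aA A_sub by blast
      have sum: "f \<otimes> y \<oplus> a \<in> P" using snoc.prems ev f_def by simp
      have fy: "f \<otimes> y \<in> n" using n_mult[OF y f(1)] m_comm f(2) yV(2) by simp
      have "a = (f \<otimes> y \<oplus> a) \<oplus> (f \<otimes> y) \<otimes> (\<ominus> \<one>)"
        using f(2) yV(2) ac by algebra
      also have "\<dots> \<in> n"
        using n_add n_mult[OF fy, of "\<ominus> \<one>"] sum P_n by auto
      finally have an: "a \<in> n" .
      have "a \<in> m"
      proof (rule ccontr)
        assume "a \<notin> m"
        then obtain w where w: "w \<in> A" "a \<otimes> w = \<one>"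
          using R.in_max_ideal_iff[of a] aA(1) unfolding Units_def by auto
        then show False using n_mult[OF an A_sub_V[OF w(1)]] one_notin_n by simp
      qed
      then have "a \<otimes> (\<ominus> \<one>) \<in> P" using m_P P(3) by simp
      then have "(f \<otimes> y \<oplus> a) \<oplus> a \<otimes> (\<ominus> \<one>) \<in> P" using P(4) sum by blast
      moreover have "(f \<otimes> y \<oplus> a) \<oplus> a \<otimes> (\<ominus> \<one>) = f \<otimes> y"
        using f(2) yV(2) ac by algebra
      ultimately have "f \<in> P \<or> y \<in> P" using P(2) f(1) yV(1) by simp
      then show ?case using snoc.IH aA(2) f_def by blast
    qed
    obtain q where q: "set q \<subseteq> A" "eval (\<one> # q) y = \<zero>" using V_E[OF yV(1)] by blast
    have "\<zero> \<in> P" using P(3)[OF tP, of \<zero>] tV by simp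
    then show ?thesis using main q by simp
  qed
  define x where "x = b \<otimes> inv t"
  have xc: "x \<in> carrier Q" unfolding x_def using bc tV by simp
  have xt: "x \<otimes> t = b" unfolding x_def using bc tV by (simp add: m_assoc)
  have x_V: "x \<notin> V"
  proof
    assume "x \<in> V"
    then have "\<one> \<in> P" unfolding P_def transporter_def using xt xc tV m_comm bc
      by (auto intro!: bexI[of _ x])
    then show False using P(1) by blast
  qed
  have xP: "x \<otimes> y \<in> V" if y: "y \<in> P" for y
  proof -
    obtain w where w: "w \<in> V" "y \<otimes> b = t \<otimes> w" using y unfolding P_def transporter_def by blast
    have c: "y \<in> carrier Q" "w \<in> carrier Q" using y w PV V_sub by auto
    have "t \<otimes> (x \<otimes> y) = (x \<otimes> t) \<otimes> y" using c xc tV by (simp add: m_ac)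
    also have "\<dots> = t \<otimes> w" using xt w c bc m_comm by simp
    finally have "x \<otimes> y = w" using Units_l_cancel[OF tV(4)] c xc by simp
    then show ?thesis using w by simp
  qed
  have "\<exists>y\<in>P. x \<otimes> y \<notin> P"
  proof (rule ccontr)
    assume "\<not> ?thesis"
    then have all: "\<And>y. y \<in> P \<Longrightarrow> x \<otimes> y \<in> P" by blast
    have "t \<otimes> x [^] j \<in> P" for j :: nat
    proof (induction j)
      case (Suc j)
      have "t \<otimes> x [^] Suc j = x \<otimes> (t \<otimes> x [^] j)" using tV xc by (simp add: m_ac)
      then show ?case using all[OF Suc] by simp
    qed (use tP tV in simp)
    then have "x \<in> V" using completely_integrally_closed[OF xc tV(4)] PV by blast
    then show False using x_V by blast
  qed
  then obtain y where y: "y \<in> P" "x \<otimes> y \<notin> P" by blast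
  have yc: "y \<in> V" "y \<in> carrier Q" using y PV V_sub by auto
  obtain w where w: "w \<in> V" "x \<otimes> y \<otimes> w = \<one>"
    using unit_if_notin_n[OF xP[OF y(1)]] n_P y(2) by blast
  have wc: "w \<in> carrier Q" using w V_sub by blast
  define \<pi> where "\<pi> = y \<otimes> w"
  have \<pi>c: "\<pi> \<in> carrier Q" unfolding \<pi>_def using yc wc by simp
  have x\<pi>: "x \<otimes> \<pi> = \<one>" unfolding \<pi>_def using w(2) yc wc xc by (simp add: m_assoc)
  show thesis
  proof (rule that[of \<pi>])
    show "\<pi> \<in> n" unfolding \<pi>_def using n_mult[OF subsetD[OF P_n y(1)] w(1)] .
    show "\<pi> \<noteq> \<zero>" using x\<pi> xc one_not_zero by auto
    fix z assume z: "z \<in> n"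
    have zc: "z \<in> carrier Q" using z n_sub V_sub by blast
    have "\<pi> \<otimes> (x \<otimes> z) = x \<otimes> \<pi> \<otimes> z" using \<pi>c xc zc by (simp add: m_ac)
    then have "z = \<pi> \<otimes> (x \<otimes> z)" using x\<pi> zc by simp
    then show "\<exists>v\<in>V. z = \<pi> \<otimes> v" using xP[OF n_P[OF z]] by blast
  qed
qed

text \<open>A generator is an element \<open>g\<close> for which \<open>d g\<close> has least
  valuation: if \<open>d g = u \<pi>^j\<close> with a unit \<open>u\<close>, every nonzero
  \<open>d y\<close> is a unit times \<open>\<pi>^i\<close> with \<open>i \<ge> j\<close>. The
  factor \<open>d\<close> moves \<open>I\<close> into \<open>V\<close>, where valuations are natural
  numbers and a least one exists.\<close>

lemma principal:
  assumes I: "I \<subseteq> carrier Q" "\<And>v y. v \<in> V \<Longrightarrow> y \<in> I \<Longrightarrow> v \<otimes> y \<in> I"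
    and nz: "\<exists>y\<in>I. y \<noteq> \<zero>"
    and d: "d \<in> carrier Q" "d \<noteq> \<zero>" "\<And>y. y \<in> I \<Longrightarrow> d \<otimes> y \<in> V"
  shows "\<exists>g\<in>I. g \<noteq> \<zero> \<and> (\<forall>y\<in>I. \<exists>v\<in>V. y = v \<otimes> g)"
proof -
  obtain \<pi> where p: "\<pi> \<in> n" "\<pi> \<noteq> \<zero>" "\<And>z. z \<in> n \<Longrightarrow> \<exists>v\<in>V. z = \<pi> \<otimes> v"
    using uniformizer by blast
  have pc: "\<pi> \<in> V" "\<pi> \<in> carrier Q" "\<pi> \<in> Units Q" using p n_sub V_sub Q_field by auto
  have pk: "\<pi> [^] k \<in> Units Q" "\<pi> [^] k \<in> V" for k :: nat
    using pc by (induction k) auto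
  \<comment> \<open>If all \<open>v / \<pi>^j\<close> were in \<open>V\<close>, bounded denominators
    would put \<open>1 / \<pi>\<close> into \<open>V\<close>, against \<open>\<pi> \<in> n\<close>.
    Just before the first exponent at which \<open>V\<close> is left, the quotient is not a multiple
    of \<open>\<pi>\<close>, so it is a unit.\<close>
  have rep: "\<exists>j::nat. \<exists>u\<in>V. \<exists>u'\<in>V. u \<otimes> u' = \<one> \<and> v = u \<otimes> \<pi> [^] j"
    if v: "v \<in> V" "v \<noteq> \<zero>" for v
  proof -
    have vc: "v \<in> carrier Q" "v \<in> Units Q" using v V_sub Q_field by auto
    have ex: "\<exists>j::nat. v \<otimes> inv \<pi> [^] j \<notin> V"
    proof (rule ccontr)
      assume "\<not> ?thesis"
      then have "inv \<pi> \<in> V" using completely_integrally_closed[of "inv \<pi>" v] vc pc by auto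
      then have "\<pi> \<otimes> inv \<pi> \<in> n" using n_mult[OF p(1)] by blast
      then show False using one_notin_n pc by simp
    qed
    define j where "j = (LEAST j::nat. v \<otimes> inv \<pi> [^] j \<notin> V)"
    have j: "v \<otimes> inv \<pi> [^] j \<notin> V" using LeastI_ex[OF ex] unfolding j_def .
    then have "j \<noteq> 0" using v vc by (metis nat_pow_0 r_one)
    then obtain i where i: "j = Suc i" using not0_implies_Suc by blast
    have u: "v \<otimes> inv \<pi> [^] i \<in> V"
      using not_less_Least[of i "\<lambda>j. v \<otimes> inv \<pi> [^] j \<notin> V"] i unfolding j_def by auto
    define u where "u = v \<otimes> inv \<pi> [^] i"
    have uc: "u \<in> V" "u \<in> carrier Q" using u V_sub unfolding u_def by auto
    have ipc: "inv \<pi> \<in> carrier Q" using pc by simp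
    have "u \<notin> n"
    proof
      assume "u \<in> n"
      then obtain w where w: "w \<in> V" "u = \<pi> \<otimes> w" using p(3) by blast
      have wc: "w \<in> carrier Q" using w V_sub by blast
      have "v \<otimes> inv \<pi> [^] j = u \<otimes> inv \<pi>"
        unfolding i u_def using vc ipc by (simp add: m_assoc)
      also have "\<dots> = (\<pi> \<otimes> inv \<pi>) \<otimes> w" unfolding w(2) using ipc wc pc(2) by (simp add: m_ac)
      finally show False using j w wc pc by simp
    qed
    then obtain u' where u': "u' \<in> V" "u \<otimes> u' = \<one>" using unit_if_notin_n uc by blast
    have "u \<otimes> \<pi> [^] i = v \<otimes> (inv \<pi> \<otimes> \<pi>) [^] i"
      unfolding u_def using vc ipc pc(2) by (simp add: m_assoc nat_pow_distrib)
    then have "v = u \<otimes> \<pi> [^] i" using pc vc by simp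
    then show ?thesis using uc u' by blast
  qed
  define p where "p = (\<lambda>j::nat. \<exists>y\<in>I. \<exists>u\<in>V. \<exists>u'\<in>V. u \<otimes> u' = \<one> \<and> d \<otimes> y = u \<otimes> \<pi> [^] j)"
  have dy: "d \<otimes> y \<in> V" "d \<otimes> y \<noteq> \<zero>" if "y \<in> I" "y \<noteq> \<zero>" for y
    using d that I(1) integral_iff[of d y] by auto
  have ex: "\<exists>j. p j" using nz rep[OF dy] unfolding p_def by blast
  define j where "j = (LEAST j. p j)"
  have pj: "p j" using LeastI_ex[OF ex] unfolding j_def .
  then obtain g u u' where g: "g \<in> I" "u \<in> V" "u' \<in> V" "u \<otimes> u' = \<one>" "d \<otimes> g = u \<otimes> \<pi> [^] j"
    unfolding p_def by blast
  have du: "d \<in> Units Q" using d Q_field by blast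
  have gc: "g \<in> carrier Q" "u \<in> carrier Q" "u' \<in> carrier Q" using g I(1) V_sub by auto
  have pjc: "\<pi> [^] k \<in> carrier Q" for k :: nat using pk(1) by blast
  have pjg: "\<pi> [^] j = u' \<otimes> (d \<otimes> g)"
  proof -
    have "u' \<otimes> (d \<otimes> g) = (u \<otimes> u') \<otimes> \<pi> [^] j" unfolding g(5) using gc pjc by (simp add: m_ac)
    then show ?thesis using g(4) pjc by simp
  qed
  have "g \<noteq> \<zero>"
  proof
    assume "g = \<zero>"
    then have "\<pi> [^] j = \<zero>" using pjg gc d(1) by simp
    then show False using pk(1)[of j] field_Units by simp
  qed
  moreover have "\<exists>v\<in>V. y = v \<otimes> g" if y: "y \<in> I" for y
  proof (cases "y = \<zero>")
    case True
    then show ?thesis using gc by (intro bexI[of _ \<zero>]) auto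
  next
    case False
    then obtain i w w' where w: "w \<in> V" "w' \<in> V" "w \<otimes> w' = \<one>" "d \<otimes> y = w \<otimes> \<pi> [^] (i::nat)"
      using rep[OF dy[OF y]] by blast
    then have "p i" using y unfolding p_def by blast
    then have "j \<le> i" unfolding j_def by (rule Least_le)
    then have pi: "\<pi> [^] i = \<pi> [^] (i - j) \<otimes> \<pi> [^] j" using nat_pow_mult[OF pc(2), of "i - j" j] by simp
    have yc: "y \<in> carrier Q" "w \<in> carrier Q" using y w I(1) V_sub by auto
    have "d \<otimes> y = w \<otimes> (\<pi> [^] (i - j) \<otimes> (u' \<otimes> (d \<otimes> g)))" using w(4) pi pjg by simp
    also have "\<dots> = d \<otimes> ((w \<otimes> \<pi> [^] (i - j) \<otimes> u') \<otimes> g)"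
      using yc gc d(1) pjc by (simp add: m_ac)
    finally have "y = (w \<otimes> \<pi> [^] (i - j) \<otimes> u') \<otimes> g"
      using Units_l_cancel[OF du yc(1)] yc gc pjc by simp
    moreover have "w \<otimes> \<pi> [^] (i - j) \<otimes> u' \<in> V" using w g pk(2) by simp
    ultimately show ?thesis by blast
  qed
  ultimately show ?thesis using g(1) by blast
qed

end

section \<open>Lattices over the integral closure\<close>

context finite_local_normalization
begin

text \<open>Induction on the rank. The last coordinates of \<open>H\<close> form a bounded nonzero
  \<open>V\<close>-submodule of \<open>Q\<close>, generated by the last coordinate of some
  \<open>h\<close> in \<open>H\<close>. Hence \<open>H\<close> is the direct sum of
  \<open>V h\<close> and the kernel of the last coordinate, a lattice of rank one less. Full rank is
  expressed by a scalar \<open>s\<close> for each single vector, a form that passes to the kernel.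
  The bound \<open>d\<close> is the same at all stages and is kept out of the induction.\<close>

lemma lattice_free:
  fixes r :: nat
  assumes "H \<subseteq> {..<r} \<rightarrow>\<^sub>E carrier Q"
    and "\<And>u v. u \<in> H \<Longrightarrow> v \<in> H \<Longrightarrow> (\<lambda>i\<in>{..<r}. u i \<oplus> v i) \<in> H"
    and "\<And>a u. a \<in> V \<Longrightarrow> u \<in> H \<Longrightarrow> (\<lambda>i\<in>{..<r}. a \<otimes> u i) \<in> H"
    and "\<And>v. v \<in> {..<r} \<rightarrow>\<^sub>E carrier Q \<Longrightarrow>
      \<exists>s\<in>carrier Q. s \<noteq> \<zero> \<and> (\<lambda>i\<in>{..<r}. s \<otimes> v i) \<in> H"
    and d: "d \<in> carrier Q" "d \<noteq> \<zero>"
    and "\<And>u i. u \<in> H \<Longrightarrow> i < r \<Longrightarrow> d \<otimes> u i \<in> V"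
  shows "\<exists>\<Phi>. bij_betw \<Phi> H ({..<r} \<rightarrow>\<^sub>E V) \<and>
    (\<forall>u\<in>H. \<forall>v\<in>H. \<Phi> (\<lambda>i\<in>{..<r}. u i \<oplus> v i) = (\<lambda>i\<in>{..<r}. \<Phi> u i \<oplus> \<Phi> v i)) \<and>
    (\<forall>a\<in>V. \<forall>u\<in>H. \<Phi> (\<lambda>i\<in>{..<r}. a \<otimes> u i) = (\<lambda>i\<in>{..<r}. a \<otimes> \<Phi> u i))"
  using assms(1-4,7)
proof (induction r arbitrary: H)
  case 0
  \<comment> \<open>For \<open>r = 0\<close> the function space consists of the everywhere undefined
    function, and full rank puts it into \<open>H\<close>.\<close>
  have "H = {\<lambda>_. undefined}" using 0(1) 0(4)[of "\<lambda>_. undefined"] by auto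
  then show ?case by (intro exI[of _ id]) (auto simp: bij_betw_def)
next
  case (Suc r)
  note H_sub = Suc.prems(1) and H_add = Suc.prems(2) and H_smult = Suc.prems(3)
    and H_full = Suc.prems(4) and H_bound = Suc.prems(5)
  have Hc: "u i \<in> carrier Q" if "u \<in> H" "i < Suc r" for u i
    using H_sub that by auto
  have "\<exists>g\<in>(\<lambda>u. u r) ` H. g \<noteq> \<zero> \<and> (\<forall>y\<in>(\<lambda>u. u r) ` H. \<exists>v\<in>V. y = v \<otimes> g)"
  proof (rule principal[OF _ _ _ d])
    show "(\<lambda>u. u r) ` H \<subseteq> carrier Q" using Hc by blast
    show "v \<otimes> y \<in> (\<lambda>u. u r) ` H" if vy: "v \<in> V" "y \<in> (\<lambda>u. u r) ` H" for v y
    proof -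
      obtain u where u: "u \<in> H" "y = u r" using vy by blast
      show ?thesis using H_smult[OF vy(1) u(1)] u(2) by (intro image_eqI) auto
    qed
    \<comment> \<open>A nonzero multiple of the all-one vector lies in \<open>H\<close>, so not all
      last coordinates vanish.\<close>
    have "(\<lambda>i\<in>{..<Suc r}. \<one>) \<in> {..<Suc r} \<rightarrow>\<^sub>E carrier Q" by simp
    from H_full[OF this] obtain s where s: "s \<in> carrier Q" "s \<noteq> \<zero>"
      "(\<lambda>i\<in>{..<Suc r}. s \<otimes> (\<lambda>i\<in>{..<Suc r}. \<one>) i) \<in> H"
      by blast
    show "\<exists>y\<in>(\<lambda>u. u r) ` H. y \<noteq> \<zero>"
      by (rule bexI[OF _ imageI[OF s(3)]]) (use s in simp)
    show "d \<otimes> y \<in> V" if "y \<in> (\<lambda>u. u r) ` H" for y using that H_bound by auto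
  qed
  then obtain h where h: "h \<in> H" "h r \<noteq> \<zero>" "\<And>u. u \<in> H \<Longrightarrow> \<exists>v\<in>V. u r = v \<otimes> h r"
    by blast
  have gc: "h r \<in> carrier Q" using Hc[OF h(1)] by simp
  then have gu: "h r \<in> Units Q" using h(2) Q_field by blast
  \<comment> \<open>The coefficient of \<open>h\<close> in the decomposition of \<open>u\<close>; it
    lies in \<open>V\<close> because \<open>h r\<close> generates the last coordinates.\<close>
  define \<kappa> where "\<kappa> = (\<lambda>u. u r \<otimes> inv (h r))"
  have \<kappa>: "\<kappa> u \<in> V" "u r = \<kappa> u \<otimes> h r" if u: "u \<in> H" for u
  proof -
    obtain v where v: "v \<in> V" "u r = v \<otimes> h r" using h(3)[OF u] by blast
    have "\<kappa> u = v" unfolding \<kappa>_def v(2) using V_sub[OF v(1)] gc gu by (simp add: m_assoc)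
    then show "\<kappa> u \<in> V" "u r = \<kappa> u \<otimes> h r" using v by auto
  qed
  have \<kappa>c: "\<kappa> u \<in> carrier Q" if "u \<in> H" for u using \<kappa>[OF that] V_sub by blast
  define H' where "H' = {\<lambda>i\<in>{..<r}. u i |u. u \<in> H \<and> u r = \<zero>}"
  have "\<exists>\<Psi>. bij_betw \<Psi> H' ({..<r} \<rightarrow>\<^sub>E V) \<and>
    (\<forall>u\<in>H'. \<forall>v\<in>H'. \<Psi> (\<lambda>i\<in>{..<r}. u i \<oplus> v i) = (\<lambda>i\<in>{..<r}. \<Psi> u i \<oplus> \<Psi> v i)) \<and>
    (\<forall>a\<in>V. \<forall>u\<in>H'. \<Psi> (\<lambda>i\<in>{..<r}. a \<otimes> u i) = (\<lambda>i\<in>{..<r}. a \<otimes> \<Psi> u i))"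
  proof (rule Suc.IH)
    show "H' \<subseteq> {..<r} \<rightarrow>\<^sub>E carrier Q" using Hc unfolding H'_def by (auto split: if_splits)
    fix u assume "u \<in> H'"
    then obtain u0 where u: "u0 \<in> H" "u0 r = \<zero>" "u = (\<lambda>i\<in>{..<r}. u0 i)" unfolding H'_def by blast
    show "d \<otimes> u i \<in> V" if "i < r" for i using that u H_bound by simp
    show "(\<lambda>i\<in>{..<r}. a \<otimes> u i) \<in> H'" if "a \<in> V" for a
      unfolding H'_def
      by (intro CollectI exI[of _ "\<lambda>i\<in>{..<Suc r}. a \<otimes> u0 i"] conjI H_smult[OF that u(1)])
        (use u V_sub[OF that] in auto)
    fix v assume "v \<in> H'"
    then obtain v0 where v: "v0 \<in> H" "v0 r = \<zero>" "v = (\<lambda>i\<in>{..<r}. v0 i)" unfolding H'_def by blast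
    show "(\<lambda>i\<in>{..<r}. u i \<oplus> v i) \<in> H'"
      unfolding H'_def
      by (intro CollectI exI[of _ "\<lambda>i\<in>{..<Suc r}. u0 i \<oplus> v0 i"] conjI H_add[OF u(1) v(1)])
        (use u v in auto)
  next
    fix v assume v: "v \<in> {..<r} \<rightarrow>\<^sub>E carrier Q"
    define w where "w = (\<lambda>i\<in>{..<Suc r}. if i < r then v i else \<zero>)"
    have "v i \<in> carrier Q" if "i < r" for i using PiE_mem[OF v] that by simp
    then have "w \<in> {..<Suc r} \<rightarrow>\<^sub>E carrier Q" by (intro PiE_I) (simp_all add: w_def)
    from H_full[OF this]
    obtain s where s: "s \<in> carrier Q" "s \<noteq> \<zero>" "(\<lambda>i\<in>{..<Suc r}. s \<otimes> w i) \<in> H"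
      by blast
    then show "\<exists>s\<in>carrier Q. s \<noteq> \<zero> \<and> (\<lambda>i\<in>{..<r}. s \<otimes> v i) \<in> H'"
      unfolding H'_def
      by (intro bexI[of _ s] conjI CollectI exI[of _ "\<lambda>i\<in>{..<Suc r}. s \<otimes> w i"] s)
        (use s(1) in \<open>auto simp: w_def\<close>)
  qed
  then obtain \<Psi> where bij: "bij_betw \<Psi> H' ({..<r} \<rightarrow>\<^sub>E V)"
    and \<Psi>_add: "\<And>u v. u \<in> H' \<Longrightarrow> v \<in> H' \<Longrightarrow>
      \<Psi> (\<lambda>i\<in>{..<r}. u i \<oplus> v i) = (\<lambda>i\<in>{..<r}. \<Psi> u i \<oplus> \<Psi> v i)"
    and \<Psi>_smult: "\<And>a u. a \<in> V \<Longrightarrow> u \<in> H' \<Longrightarrow>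
      \<Psi> (\<lambda>i\<in>{..<r}. a \<otimes> u i) = (\<lambda>i\<in>{..<r}. a \<otimes> \<Psi> u i)"
    by blast
  have \<Psi>: "\<Psi> u \<in> {..<r} \<rightarrow>\<^sub>E V" if "u \<in> H'" for u using bij that bij_betwE by blast
  \<comment> \<open>The component \<open>u - \<kappa> u h\<close> in the kernel of the last
    coordinate, with that zero coordinate dropped.\<close>
  define \<rho> where "\<rho> = (\<lambda>u. \<lambda>i\<in>{..<r}. u i \<ominus> \<kappa> u \<otimes> h i)"
  have hc: "h i \<in> carrier Q" if "i < Suc r" for i using Hc[OF h(1) that] .
  have \<rho>: "\<rho> u \<in> H'" if u: "u \<in> H" for u
  proof -
    define w where "w = (\<lambda>i\<in>{..<Suc r}. u i \<oplus> (\<lambda>i\<in>{..<Suc r}. \<ominus> \<kappa> u \<otimes> h i) i)"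
    have "\<ominus> \<kappa> u \<in> V" using \<kappa>(1)[OF u] by simp
    then have "w \<in> H" unfolding w_def by (intro H_add[OF u] H_smult[OF _ h(1)])
    moreover have "w r = \<zero>" using \<kappa>(2)[OF u] \<kappa>c[OF u] gc by (simp add: w_def l_minus r_neg)
    moreover have "\<rho> u = (\<lambda>i\<in>{..<r}. w i)"
      unfolding \<rho>_def w_def using \<kappa>c[OF u] hc by (auto simp: a_minus_def l_minus)
    ultimately show ?thesis unfolding H'_def by blast
  qed
  define \<Phi> where "\<Phi> = (\<lambda>u. (\<Psi> (\<rho> u))(r := \<kappa> u))"
  have \<Phi>_V: "\<Phi> u \<in> {..<Suc r} \<rightarrow>\<^sub>E V" if "u \<in> H" for u
    using \<Psi>[OF \<rho>[OF that]] \<kappa>(1)[OF that] unfolding \<Phi>_def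
    by (auto simp: PiE_iff extensional_def less_Suc_eq)
  have inj: "inj_on \<Phi> H"
  proof (rule inj_onI)
    fix u v assume uv: "u \<in> H" "v \<in> H" "\<Phi> u = \<Phi> v"
    have k: "\<kappa> u = \<kappa> v" using fun_cong[OF uv(3), of r] unfolding \<Phi>_def by simp
    \<comment> \<open>The values of \<open>\<Psi>\<close> are extensional on the first
      \<open>r\<close> indices, so the entry overwritten in \<open>\<Phi>\<close> was
      \<open>undefined\<close> on both sides and can be restored.\<close>
    have "\<Psi> (\<rho> u) r = undefined" "\<Psi> (\<rho> v) r = undefined"
      using \<Psi>[OF \<rho>] uv by (auto simp: PiE_iff extensional_def)
    then have "\<Psi> (\<rho> u) = \<Psi> (\<rho> v)"
      using uv(3) unfolding \<Phi>_def by (metis fun_upd_triv fun_upd_upd)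
    then have \<rho>eq: "\<rho> u = \<rho> v"
      using bij \<rho> uv by (meson bij_betw_imp_inj_on inj_on_eq_iff)
    have "u i = v i" if i: "i < Suc r" for i
    proof (cases "i = r")
      case True
      then show ?thesis using \<kappa>(2) uv k by metis
    next
      case False
      then have "u i \<ominus> \<kappa> v \<otimes> h i = v i \<ominus> \<kappa> v \<otimes> h i"
        using fun_cong[OF \<rho>eq, of i] i k unfolding \<rho>_def by simp
      then show ?thesis using Hc[OF uv(1) i] Hc[OF uv(2) i] \<kappa>c[OF uv(2)] hc[OF i]
        by (simp add: a_minus_def)
    qed
    then show "u = v" using H_sub uv(1,2)
      by (intro PiE_ext[of u "{..<Suc r}" "\<lambda>_. carrier Q" v]) auto
  qed
  have surj: "\<exists>u\<in>H. \<Phi> u = w" if w: "w \<in> {..<Suc r} \<rightarrow>\<^sub>E V" for w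
  proof -
    have "w i \<in> V" if "i < Suc r" for i using PiE_mem[OF w] that by simp
    then have "(\<lambda>i\<in>{..<r}. w i) \<in> {..<r} \<rightarrow>\<^sub>E V" by (intro PiE_I) simp_all
    then obtain u' where u': "u' \<in> H'" "\<Psi> u' = (\<lambda>i\<in>{..<r}. w i)"
      using bij by (metis bij_betw_imp_surj_on imageE)
    then obtain u0 where u0: "u0 \<in> H" "u0 r = \<zero>" "u' = (\<lambda>i\<in>{..<r}. u0 i)" unfolding H'_def by blast
    have wr: "w r \<in> V" "w r \<in> carrier Q" using PiE_mem[OF w, of r] V_sub by simp_all
    define u where "u = (\<lambda>i\<in>{..<Suc r}. u0 i \<oplus> (\<lambda>i\<in>{..<Suc r}. w r \<otimes> h i) i)"
    have uH: "u \<in> H" unfolding u_def using H_add[OF u0(1) H_smult[OF wr(1) h(1)]] .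
    have k: "\<kappa> u = w r" unfolding \<kappa>_def u_def using u0(2) wr gc gu by (simp add: m_assoc)
    have "\<rho> u = u'"
    proof
      fix i show "\<rho> u i = u' i"
      proof (cases "i < r")
        case True
        then have "u0 i \<in> carrier Q" "h i \<in> carrier Q" using Hc[OF u0(1)] hc by auto
        then show ?thesis using True k wr(2) unfolding \<rho>_def u0(3)
          by (simp add: u_def a_minus_def a_assoc r_neg)
      qed (simp add: \<rho>_def u0(3))
    qed
    then have "\<Phi> u = (\<lambda>i\<in>{..<r}. w i)(r := w r)" unfolding \<Phi>_def using k u'(2) by simp
    also have "\<dots> = w"
    proof
      fix i show "((\<lambda>i\<in>{..<r}. w i)(r := w r)) i = w i"
        using w by (cases "i < Suc r") (auto simp: PiE_iff extensional_def)
    qed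
    finally show ?thesis using uH by blast
  qed
  have "\<Phi> ` H = {..<Suc r} \<rightarrow>\<^sub>E V"
  proof
    show "\<Phi> ` H \<subseteq> {..<Suc r} \<rightarrow>\<^sub>E V" by (rule image_subsetI) (rule \<Phi>_V)
    show "{..<Suc r} \<rightarrow>\<^sub>E V \<subseteq> \<Phi> ` H"
    proof
      fix w assume "w \<in> {..<Suc r} \<rightarrow>\<^sub>E V"
      from surj[OF this] show "w \<in> \<Phi> ` H" by blast
    qed
  qed
  then have "bij_betw \<Phi> H ({..<Suc r} \<rightarrow>\<^sub>E V)" using inj unfolding bij_betw_def by simp
  moreover have "\<Phi> (\<lambda>i\<in>{..<Suc r}. u i \<oplus> v i) = (\<lambda>i\<in>{..<Suc r}. \<Phi> u i \<oplus> \<Phi> v i)"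
    if uv: "u \<in> H" "v \<in> H" for u v
  proof -
    define w where "w = (\<lambda>i\<in>{..<Suc r}. u i \<oplus> v i)"
    have k: "\<kappa> w = \<kappa> u \<oplus> \<kappa> v"
      unfolding \<kappa>_def w_def using Hc[OF uv(1), of r] Hc[OF uv(2), of r] gu by (simp add: l_distr)
    have "\<rho> w = (\<lambda>i\<in>{..<r}. \<rho> u i \<oplus> \<rho> v i)"
    proof
      fix i show "\<rho> w i = (\<lambda>i\<in>{..<r}. \<rho> u i \<oplus> \<rho> v i) i"
      proof (cases "i < r")
        case True
        then have c: "u i \<in> carrier Q" "v i \<in> carrier Q" "h i \<in> carrier Q"
          using Hc[OF uv(1)] Hc[OF uv(2)] hc by auto
        have "u i \<oplus> v i \<ominus> (\<kappa> u \<oplus> \<kappa> v) \<otimes> h i = (u i \<ominus> \<kappa> u \<otimes> h i) \<oplus> (v i \<ominus> \<kappa> v \<otimes> h i)"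
          using c \<kappa>c[OF uv(1)] \<kappa>c[OF uv(2)] by algebra
        then show ?thesis using True k unfolding \<rho>_def by (simp add: w_def)
      qed (simp add: \<rho>_def)
    qed
    then have "\<Psi> (\<rho> w) = (\<lambda>i\<in>{..<r}. \<Psi> (\<rho> u) i \<oplus> \<Psi> (\<rho> v) i)"
      by (simp only: \<Psi>_add[OF \<rho>[OF uv(1)] \<rho>[OF uv(2)]])
    then show ?thesis
      unfolding \<Phi>_def w_def[symmetric] using k by (auto simp: fun_eq_iff less_Suc_eq)
  qed
  moreover have "\<Phi> (\<lambda>i\<in>{..<Suc r}. a \<otimes> u i) = (\<lambda>i\<in>{..<Suc r}. a \<otimes> \<Phi> u i)"
    if au: "a \<in> V" "u \<in> H" for a u
  proof -
    define w where "w = (\<lambda>i\<in>{..<Suc r}. a \<otimes> u i)"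
    have ac: "a \<in> carrier Q" using au V_sub by blast
    have k: "\<kappa> w = a \<otimes> \<kappa> u"
      unfolding \<kappa>_def w_def using Hc[OF au(2), of r] gu ac by (simp add: m_assoc)
    have "\<rho> w = (\<lambda>i\<in>{..<r}. a \<otimes> \<rho> u i)"
    proof
      fix i show "\<rho> w i = (\<lambda>i\<in>{..<r}. a \<otimes> \<rho> u i) i"
      proof (cases "i < r")
        case True
        then have c: "u i \<in> carrier Q" "h i \<in> carrier Q" using Hc[OF au(2)] hc by auto
        have "a \<otimes> u i \<ominus> (a \<otimes> \<kappa> u) \<otimes> h i = a \<otimes> (u i \<ominus> \<kappa> u \<otimes> h i)"
          using c \<kappa>c[OF au(2)] ac by algebra
        then show ?thesis using True k unfolding \<rho>_def by (simp add: w_def)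
      qed (simp add: \<rho>_def)
    qed
    then have "\<Psi> (\<rho> w) = (\<lambda>i\<in>{..<r}. a \<otimes> \<Psi> (\<rho> u) i)"
      by (simp only: \<Psi>_smult[OF au(1) \<rho>[OF au(2)]])
    then show ?thesis
      unfolding \<Phi>_def w_def[symmetric] using k by (auto simp: fun_eq_iff less_Suc_eq)
  qed
  ultimately show ?case by (intro exI[of _ \<Phi>] conjI ballI)
qed

end

section \<open>The tensor product with the ring of fractions\<close>

lemma (in module) submodule_cosets:
  assumes "submodule K R M"
  shows "x \<in> carrier M \<Longrightarrow> y \<in> carrier M \<Longrightarrow>
      (K +>\<^bsub>M\<^esub> x) <+>\<^bsub>M\<^esub> (K +>\<^bsub>M\<^esub> y) = K +>\<^bsub>M\<^esub> (x \<oplus>\<^bsub>M\<^esub> y)"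
    and "x \<in> carrier M \<Longrightarrow> y \<in> carrier M \<Longrightarrow>
      K +>\<^bsub>M\<^esub> x = K +>\<^bsub>M\<^esub> y \<longleftrightarrow> x \<ominus>\<^bsub>M\<^esub> y \<in> K"
    and "a \<in> carrier R \<Longrightarrow> x \<in> carrier M \<Longrightarrow>
      (\<Union>z\<in>K +>\<^bsub>M\<^esub> x. K +>\<^bsub>M\<^esub> (a \<odot>\<^bsub>M\<^esub> z)) = K +>\<^bsub>M\<^esub> (a \<odot>\<^bsub>M\<^esub> x)"
proof -
  interpret K: submodule K R M by fact
  interpret K: abelian_subgroup K M
    by (rule abelian_subgroupI3)
      (auto intro!: additive_subgroup.intro K.subgroup_axioms M.abelian_group_axioms)
  show "x \<in> carrier M \<Longrightarrow> y \<in> carrier M \<Longrightarrow>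
      (K +>\<^bsub>M\<^esub> x) <+>\<^bsub>M\<^esub> (K +>\<^bsub>M\<^esub> y) = K +>\<^bsub>M\<^esub> (x \<oplus>\<^bsub>M\<^esub> y)"
    by (rule K.a_rcos_sum)
  show eq: "K +>\<^bsub>M\<^esub> x = K +>\<^bsub>M\<^esub> y \<longleftrightarrow> x \<ominus>\<^bsub>M\<^esub> y \<in> K"
    if "x \<in> carrier M" "y \<in> carrier M" for x y
    using K.a_repr_independence' K.a_rcos_self K.a_rcos_module_imp K.a_rcos_module_rev that
    by (metis K.a_rcos_module a_minus_def)
  assume ax: "a \<in> carrier R" "x \<in> carrier M"
  have "K +>\<^bsub>M\<^esub> (a \<odot>\<^bsub>M\<^esub> z) = K +>\<^bsub>M\<^esub> (a \<odot>\<^bsub>M\<^esub> x)" if z: "z \<in> K +>\<^bsub>M\<^esub> x" for z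
  proof -
    have zc: "z \<in> carrier M" using z K.a_elemrcos_carrier ax by blast
    have "z \<ominus>\<^bsub>M\<^esub> x \<in> K" using z K.a_rcos_module_minus K.a_rcos_module ax zc a_minus_def by metis
    then have "a \<odot>\<^bsub>M\<^esub> (z \<ominus>\<^bsub>M\<^esub> x) \<in> K" using ax K.smult_closed by blast
    moreover have "a \<odot>\<^bsub>M\<^esub> (z \<ominus>\<^bsub>M\<^esub> x) = a \<odot>\<^bsub>M\<^esub> z \<ominus>\<^bsub>M\<^esub> a \<odot>\<^bsub>M\<^esub> x"
      using ax zc by (simp add: a_minus_def smult_r_distr smult_r_minus)
    ultimately show ?thesis using eq ax zc by simp
  qed
  moreover have "x \<in> K +>\<^bsub>M\<^esub> x" using ax K.a_rcos_self by blast
  ultimately show "(\<Union>z\<in>K +>\<^bsub>M\<^esub> x. K +>\<^bsub>M\<^esub> (a \<odot>\<^bsub>M\<^esub> z)) = K +>\<^bsub>M\<^esub> (a \<odot>\<^bsub>M\<^esub> x)" by blast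
qed

lemma (in module) module_span_submodule:
  assumes "B \<subseteq> carrier M"
  shows "submodule (module_span R M B) R M"
proof (rule submoduleI)
  have s: "submodule (carrier M) R M" by (rule carrier_is_submodule)
  show "module_span R M B \<subseteq> carrier M" unfolding module_span_def using s assms by blast
qed (auto simp: module_span_def dest: submoduleE subgroup.one_closed[OF submodule.axioms(1)])

lemma free_module_on_simps [simp]:
  "carrier (free_module_on R S) = {c \<in> S \<rightarrow>\<^sub>E carrier R. finite {s \<in> S. c s \<noteq> \<zero>\<^bsub>R\<^esub>}}"
  "ring.zero (free_module_on R S) = (\<lambda>s\<in>S. \<zero>\<^bsub>R\<^esub>)"
  "ring.add (free_module_on R S) = (\<lambda>c d. \<lambda>s\<in>S. c s \<oplus>\<^bsub>R\<^esub> d s)"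
  "smult (free_module_on R S) = (\<lambda>a c. \<lambda>s\<in>S. a \<otimes>\<^bsub>R\<^esub> c s)"
  by (simp_all add: free_module_on_def)

lemma (in cring) free_module_on_module: "module R (free_module_on R S)"
proof -
  have fin_add: "finite {s \<in> S. c s \<oplus> d s \<noteq> \<zero>}"
    if "finite {s \<in> S. c s \<noteq> \<zero>}" "finite {s \<in> S. d s \<noteq> \<zero>}" for c d
    by (rule finite_subset[OF _ finite_UnI[OF that]]) auto
  have fin_smult: "finite {s \<in> S. a \<otimes> c s \<noteq> \<zero>}"
    if "a \<in> carrier R" "finite {s \<in> S. c s \<noteq> \<zero>}" for a c
    by (rule finite_subset[OF _ that(2)]) (use that(1) in auto)
  show ?thesis
  proof (rule moduleI)
  show "cring R" by (rule is_cring)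
  show "abelian_group (free_module_on R S)"
  proof (rule abelian_groupI)
    fix x assume x: "x \<in> carrier (free_module_on R S)"
    have "finite {s \<in> S. \<ominus> x s \<noteq> \<zero>}"
      by (rule finite_subset[of _ "{s \<in> S. x s \<noteq> \<zero>}"]) (use x in auto)
    then show "\<exists>y\<in>carrier (free_module_on R S).
        y \<oplus>\<^bsub>free_module_on R S\<^esub> x = \<zero>\<^bsub>free_module_on R S\<^esub>"
      using x by (intro bexI[of _ "\<lambda>s\<in>S. \<ominus> x s"]) (auto simp: l_neg PiE_iff cong: conj_cong)
  qed (use fin_add in \<open>auto simp: fun_eq_iff a_ac PiE_iff extensional_def cong: conj_cong\<close>)
qed (use fin_smult in \<open>auto simp: fun_eq_iff l_distr r_distr m_assoc PiE_iff extensional_def cong: conj_cong\<close>)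
qed

lemma (in cring) free_generator_closed:
  "s \<in> S \<Longrightarrow> free_generator R S s \<in> carrier (free_module_on R S)"
proof -
  have "finite {t \<in> S. free_generator R S s t \<noteq> \<zero>}"
    by (rule finite_subset[of _ "{s}"]) (auto simp: free_generator_def)
  then show ?thesis by (auto simp: free_generator_def)
qed

text \<open>Induction on a finite set containing the support: a point \<open>x\<close> is removed by
  splitting off \<open>c x\<close> times its generator.\<close>

lemma (in cring) free_module_on_induct [consumes 1, case_names zero add smult]:
  assumes c: "c \<in> carrier (free_module_on R S)"
    and zero: "P \<zero>\<^bsub>free_module_on R S\<^esub>"
    and add: "\<And>c d. c \<in> carrier (free_module_on R S) \<Longrightarrow> d \<in> carrier (free_module_on R S) \<Longrightarrow>
      P c \<Longrightarrow> P d \<Longrightarrow> P (c \<oplus>\<^bsub>free_module_on R S\<^esub> d)"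
    and gen: "\<And>a s. a \<in> carrier R \<Longrightarrow> s \<in> S \<Longrightarrow>
      P (a \<odot>\<^bsub>free_module_on R S\<^esub> free_generator R S s)"
  shows "P c"
proof -
  interpret F: module R "free_module_on R S" by (rule free_module_on_module)
  have "\<forall>c\<in>carrier (free_module_on R S). {s \<in> S. c s \<noteq> \<zero>} \<subseteq> U \<longrightarrow> P c" if "finite U" for U
    using that
  proof (induction U rule: finite_induct)
    case empty
    have "c = \<zero>\<^bsub>free_module_on R S\<^esub>"
      if "c \<in> carrier (free_module_on R S)" "{s \<in> S. c s \<noteq> \<zero>} \<subseteq> {}" for c
      using that by (auto simp: fun_eq_iff PiE_iff extensional_def)
    with zero show ?case by (intro ballI impI) (simp only:)
  next
    case (insert x U)
    show ?case
    proof (intro ballI impI)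
      fix c assume c: "c \<in> carrier (free_module_on R S)" "{s \<in> S. c s \<noteq> \<zero>} \<subseteq> insert x U"
      show "P c"
      proof (cases "x \<in> S")
        case False
        then have "{s \<in> S. c s \<noteq> \<zero>} \<subseteq> U" using c(2) by blast
        then show ?thesis using insert.IH c(1) by blast
      next
        case True
        have cc: "c s \<in> carrier R" if "s \<in> S" for s using c(1) that by auto
        define d where "d = (\<lambda>s\<in>S. if s = x then \<zero> else c s)"
        have "finite {s \<in> S. d s \<noteq> \<zero>}"
          by (rule finite_subset[of _ "{s \<in> S. c s \<noteq> \<zero>}"]) (use c(1) in \<open>auto simp: d_def\<close>)
        then have d: "d \<in> carrier (free_module_on R S)" using cc by (auto simp: d_def)
        have "{s \<in> S. d s \<noteq> \<zero>} \<subseteq> U" using c(2) by (auto simp: d_def)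
        then have "P d" using insert.IH d by blast
        moreover have "c = c x \<odot>\<^bsub>free_module_on R S\<^esub> free_generator R S x
            \<oplus>\<^bsub>free_module_on R S\<^esub> d"
          using c(1) cc cc[OF True] by (auto simp: fun_eq_iff free_generator_def d_def PiE_iff extensional_def)
        ultimately show ?thesis
          using add[OF F.smult_closed[OF cc free_generator_closed] d gen[OF cc]] True by metis
      qed
    qed
  qed
  moreover have "finite {s \<in> S. c s \<noteq> \<zero>}" using c by simp
  ultimately show ?thesis using c by blast
qed

lemma power_module_simps [simp]:
  "carrier (power_module M k) = {..<k} \<rightarrow>\<^sub>E carrier M"
  "ring.zero (power_module M k) = (\<lambda>i\<in>{..<k}. \<zero>\<^bsub>M\<^esub>)"
  "ring.add (power_module M k) = (\<lambda>u v. \<lambda>i\<in>{..<k}. u i \<oplus>\<^bsub>M\<^esub> v i)"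
  "smult (power_module M k) = (\<lambda>a u. \<lambda>i\<in>{..<k}. a \<odot>\<^bsub>M\<^esub> u i)"
  by (simp_all add: power_module_def)

context fraction_pair
begin

text \<open>The universal property of the free \<open>R\<close>-module on \<open>S\<close> for maps
  into \<open>Q\<close>: the linear extension of \<open>\<beta>\<close>. The sum runs over the
  support because \<open>S\<close> may be infinite.\<close>

definition free_extension :: "('s \<Rightarrow> 'a) \<Rightarrow> 's set \<Rightarrow> ('s \<Rightarrow> 'a) \<Rightarrow> 'a" where
  "free_extension \<beta> S c = (\<Oplus>s\<in>{s \<in> S. c s \<noteq> \<zero>}. c s \<otimes> \<beta> s)"

context
  fixes \<beta> :: "'s \<Rightarrow> 'a" and S :: "'s set"
  assumes \<beta>: "\<beta> \<in> S \<rightarrow> carrier Q"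
begin

text \<open>Sums over different supports can be added termwise only after both are taken over one
  finite index set.\<close>

lemma free_extension_superset:
  assumes "c \<in> carrier (free_module_on R S)" "finite U" "U \<subseteq> S" "{s \<in> S. c s \<noteq> \<zero>} \<subseteq> U"
  shows "free_extension \<beta> S c = (\<Oplus>s\<in>U. c s \<otimes> \<beta> s)"
  unfolding free_extension_def
proof (rule add.finprod_mono_neutral_cong_left[OF assms(2,4)])
  show "c i \<otimes> \<beta> i = \<zero>" if "i \<in> U - {s \<in> S. c s \<noteq> \<zero>}" for i
    using that assms(3) \<beta> by (auto simp: Pi_iff)
  show "(\<lambda>s. c s \<otimes> \<beta> s) \<in> U \<rightarrow> carrier Q"
    using assms(1,3) \<beta> A_sub by (auto simp: Pi_iff PiE_iff)
qed simp

lemma free_extension_add: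
  assumes c: "c \<in> carrier (free_module_on R S)" and d: "d \<in> carrier (free_module_on R S)"
  shows "free_extension \<beta> S (c \<oplus>\<^bsub>free_module_on R S\<^esub> d)
    = free_extension \<beta> S c \<oplus> free_extension \<beta> S d"
proof -
  interpret F: module R "free_module_on R S" using R_cring by (rule cring.free_module_on_module)
  define U where "U = {s \<in> S. c s \<noteq> \<zero>} \<union> {s \<in> S. d s \<noteq> \<zero>}"
  have U: "finite U" "U \<subseteq> S" using c d unfolding U_def by auto
  have cd: "c s \<in> carrier Q" "d s \<in> carrier Q" "\<beta> s \<in> carrier Q" if "s \<in> U" for s
    using c d that U A_sub \<beta> by (auto simp: Pi_iff PiE_iff)
  have sum: "c \<oplus>\<^bsub>free_module_on R S\<^esub> d \<in> carrier (free_module_on R S)"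
    using c d by (rule F.M.a_closed)
  have supp: "{s \<in> S. (c \<oplus>\<^bsub>free_module_on R S\<^esub> d) s \<noteq> \<zero>} \<subseteq> U"
    using c d unfolding U_def by auto
  have "free_extension \<beta> S (c \<oplus>\<^bsub>free_module_on R S\<^esub> d)
      = (\<Oplus>s\<in>U. (c \<oplus>\<^bsub>free_module_on R S\<^esub> d) s \<otimes> \<beta> s)"
    by (rule free_extension_superset[OF sum U supp])
  also have "\<dots> = (\<Oplus>s\<in>U. c s \<otimes> \<beta> s \<oplus> d s \<otimes> \<beta> s)"
    using cd U(2) by (intro finsum_cong') (auto simp: l_distr)
  also have "\<dots> = (\<Oplus>s\<in>U. c s \<otimes> \<beta> s) \<oplus> (\<Oplus>s\<in>U. d s \<otimes> \<beta> s)"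
    using cd by (intro finsum_addf) auto
  also have "\<dots> = free_extension \<beta> S c \<oplus> free_extension \<beta> S d"
    using free_extension_superset[OF c U] free_extension_superset[OF d U] unfolding U_def by simp
  finally show ?thesis .
qed

lemma free_extension_smult:
  assumes a: "a \<in> A" and c: "c \<in> carrier (free_module_on R S)"
  shows "free_extension \<beta> S (a \<odot>\<^bsub>free_module_on R S\<^esub> c) = a \<otimes> free_extension \<beta> S c"
proof -
  interpret F: module R "free_module_on R S" using R_cring by (rule cring.free_module_on_module)
  define U where "U = {s \<in> S. c s \<noteq> \<zero>}"
  have U: "finite U" "U \<subseteq> S" using c unfolding U_def by auto
  have cd: "c s \<in> carrier Q" "\<beta> s \<in> carrier Q" if "s \<in> U" for s
    using c that U A_sub \<beta> by (auto simp: Pi_iff PiE_iff)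
  have ac: "a \<in> carrier Q" using a A_sub by blast
  have sum: "a \<odot>\<^bsub>free_module_on R S\<^esub> c \<in> carrier (free_module_on R S)"
    using a c by (rule F.smult_closed)
  have supp: "{s \<in> S. (a \<odot>\<^bsub>free_module_on R S\<^esub> c) s \<noteq> \<zero>} \<subseteq> U"
    using ac unfolding U_def by auto
  have "free_extension \<beta> S (a \<odot>\<^bsub>free_module_on R S\<^esub> c)
      = (\<Oplus>s\<in>U. (a \<odot>\<^bsub>free_module_on R S\<^esub> c) s \<otimes> \<beta> s)"
    by (rule free_extension_superset[OF sum U supp])
  also have "\<dots> = (\<Oplus>s\<in>U. a \<otimes> (c s \<otimes> \<beta> s))"
    using cd U(2) ac by (intro finsum_cong') (auto simp: m_assoc)
  also have "\<dots> = a \<otimes> (\<Oplus>s\<in>U. c s \<otimes> \<beta> s)"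
    using cd by (intro finsum_rdistr[symmetric] U ac) auto
  also have "\<dots> = a \<otimes> free_extension \<beta> S c"
    using free_extension_superset[OF c U] unfolding U_def by simp
  finally show ?thesis .
qed

lemma free_extension_minus:
  assumes c: "c \<in> carrier (free_module_on R S)" and d: "d \<in> carrier (free_module_on R S)"
  shows "free_extension \<beta> S (c \<ominus>\<^bsub>free_module_on R S\<^esub> d)
    = free_extension \<beta> S c \<oplus> (\<ominus> \<one>) \<otimes> free_extension \<beta> S d"
proof -
  interpret F: module R "free_module_on R S" using R_cring by (rule cring.free_module_on_module)
  have "c \<ominus>\<^bsub>free_module_on R S\<^esub> d = c \<oplus>\<^bsub>free_module_on R S\<^esub> ((\<ominus> \<one>) \<odot>\<^bsub>free_module_on R S\<^esub> d)"
    using F.smult_l_minus[of "\<one>\<^bsub>R\<^esub>" d] F.smult_one[OF d] d R_minus[of \<one>]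
    by (simp only: a_minus_def R_ops F.R.one_closed A_closed)
  moreover have "\<ominus> \<one> \<in> A" by simp
  ultimately show ?thesis
    using free_extension_add[OF c F.smult_closed[OF _ d]] free_extension_smult[OF _ d] by metis
qed

lemma free_extension_generator:
  assumes "s \<in> S"
  shows "free_extension \<beta> S (free_generator R S s) = \<beta> s"
proof -
  have "free_extension \<beta> S (free_generator R S s) = (\<Oplus>t\<in>{s}. free_generator R S s t \<otimes> \<beta> t)"
    using assms
    by (intro free_extension_superset cring.free_generator_closed[OF R_cring])
      (auto simp: free_generator_def)
  also have "\<dots> = free_generator R S s s \<otimes> \<beta> s"
    using assms \<beta> by (subst finsum_insert) (auto simp: free_generator_def Pi_iff)
  also have "\<dots> = \<beta> s" using assms \<beta> by (auto simp: free_generator_def Pi_iff)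
  finally show ?thesis .
qed

lemma free_extension_closed:
  assumes c: "c \<in> carrier (free_module_on R S)"
  shows "free_extension \<beta> S c \<in> carrier Q"
  unfolding free_extension_def
  using c \<beta> A_sub by (intro finsum_closed) (auto simp: Pi_iff PiE_iff)

end

end

lemma quot_module_simps:
  assumes "module R M" "submodule K R M"
  shows "carrier (quot_module M K) = (\<lambda>c. K +>\<^bsub>M\<^esub> c) ` carrier M"
    and "x \<in> carrier M \<Longrightarrow> y \<in> carrier M \<Longrightarrow>
      (K +>\<^bsub>M\<^esub> x) \<oplus>\<^bsub>quot_module M K\<^esub> (K +>\<^bsub>M\<^esub> y) = K +>\<^bsub>M\<^esub> (x \<oplus>\<^bsub>M\<^esub> y)"
    and "a \<in> carrier R \<Longrightarrow> x \<in> carrier M \<Longrightarrow>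
      a \<odot>\<^bsub>quot_module M K\<^esub> (K +>\<^bsub>M\<^esub> x) = K +>\<^bsub>M\<^esub> (a \<odot>\<^bsub>M\<^esub> x)"
  using module.submodule_cosets[OF assms]
  by (auto simp: quot_module_def A_RCOSETS_def')

text \<open>A name for the bilinearity relations inside \<open>tensor_module\<close>: any submodule
  containing this set contains the kernel of the passage to the tensor product.\<close>

definition tensor_relations ::
    "('a, 'c) ring_scheme \<Rightarrow> ('a, 'm, 'd) module_scheme \<Rightarrow> ('a, 'n, 'e) module_scheme \<Rightarrow>
      ('m \<times> 'n \<Rightarrow> 'a) set" where
  "tensor_relations R M N =
    (let S = carrier M \<times> carrier N; F = free_module_on R S; e = free_generator R S in
       {e (x \<oplus>\<^bsub>M\<^esub> x', y) \<ominus>\<^bsub>F\<^esub> (e (x, y) \<oplus>\<^bsub>F\<^esub> e (x', y)) |x x' y.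
           x \<in> carrier M \<and> x' \<in> carrier M \<and> y \<in> carrier N} \<union>
        {e (x, y \<oplus>\<^bsub>N\<^esub> y') \<ominus>\<^bsub>F\<^esub> (e (x, y) \<oplus>\<^bsub>F\<^esub> e (x, y')) |x y y'.
           x \<in> carrier M \<and> y \<in> carrier N \<and> y' \<in> carrier N} \<union>
        {e (a \<odot>\<^bsub>M\<^esub> x, y) \<ominus>\<^bsub>F\<^esub> (a \<odot>\<^bsub>F\<^esub> e (x, y)) |a x y.
           a \<in> carrier R \<and> x \<in> carrier M \<and> y \<in> carrier N} \<union>
        {e (x, a \<odot>\<^bsub>N\<^esub> y) \<ominus>\<^bsub>F\<^esub> (a \<odot>\<^bsub>F\<^esub> e (x, y)) |a x y.
           a \<in> carrier R \<and> x \<in> carrier M \<and> y \<in> carrier N})"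

lemma tensor_module_eq:
  "tensor_module R M N =
    (let F = free_module_on R (carrier M \<times> carrier N) in
      quot_module F (module_span R F (tensor_relations R M N)))"
  unfolding tensor_module_def tensor_relations_def Let_def ..

section \<open>Mapping a module of rank \<open>r\<close> to \<open>Q^r\<close>\<close>

context fraction_pair
begin

text \<open>The map \<open>j\<close> is \<open>x \<mapsto> x \<otimes> 1\<close> followed by the
  isomorphism of the tensor product with \<open>Q^r\<close>. Clearing denominators turns every
  tensor into one of the form \<open>x \<otimes> 1\<close>, and a functional \<open>f\<close>
  extends by \<open>x \<otimes> q \<mapsto> f x q\<close>, which respects the relations. The kernel
  of \<open>j\<close> is the torsion of \<open>M\<close>; that it vanishes will come from
  reflexivity.\<close>

lemma tensor_rank_embedding:
  fixes M :: "('a, 'm, 'd) module_scheme"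
  assumes "module R M" and rank: "has_rank R Q M r"
  shows "\<exists>j\<in>lin_maps R M (power_module (self_module Q) r).
    (\<forall>v\<in>{..<r} \<rightarrow>\<^sub>E carrier Q. \<exists>s\<in>nonzerodivisors R. \<exists>x\<in>carrier M. j x = (\<lambda>i\<in>{..<r}. s \<otimes> v i)) \<and>
    (\<forall>f\<in>lin_maps R M (self_module R).
      \<exists>g\<in>lin_maps R (power_module (self_module Q) r) (self_module Q). \<forall>x\<in>carrier M. g (j x) = f x)"
proof -
  interpret M: module R M by fact
  define S where "S = carrier M \<times> carrier Q"
  define F where "F = free_module_on R S"
  define e where "e = free_generator R S"
  define K where "K = module_span R F (tensor_relations R M (self_module Q))"
  define P where "P = power_module (self_module Q) r"
  define T where "T = quot_module F K"
  interpret F: module R F unfolding F_def using R_cring by (rule cring.free_module_on_module)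
  have e: "e (x, q) \<in> carrier F" if "x \<in> carrier M" "q \<in> carrier Q" for x q
    unfolding e_def F_def using that by (intro cring.free_generator_closed[OF R_cring]) (simp add: S_def)
  have rel: "tensor_relations R M (self_module Q) =
       {e (x \<oplus>\<^bsub>M\<^esub> x', y) \<ominus>\<^bsub>F\<^esub> (e (x, y) \<oplus>\<^bsub>F\<^esub> e (x', y)) |x x' y.
           x \<in> carrier M \<and> x' \<in> carrier M \<and> y \<in> carrier Q} \<union>
        {e (x, y \<oplus> y') \<ominus>\<^bsub>F\<^esub> (e (x, y) \<oplus>\<^bsub>F\<^esub> e (x, y')) |x y y'.
           x \<in> carrier M \<and> y \<in> carrier Q \<and> y' \<in> carrier Q} \<union>
        {e (a \<odot>\<^bsub>M\<^esub> x, y) \<ominus>\<^bsub>F\<^esub> (a \<odot>\<^bsub>F\<^esub> e (x, y)) |a x y.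
           a \<in> A \<and> x \<in> carrier M \<and> y \<in> carrier Q} \<union>
        {e (x, a \<otimes> y) \<ominus>\<^bsub>F\<^esub> (a \<odot>\<^bsub>F\<^esub> e (x, y)) |a x y.
           a \<in> A \<and> x \<in> carrier M \<and> y \<in> carrier Q}"
    unfolding tensor_relations_def Let_def S_def[symmetric] self_module_simps F_def[symmetric] e_def[symmetric] ..
  have rel_F: "tensor_relations R M (self_module Q) \<subseteq> carrier F"
    unfolding rel using e A_sub
    by (auto intro!: F.M.minus_closed F.M.a_closed F.smult_closed M.M.a_closed M.smult_closed a_closed m_closed)
  have K: "submodule K R F" unfolding K_def by (rule F.module_span_submodule[OF rel_F])
  have rel_K: "tensor_relations R M (self_module Q) \<subseteq> K"
    unfolding K_def module_span_def by blast
  note T = quot_module_simps[OF F.module_axioms K, folded T_def]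
  have "isomorphic_modules R T P"
    using rank unfolding has_rank_def tensor_module_eq Let_def self_module_simps
    unfolding S_def[symmetric] F_def[symmetric] K_def[symmetric] T_def[symmetric] P_def[symmetric] .
  then obtain \<phi> where \<phi>: "\<phi> \<in> lin_maps R T P" "bij_betw \<phi> (carrier T) (carrier P)"
    unfolding isomorphic_modules_def module_isos_def by blast
  \<comment> \<open>Lifting \<open>\<phi>\<close> to the free module removes the cosets: two
    elements have the same image under \<open>\<psi>\<close> exactly if their difference lies in
    \<open>K\<close>.\<close>
  define \<psi> where "\<psi> = (\<lambda>c. \<phi> (K +>\<^bsub>F\<^esub> c))"
  have coset: "K +>\<^bsub>F\<^esub> c \<in> carrier T" if "c \<in> carrier F" for c using that T(1) by blast
  have \<psi>_P: "\<psi> c \<in> carrier P" if "c \<in> carrier F" for c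
    unfolding \<psi>_def using coset[OF that] \<phi>(2) bij_betwE by blast
  have \<psi>_add: "\<psi> (c \<oplus>\<^bsub>F\<^esub> d) = \<psi> c \<oplus>\<^bsub>P\<^esub> \<psi> d" if "c \<in> carrier F" "d \<in> carrier F" for c d
    unfolding \<psi>_def T(2)[OF that, symmetric] using \<phi>(1) coset that unfolding lin_maps_def by blast
  have \<psi>_smult: "\<psi> (a \<odot>\<^bsub>F\<^esub> c) = a \<odot>\<^bsub>P\<^esub> \<psi> c" if "a \<in> A" "c \<in> carrier F" for a c
    unfolding \<psi>_def T(3)[OF that, symmetric] using \<phi>(1) coset that unfolding lin_maps_def by blast
  have \<psi>_eq: "\<psi> c = \<psi> d \<longleftrightarrow> c \<ominus>\<^bsub>F\<^esub> d \<in> K" if "c \<in> carrier F" "d \<in> carrier F" for c d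
    unfolding \<psi>_def F.submodule_cosets(2)[OF K that, symmetric]
    by (rule inj_on_eq_iff[OF bij_betw_imp_inj_on[OF \<phi>(2)] coset[OF that(1)] coset[OF that(2)]])
  have \<psi>_surj: "\<exists>c\<in>carrier F. \<psi> c = v" if "v \<in> carrier P" for v
  proof -
    have "v \<in> \<phi> ` carrier T" using that \<phi>(2) unfolding bij_betw_def by simp
    then show ?thesis unfolding T(1) \<psi>_def by blast
  qed
  define t where "t = (\<lambda>x q. \<psi> (e (x, q)))"
  have t_P: "t x q \<in> carrier P" if "x \<in> carrier M" "q \<in> carrier Q" for x q
    unfolding t_def using \<psi>_P e that by blast
  have t_add: "t (x \<oplus>\<^bsub>M\<^esub> x') q = t x q \<oplus>\<^bsub>P\<^esub> t x' q"
    if "x \<in> carrier M" "x' \<in> carrier M" "q \<in> carrier Q" for x x' q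
  proof -
    have "e (x \<oplus>\<^bsub>M\<^esub> x', q) \<ominus>\<^bsub>F\<^esub> (e (x, q) \<oplus>\<^bsub>F\<^esub> e (x', q)) \<in> K"
      using rel_K that unfolding rel by blast
    then have "\<psi> (e (x \<oplus>\<^bsub>M\<^esub> x', q)) = \<psi> (e (x, q) \<oplus>\<^bsub>F\<^esub> e (x', q))"
      using \<psi>_eq e that by simp
    then show ?thesis unfolding t_def using \<psi>_add e that by simp
  qed
  have t_smult: "t (a \<odot>\<^bsub>M\<^esub> x) q = a \<odot>\<^bsub>P\<^esub> t x q"
    if "a \<in> A" "x \<in> carrier M" "q \<in> carrier Q" for a x q
  proof -
    have "e (a \<odot>\<^bsub>M\<^esub> x, q) \<ominus>\<^bsub>F\<^esub> (a \<odot>\<^bsub>F\<^esub> e (x, q)) \<in> K"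
      using rel_K that unfolding rel by blast
    then have "\<psi> (e (a \<odot>\<^bsub>M\<^esub> x, q)) = \<psi> (a \<odot>\<^bsub>F\<^esub> e (x, q))"
      using \<psi>_eq e that by simp
    then show ?thesis unfolding t_def using \<psi>_smult e that by simp
  qed
  have t_smult': "t x (a \<otimes> q) = a \<odot>\<^bsub>P\<^esub> t x q"
    if "a \<in> A" "x \<in> carrier M" "q \<in> carrier Q" for a x q
  proof -
    have "e (x, a \<otimes> q) \<ominus>\<^bsub>F\<^esub> (a \<odot>\<^bsub>F\<^esub> e (x, q)) \<in> K"
      using rel_K that unfolding rel by blast
    then have "\<psi> (e (x, a \<otimes> q)) = \<psi> (a \<odot>\<^bsub>F\<^esub> e (x, q))"
      using \<psi>_eq e A_sub that by simp
    then show ?thesis unfolding t_def using \<psi>_smult e that by simp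
  qed
  define j where "j = (\<lambda>x\<in>carrier M. t x \<one>)"
  have j_lin: "j \<in> lin_maps R M P"
    unfolding lin_maps_def j_def using t_P t_add t_smult by auto
  have j_P: "j x \<in> carrier P" if "x \<in> carrier M" for x using j_lin that unfolding lin_maps_def by blast
  have j_add: "j (x \<oplus>\<^bsub>M\<^esub> y) = (\<lambda>i\<in>{..<r}. j x i \<oplus> j y i)" if "x \<in> carrier M" "y \<in> carrier M" for x y
    using j_lin that unfolding lin_maps_def P_def by simp
  have j_smult: "j (a \<odot>\<^bsub>M\<^esub> x) = (\<lambda>i\<in>{..<r}. a \<otimes> j x i)" if "a \<in> A" "x \<in> carrier M" for a x
    using j_lin that unfolding lin_maps_def P_def by simp
  have comp: "v i \<in> carrier Q" if "v \<in> carrier P" "i < r" for v i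
    using that unfolding P_def by auto
  \<comment> \<open>It is enough to clear denominators for multiples of generators, since for a sum
    the two denominators can be multiplied.\<close>
  have "\<exists>s\<in>nonzerodivisors R. \<exists>x\<in>carrier M. j x = (\<lambda>i\<in>{..<r}. s \<otimes> \<psi> c i)" if "c \<in> carrier F" for c
  proof -
    show ?thesis
      using that
    proof (induction rule: cring.free_module_on_induct[OF R_cring, of c S, folded F_def e_def,
        consumes 1, case_names zero add smult])
      case zero
      have "j \<zero>\<^bsub>M\<^esub> = j (\<zero> \<odot>\<^bsub>M\<^esub> \<zero>\<^bsub>M\<^esub>)" by simp
      also have "\<dots> = (\<lambda>i\<in>{..<r}. \<zero> \<otimes> j \<zero>\<^bsub>M\<^esub> i)" by (rule j_smult) auto
      also have "\<dots> = (\<lambda>i\<in>{..<r}. \<zero>)" using comp[OF j_P] by (intro restrict_ext) auto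
      finally have 1: "j \<zero>\<^bsub>M\<^esub> = (\<lambda>i\<in>{..<r}. \<zero>)" .
      have "\<psi> \<zero>\<^bsub>F\<^esub> = \<psi> (\<zero> \<odot>\<^bsub>F\<^esub> \<zero>\<^bsub>F\<^esub>)" by simp
      also have "\<dots> = (\<lambda>i\<in>{..<r}. \<zero> \<otimes> \<psi> \<zero>\<^bsub>F\<^esub> i)"
        using \<psi>_smult[of \<zero> "\<zero>\<^bsub>F\<^esub>"] unfolding P_def by simp
      also have "\<dots> = (\<lambda>i\<in>{..<r}. \<zero>)" using comp[OF \<psi>_P] by (intro restrict_ext) auto
      finally have 2: "\<psi> \<zero>\<^bsub>F\<^esub> = (\<lambda>i\<in>{..<r}. \<zero>)" .
      show ?case
        by (rule bexI[OF _ one_nonzerodivisors], rule bexI[OF _ M.M.zero_closed])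
          (simp add: 1 2 fun_eq_iff)
    next
      case (add c d)
      then obtain s s' x x' where
        s: "s \<in> nonzerodivisors R" "x \<in> carrier M" "j x = (\<lambda>i\<in>{..<r}. s \<otimes> \<psi> c i)" and
        s': "s' \<in> nonzerodivisors R" "x' \<in> carrier M" "j x' = (\<lambda>i\<in>{..<r}. s' \<otimes> \<psi> d i)"
        by blast
      have sA: "s \<in> A" "s' \<in> A" "s \<in> carrier Q" "s' \<in> carrier Q"
        using s(1) s'(1) A_sub by (auto simp: nonzerodivisors_iff)
      have "j (s' \<odot>\<^bsub>M\<^esub> x \<oplus>\<^bsub>M\<^esub> s \<odot>\<^bsub>M\<^esub> x') = (\<lambda>i\<in>{..<r}. s \<otimes> s' \<otimes> \<psi> (c \<oplus>\<^bsub>F\<^esub> d) i)"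
      proof
        fix i show "j (s' \<odot>\<^bsub>M\<^esub> x \<oplus>\<^bsub>M\<^esub> s \<odot>\<^bsub>M\<^esub> x') i = (\<lambda>i\<in>{..<r}. s \<otimes> s' \<otimes> \<psi> (c \<oplus>\<^bsub>F\<^esub> d) i) i"
        proof (cases "i < r")
          case True
          have cc: "\<psi> c i \<in> carrier Q" "\<psi> d i \<in> carrier Q"
            using comp[OF \<psi>_P True] add.hyps by auto
          have "j (s' \<odot>\<^bsub>M\<^esub> x \<oplus>\<^bsub>M\<^esub> s \<odot>\<^bsub>M\<^esub> x') i = s' \<otimes> (s \<otimes> \<psi> c i) \<oplus> s \<otimes> (s' \<otimes> \<psi> d i)"
            using True sA s(2) s'(2) by (simp add: j_add j_smult s(3) s'(3))
          also have "\<dots> = s \<otimes> s' \<otimes> (\<psi> c i \<oplus> \<psi> d i)" using sA cc by algebra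
          finally show ?thesis using True add.hyps by (simp add: \<psi>_add[unfolded P_def])
        qed (use sA s(2) s'(2) in \<open>simp add: j_add\<close>)
      qed
      then show ?case
        using nonzerodivisors_mult[OF s(1) s'(1)] sA(1,2) s(2) s'(2)
        by (meson M.M.a_closed M.smult_closed)
    next
      case (smult a p)
      obtain x q where p: "p = (x, q)" "x \<in> carrier M" "q \<in> carrier Q" using smult S_def by auto
      obtain s where s: "s \<in> nonzerodivisors R" "s \<otimes> q \<in> A" using denominator[OF p(3)] by blast
      have sA: "s \<in> A" "s \<in> carrier Q" "a \<in> carrier Q" "s \<otimes> q \<in> carrier Q"
        using s smult(1) A_sub by (auto simp: nonzerodivisors_iff)
      \<comment> \<open>The fraction is moved across the tensor sign:
        \<open>s a (x \<otimes> q)\<close> equals \<open>x \<otimes> (a s q)\<close>, and since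
        \<open>a s q\<close> lies in \<open>R\<close>, this is the image of
        \<open>(a s q) x\<close>.\<close>
      have "j ((a \<otimes> (s \<otimes> q)) \<odot>\<^bsub>M\<^esub> x) = (\<lambda>i\<in>{..<r}. s \<otimes> \<psi> (a \<odot>\<^bsub>F\<^esub> e (x, q)) i)"
      proof
        fix i show "j ((a \<otimes> (s \<otimes> q)) \<odot>\<^bsub>M\<^esub> x) i = (\<lambda>i\<in>{..<r}. s \<otimes> \<psi> (a \<odot>\<^bsub>F\<^esub> e (x, q)) i) i"
        proof (cases "i < r")
          case True
          have c: "t x \<one> i \<in> carrier Q" "t x q i \<in> carrier Q"
            using comp[OF t_P True] p by auto
          have "t x (s \<otimes> q) = (\<lambda>i\<in>{..<r}. (s \<otimes> q) \<otimes> t x \<one> i)"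
            using t_smult'[of "s \<otimes> q" x \<one>] s p sA unfolding P_def by simp
          moreover have "t x (s \<otimes> q) = (\<lambda>i\<in>{..<r}. s \<otimes> t x q i)"
            using t_smult'[of s x q] sA p unfolding P_def by simp
          ultimately have *: "(s \<otimes> q) \<otimes> t x \<one> i = s \<otimes> t x q i"
            using True by (auto dest: fun_cong[where x = i])
          have "j ((a \<otimes> (s \<otimes> q)) \<odot>\<^bsub>M\<^esub> x) i = a \<otimes> (s \<otimes> q) \<otimes> t x \<one> i"
            using True s smult(1) p by (simp add: j_smult) (simp add: j_def)
          also have "\<dots> = s \<otimes> (a \<otimes> t x q i)"
            using sA c * by (simp add: m_assoc m_lcomm)
          finally show ?thesis
            using True smult(1) e p \<psi>_smult[of a "e (x, q)"] by (simp add: P_def t_def)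
        qed (use sA s smult(1) p in \<open>simp add: j_smult\<close>)
      qed
      moreover have "(a \<otimes> (s \<otimes> q)) \<odot>\<^bsub>M\<^esub> x \<in> carrier M" using s smult(1) p(2) by simp
      ultimately show ?case using s(1) p(1) by blast
    qed
  qed
  then have full: "\<exists>s\<in>nonzerodivisors R. \<exists>x\<in>carrier M. j x = (\<lambda>i\<in>{..<r}. s \<otimes> v i)"
    if "v \<in> carrier P" for v
    using \<psi>_surj[OF that] by blast
  have "\<exists>g\<in>lin_maps R P (self_module Q). \<forall>x\<in>carrier M. g (j x) = f x"
    if f: "f \<in> lin_maps R M (self_module R)" for f
  proof -
    have f_A: "f x \<in> A" if "x \<in> carrier M" for x using f that unfolding lin_maps_def by auto
    have f_add: "f (x \<oplus>\<^bsub>M\<^esub> y) = f x \<oplus> f y" if "x \<in> carrier M" "y \<in> carrier M" for x y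
      using f that unfolding lin_maps_def by auto
    have f_smult: "f (a \<odot>\<^bsub>M\<^esub> x) = a \<otimes> f x" if "a \<in> A" "x \<in> carrier M" for a x
      using f that unfolding lin_maps_def by auto
    define \<beta> where "\<beta> = (\<lambda>(x, q). f x \<otimes> q)"
    have \<beta>: "\<beta> \<in> S \<rightarrow> carrier Q" unfolding \<beta>_def S_def using f_A A_sub by auto
    define \<Lambda> where "\<Lambda> = free_extension \<beta> S"
    have \<Lambda>c: "\<Lambda> c \<in> carrier Q" if "c \<in> carrier F" for c
      unfolding \<Lambda>_def using free_extension_closed[OF \<beta>] that F_def by simp
    have \<Lambda>_add: "\<Lambda> (c \<oplus>\<^bsub>F\<^esub> d) = \<Lambda> c \<oplus> \<Lambda> d" if "c \<in> carrier F" "d \<in> carrier F" for c d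
      unfolding \<Lambda>_def F_def using free_extension_add[OF \<beta>] that F_def by simp
    have \<Lambda>_smult: "\<Lambda> (a \<odot>\<^bsub>F\<^esub> c) = a \<otimes> \<Lambda> c" if "a \<in> A" "c \<in> carrier F" for a c
      unfolding \<Lambda>_def F_def using free_extension_smult[OF \<beta>] that F_def by simp
    have \<Lambda>_minus: "\<Lambda> (c \<ominus>\<^bsub>F\<^esub> d) = \<Lambda> c \<oplus> (\<ominus> \<one>) \<otimes> \<Lambda> d" if "c \<in> carrier F" "d \<in> carrier F" for c d
      unfolding \<Lambda>_def F_def using free_extension_minus[OF \<beta>] that F_def by simp
    have \<Lambda>_e: "\<Lambda> (e (x, q)) = f x \<otimes> q" if "x \<in> carrier M" "q \<in> carrier Q" for x q
      unfolding \<Lambda>_def e_def using free_extension_generator[OF \<beta>] that unfolding S_def \<beta>_def by simp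
    have "submodule {c \<in> carrier F. \<Lambda> c = \<zero>} R F"
    proof (rule F.submoduleI)
      show "\<zero>\<^bsub>F\<^esub> \<in> {c \<in> carrier F. \<Lambda> c = \<zero>}"
        using \<Lambda>_smult[of \<zero> "\<zero>\<^bsub>F\<^esub>"] \<Lambda>c by simp
      fix a assume a: "a \<in> {c \<in> carrier F. \<Lambda> c = \<zero>}"
      have "\<zero>\<^bsub>F\<^esub> \<ominus>\<^bsub>F\<^esub> a = \<ominus>\<^bsub>F\<^esub> a" using a by (simp add: a_minus_def)
      then show "\<ominus>\<^bsub>F\<^esub> a \<in> {c \<in> carrier F. \<Lambda> c = \<zero>}"
        using \<Lambda>_minus[of "\<zero>\<^bsub>F\<^esub>" a] \<Lambda>_smult[of \<zero> "\<zero>\<^bsub>F\<^esub>"] \<Lambda>c a by simp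
    qed (use \<Lambda>_add \<Lambda>_smult A_sub in auto)
    moreover have "tensor_relations R M (self_module Q) \<subseteq> {c \<in> carrier F. \<Lambda> c = \<zero>}"
    proof -
      have neg: "y \<oplus> (\<ominus> \<one>) \<otimes> y = \<zero>" if "y \<in> carrier Q" for y
        using that by (simp add: l_minus r_neg)
      have 1: "\<Lambda> (e (x \<oplus>\<^bsub>M\<^esub> x', y) \<ominus>\<^bsub>F\<^esub> (e (x, y) \<oplus>\<^bsub>F\<^esub> e (x', y))) = \<zero>"
        if "x \<in> carrier M" "x' \<in> carrier M" "y \<in> carrier Q" for x x' y
        using that e neg[of "f x \<otimes> y \<oplus> f x' \<otimes> y"] f_A A_sub
        by (simp add: \<Lambda>_minus \<Lambda>_add \<Lambda>_e f_add l_distr)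
      have 2: "\<Lambda> (e (x, y \<oplus> y') \<ominus>\<^bsub>F\<^esub> (e (x, y) \<oplus>\<^bsub>F\<^esub> e (x, y'))) = \<zero>"
        if "x \<in> carrier M" "y \<in> carrier Q" "y' \<in> carrier Q" for x y y'
        using that e neg[of "f x \<otimes> y \<oplus> f x \<otimes> y'"] f_A A_sub
        by (simp add: \<Lambda>_minus \<Lambda>_add \<Lambda>_e r_distr)
      have 3: "\<Lambda> (e (a \<odot>\<^bsub>M\<^esub> x, y) \<ominus>\<^bsub>F\<^esub> (a \<odot>\<^bsub>F\<^esub> e (x, y))) = \<zero>"
        if "a \<in> A" "x \<in> carrier M" "y \<in> carrier Q" for a x y
        using that e neg[of "a \<otimes> (f x \<otimes> y)"] f_A A_sub
        by (simp add: \<Lambda>_minus \<Lambda>_smult \<Lambda>_e f_smult m_assoc)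
      have 4: "\<Lambda> (e (x, a \<otimes> y) \<ominus>\<^bsub>F\<^esub> (a \<odot>\<^bsub>F\<^esub> e (x, y))) = \<zero>"
        if "a \<in> A" "x \<in> carrier M" "y \<in> carrier Q" for a x y
        using that e neg[of "a \<otimes> (f x \<otimes> y)"] f_A A_sub
        by (simp add: \<Lambda>_minus \<Lambda>_smult \<Lambda>_e m_lcomm)
      have "\<Lambda> w = \<zero>" if "w \<in> tensor_relations R M (self_module Q)" for w
        using that unfolding rel by (elim UnE CollectE exE conjE) (simp_all only: 1 2 3 4)
      then show ?thesis using rel_F by blast
    qed
    ultimately have K\<Lambda>: "K \<subseteq> {c \<in> carrier F. \<Lambda> c = \<zero>}"
      unfolding K_def module_span_def by blast
    have \<Lambda>_well: "\<Lambda> c = \<Lambda> d" if cd: "c \<in> carrier F" "d \<in> carrier F" "\<psi> c = \<psi> d" for c d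
    proof -
      have "\<Lambda> c \<oplus> (\<ominus> \<one>) \<otimes> \<Lambda> d = \<zero>" using K\<Lambda> \<psi>_eq[OF cd(1,2)] cd \<Lambda>_minus by auto
      then have "\<Lambda> c \<ominus> \<Lambda> d = \<zero>" using \<Lambda>c cd by (simp add: a_minus_def l_minus)
      then show ?thesis using \<Lambda>c cd by (simp add: r_right_minus_eq)
    qed
    \<comment> \<open>Since \<open>\<psi>\<close> is surjective and \<open>\<Lambda>\<close> is
      constant on its fibres by \<open>\<Lambda>_well\<close>, the value does not depend on the
      chosen preimage.\<close>
    define g where "g = (\<lambda>v\<in>carrier P. \<Lambda> (SOME c. c \<in> carrier F \<and> \<psi> c = v))"
    have g\<psi>: "g (\<psi> c) = \<Lambda> c" if c: "c \<in> carrier F" for c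
    proof -
      have "(SOME c'. c' \<in> carrier F \<and> \<psi> c' = \<psi> c) \<in> carrier F \<and>
          \<psi> (SOME c'. c' \<in> carrier F \<and> \<psi> c' = \<psi> c) = \<psi> c"
        by (rule someI[of _ c]) (use c in simp)
      then have "\<Lambda> (SOME c'. c' \<in> carrier F \<and> \<psi> c' = \<psi> c) = \<Lambda> c" using \<Lambda>_well c by blast
      then show ?thesis unfolding g_def using \<psi>_P[OF c] by simp
    qed
    have "g \<in> lin_maps R P (self_module Q)"
      unfolding lin_maps_def
    proof (intro CollectI conjI ballI)
      show "g \<in> carrier P \<rightarrow>\<^sub>E carrier (self_module Q)"
      proof (rule PiE_I)
        fix v assume "v \<in> carrier P"
        then show "g v \<in> carrier (self_module Q)" using \<psi>_surj g\<psi> \<Lambda>c by force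
      qed (simp add: g_def)
      fix u assume "u \<in> carrier P"
      then obtain c where c: "c \<in> carrier F" "u = \<psi> c" using \<psi>_surj by blast
      show "g (a \<odot>\<^bsub>P\<^esub> u) = a \<odot>\<^bsub>self_module Q\<^esub> g u" if "a \<in> A" for a
        unfolding c(2) using \<psi>_smult[OF that c(1)] g\<psi> \<Lambda>_smult[OF that c(1)] c(1) that
        by (metis F.smult_closed self_module_simps(4))
      fix v assume "v \<in> carrier P"
      then obtain d where d: "d \<in> carrier F" "v = \<psi> d" using \<psi>_surj by blast
      show "g (u \<oplus>\<^bsub>P\<^esub> v) = g u \<oplus>\<^bsub>self_module Q\<^esub> g v"
        unfolding c(2) d(2) using \<psi>_add[OF c(1) d(1)] g\<psi> \<Lambda>_add[OF c(1) d(1)] c(1) d(1)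
        by (metis F.M.a_closed self_module_simps(2))
    qed
    moreover have "g (j x) = f x" if "x \<in> carrier M" for x
      using that g\<psi>[OF e[OF that one_closed]] \<Lambda>_e[OF that one_closed] f_A[OF that] A_sub
      unfolding j_def t_def by simp
    ultimately show ?thesis by blast
  qed
  then show ?thesis
    using j_lin full unfolding P_def by (intro bexI[of _ j]) auto
qed

end

section \<open>Reflexive modules as lattices\<close>

lemma lin_mapsD:
  assumes "f \<in> lin_maps R M N"
  shows "f \<in> carrier M \<rightarrow>\<^sub>E carrier N"
    and "x \<in> carrier M \<Longrightarrow> f x \<in> carrier N"
    and "x \<in> carrier M \<Longrightarrow> y \<in> carrier M \<Longrightarrow> f (x \<oplus>\<^bsub>M\<^esub> y) = f x \<oplus>\<^bsub>N\<^esub> f y"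
    and "a \<in> carrier R \<Longrightarrow> x \<in> carrier M \<Longrightarrow> f (a \<odot>\<^bsub>M\<^esub> x) = a \<odot>\<^bsub>N\<^esub> f x"
  using assms unfolding lin_maps_def by auto

lemma lin_mapsI:
  assumes "f \<in> carrier M \<rightarrow>\<^sub>E carrier N"
    and "\<And>x y. x \<in> carrier M \<Longrightarrow> y \<in> carrier M \<Longrightarrow> f (x \<oplus>\<^bsub>M\<^esub> y) = f x \<oplus>\<^bsub>N\<^esub> f y"
    and "\<And>a x. a \<in> carrier R \<Longrightarrow> x \<in> carrier M \<Longrightarrow> f (a \<odot>\<^bsub>M\<^esub> x) = a \<odot>\<^bsub>N\<^esub> f x"
  shows "f \<in> lin_maps R M N"
  using assms unfolding lin_maps_def by auto

lemma Hom_module_simps [simp]: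
  "carrier (Hom_module R M N) = lin_maps R M N"
  "ring.add (Hom_module R M N) = (\<lambda>f g. \<lambda>x\<in>carrier M. f x \<oplus>\<^bsub>N\<^esub> g x)"
  "smult (Hom_module R M N) = (\<lambda>a f. \<lambda>x\<in>carrier M. a \<odot>\<^bsub>N\<^esub> f x)"
  by (simp_all add: Hom_module_def)

lemma lin_maps_closed:
  assumes M: "module R M" and N: "module R N"
    and f: "f \<in> lin_maps R M N" and g: "g \<in> lin_maps R M N" and a: "a \<in> carrier R"
  shows "(\<lambda>x\<in>carrier M. f x \<oplus>\<^bsub>N\<^esub> g x) \<in> lin_maps R M N"
    and "(\<lambda>x\<in>carrier M. a \<odot>\<^bsub>N\<^esub> f x) \<in> lin_maps R M N"
proof -
  interpret M: module R M by fact
  interpret N: module R N by fact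
  note fg = lin_mapsD(2-4)[OF f] lin_mapsD(2-4)[OF g]
  show "(\<lambda>x\<in>carrier M. f x \<oplus>\<^bsub>N\<^esub> g x) \<in> lin_maps R M N"
    by (rule lin_mapsI) (use fg in \<open>auto simp: N.M.a_ac N.smult_r_distr\<close>)
  show "(\<lambda>x\<in>carrier M. a \<odot>\<^bsub>N\<^esub> f x) \<in> lin_maps R M N"
    by (rule lin_mapsI) (use fg a in \<open>auto simp: N.smult_r_distr N.smult_assoc1[symmetric] M.R.m_comm\<close>)
qed

lemma self_module_module: "cring R \<Longrightarrow> module R (self_module R)"
proof -
  assume "cring R"
  then interpret cring R .
  show ?thesis
  proof (rule moduleI)
    show "abelian_group (self_module R)"
    proof (rule abelian_groupI)
      show "\<exists>y\<in>carrier (self_module R). y \<oplus>\<^bsub>self_module R\<^esub> x = \<zero>\<^bsub>self_module R\<^esub>"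
        if "x \<in> carrier (self_module R)" for x
        using that by (intro bexI[of _ "\<ominus>\<^bsub>R\<^esub> x"]) (auto simp: l_neg)
    qed (auto simp: a_ac)
  qed (auto simp: is_cring l_distr r_distr m_assoc)
qed

section \<open>Lattices cut out by functionals\<close>

context fraction_pair
begin

text \<open>For a denominator \<open>s\<close> of \<open>q\<close>, linearity over \<open>R\<close>
  gives \<open>s g(q v) = g(s q v) = s q g(v)\<close>, and \<open>s\<close> can be cancelled in
  \<open>Q\<close>.\<close>

lemma lin_maps_Q_linear:
  assumes g: "g \<in> lin_maps R (power_module (self_module Q) r) (self_module Q)"
    and v: "v \<in> {..<r} \<rightarrow>\<^sub>E carrier Q" and q: "q \<in> carrier Q"
  shows "g (\<lambda>i\<in>{..<r}. q \<otimes> v i) = q \<otimes> g v"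
proof -
  obtain s where s: "s \<in> nonzerodivisors R" "s \<otimes> q \<in> A" using denominator[OF q] by blast
  have su: "s \<in> A" "s \<in> Units Q" "s \<in> carrier Q"
    using s(1) A_sub by (auto simp: nonzerodivisors_iff)
  have vc: "v i \<in> carrier Q" if "i < r" for i using PiE_mem[OF v] that by simp
  have qv: "(\<lambda>i\<in>{..<r}. q \<otimes> v i) \<in> {..<r} \<rightarrow>\<^sub>E carrier Q" using vc q by (intro PiE_I) auto
  have gc: "g u \<in> carrier Q" if "u \<in> {..<r} \<rightarrow>\<^sub>E carrier Q" for u
    using lin_mapsD(2)[OF g] that by simp
  have gs: "g (\<lambda>i\<in>{..<r}. a \<otimes> u i) = a \<otimes> g u" if "a \<in> A" "u \<in> {..<r} \<rightarrow>\<^sub>E carrier Q" for a u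
    using lin_mapsD(4)[OF g that(1), of u] that(2) by simp
  have "s \<otimes> g (\<lambda>i\<in>{..<r}. q \<otimes> v i) = g (\<lambda>i\<in>{..<r}. s \<otimes> (\<lambda>i\<in>{..<r}. q \<otimes> v i) i)"
    by (rule gs[OF su(1) qv, symmetric])
  also have "(\<lambda>i\<in>{..<r}. s \<otimes> (\<lambda>i\<in>{..<r}. q \<otimes> v i) i) = (\<lambda>i\<in>{..<r}. s \<otimes> q \<otimes> v i)"
    using su q vc by (intro restrict_ext) (simp add: m_assoc)
  also have "g \<dots> = s \<otimes> q \<otimes> g v" by (rule gs[OF s(2) v])
  also have "\<dots> = s \<otimes> (q \<otimes> g v)" using su q gc[OF v] by (simp add: m_assoc)
  finally show ?thesis
    by (rule iffD1[OF Units_l_cancel[OF su(2) gc[OF qv] m_closed[OF q gc[OF v]]]])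
qed

text \<open>Functionals separate the points of a reflexive module and factor through
  \<open>j\<close>, so \<open>j\<close> is injective. For the last claim, a vector \<open>v\<close>
  at which every functional that is \<open>R\<close>-valued on the lattice takes a value in
  \<open>R\<close> defines an element of the bidual. Reflexivity makes it the evaluation at some
  \<open>x\<close>, and then \<open>v = j x\<close>.\<close>

lemma reflexive_lattice:
  fixes M :: "('a, 'm, 'd) module_scheme"
  assumes M: "module R M" and refl: "reflexive_module R M" and rank: "has_rank R Q M r"
  shows "\<exists>j\<in>lin_maps R M (power_module (self_module Q) r). inj_on j (carrier M) \<and>
    (\<forall>v\<in>{..<r} \<rightarrow>\<^sub>E carrier Q. \<exists>s\<in>nonzerodivisors R. (\<lambda>i\<in>{..<r}. s \<otimes> v i) \<in> j ` carrier M) \<and>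
    (\<forall>v\<in>{..<r} \<rightarrow>\<^sub>E carrier Q.
      (\<forall>g\<in>lin_maps R (power_module (self_module Q) r) (self_module Q).
        (\<forall>x\<in>carrier M. g (j x) \<in> A) \<longrightarrow> g v \<in> A) \<longrightarrow> v \<in> j ` carrier M)"
proof -
  interpret M: module R M by fact
  define P where "P = power_module (self_module Q) r"
  obtain j where j: "j \<in> lin_maps R M P"
    and full: "\<And>v. v \<in> {..<r} \<rightarrow>\<^sub>E carrier Q \<Longrightarrow>
      \<exists>s\<in>nonzerodivisors R. \<exists>x\<in>carrier M. j x = (\<lambda>i\<in>{..<r}. s \<otimes> v i)"
    and ext: "\<And>f. f \<in> lin_maps R M (self_module R) \<Longrightarrow>
      \<exists>g\<in>lin_maps R P (self_module Q). \<forall>x\<in>carrier M. g (j x) = f x"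
    using tensor_rank_embedding[OF M rank] unfolding P_def by blast
  let ?D = "lin_maps R M (self_module R)"
  have D_eq: "x = y" if "x \<in> carrier M" "y \<in> carrier M" "\<And>f. f \<in> ?D \<Longrightarrow> f x = f y" for x y
  proof -
    have "bidual_map R M x = bidual_map R M y"
      using that unfolding bidual_map_def by (auto simp: fun_eq_iff)
    moreover have "inj_on (bidual_map R M) (carrier M)"
      using refl unfolding reflexive_module_def module_isos_def bij_betw_def by blast
    ultimately show ?thesis using that(1,2) by (simp add: inj_on_eq_iff)
  qed
  have jP: "j x \<in> {..<r} \<rightarrow>\<^sub>E carrier Q" if "x \<in> carrier M" for x
    using lin_mapsD(2)[OF j that] unfolding P_def by simp
  have inj: "inj_on j (carrier M)"
  proof (rule inj_onI)
    fix x y assume xy: "x \<in> carrier M" "y \<in> carrier M" "j x = j y"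
    have "f x = f y" if "f \<in> ?D" for f
      using ext[OF that] xy by metis
    then show "x = y" using D_eq xy by blast
  qed
  have refl_L: "v \<in> j ` carrier M"
    if v: "v \<in> {..<r} \<rightarrow>\<^sub>E carrier Q"
      and gv: "\<And>g. g \<in> lin_maps R P (self_module Q) \<Longrightarrow> \<forall>x\<in>carrier M. g (j x) \<in> A \<Longrightarrow> g v \<in> A" for v
  proof -
    obtain s x' where s: "s \<in> nonzerodivisors R" and x': "x' \<in> carrier M"
      and jx': "j x' = (\<lambda>i\<in>{..<r}. s \<otimes> v i)"
      using full[OF v] by blast
    have su: "s \<in> A" "s \<in> Units Q" "s \<in> carrier Q"
      using s A_sub by (auto simp: nonzerodivisors_iff)
    \<comment> \<open>The extension \<open>G f\<close> is chosen arbitrarily, but its value at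
      \<open>v\<close> is forced: \<open>s v = j x'\<close> gives \<open>s (G f v) = f x'\<close>.
      This is what makes \<open>f \<mapsto> G f v\<close> linear.\<close>
    obtain G where G: "\<And>f. f \<in> ?D \<Longrightarrow> G f \<in> lin_maps R P (self_module Q)"
      "\<And>f x. f \<in> ?D \<Longrightarrow> x \<in> carrier M \<Longrightarrow> G f (j x) = f x"
      using ext by metis
    have fx: "f x \<in> A" if "f \<in> ?D" "x \<in> carrier M" for f x
      using lin_mapsD(2)[OF that] by simp
    have G_A: "G f v \<in> A" if "f \<in> ?D" for f
      using gv[OF G(1)[OF that]] G(2)[OF that] fx that by simp
    have G_val: "s \<otimes> G f v = f x'" if "f \<in> ?D" for f
      using lin_mapsD(4)[OF G(1)[OF that] su(1), of v] v G(2)[OF that x'] jx' unfolding P_def by simp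
    have G_eq: "G f v = y" if "f \<in> ?D" "y \<in> carrier Q" "f x' = s \<otimes> y" for f y
      using Units_l_cancel[OF su(2), of "G f v" y] G_val[OF that(1)] G_A[OF that(1)] A_sub that by simp
    have Rm: "module R (self_module R)" using R_cring by (rule self_module_module)
    note D_closed = lin_maps_closed[OF M Rm]
    have "(\<lambda>f\<in>?D. G f v) \<in> lin_maps R (Hom_module R M (self_module R)) (self_module R)"
    proof (rule lin_mapsI)
      show "(\<lambda>f\<in>?D. G f v) \<in> carrier (Hom_module R M (self_module R)) \<rightarrow>\<^sub>E carrier (self_module R)"
        using G_A by auto
      fix f assume "f \<in> carrier (Hom_module R M (self_module R))"
      then have f: "f \<in> ?D" by simp
      show "(\<lambda>f\<in>?D. G f v) (a \<odot>\<^bsub>Hom_module R M (self_module R)\<^esub> f)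
          = a \<odot>\<^bsub>self_module R\<^esub> (\<lambda>f\<in>?D. G f v) f" if a: "a \<in> A" for a
      proof -
        have af: "(\<lambda>x\<in>carrier M. a \<odot>\<^bsub>self_module R\<^esub> f x) \<in> ?D" by (rule D_closed(2)[OF f f a])
        have "(\<lambda>x\<in>carrier M. a \<odot>\<^bsub>self_module R\<^esub> f x) x' = s \<otimes> (a \<otimes> G f v)"
          using G_val[OF f, symmetric] x' su a A_sub G_A[OF f] by (simp add: m_lcomm)
        then have "G (\<lambda>x\<in>carrier M. a \<odot>\<^bsub>self_module R\<^esub> f x) v = a \<otimes> G f v"
          using G_eq[OF af, of "a \<otimes> G f v"] a A_sub G_A[OF f] by simp
        then show ?thesis using f af by simp
      qed
      fix h assume "h \<in> carrier (Hom_module R M (self_module R))"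
      then have h: "h \<in> ?D" by simp
      have fh: "(\<lambda>x\<in>carrier M. f x \<oplus>\<^bsub>self_module R\<^esub> h x) \<in> ?D"
        by (rule D_closed(1)[OF f h su(1)])
      have "(\<lambda>x\<in>carrier M. f x \<oplus>\<^bsub>self_module R\<^esub> h x) x' = s \<otimes> (G f v \<oplus> G h v)"
        using G_val[OF f, symmetric] G_val[OF h, symmetric] x' su A_sub G_A[OF f] G_A[OF h]
        by (simp add: r_distr)
      then have "G (\<lambda>x\<in>carrier M. f x \<oplus>\<^bsub>self_module R\<^esub> h x) v = G f v \<oplus> G h v"
        using G_eq[OF fh, of "G f v \<oplus> G h v"] A_sub G_A[OF f] G_A[OF h] by simp
      then show "(\<lambda>f\<in>?D. G f v) (f \<oplus>\<^bsub>Hom_module R M (self_module R)\<^esub> h)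
          = (\<lambda>f\<in>?D. G f v) f \<oplus>\<^bsub>self_module R\<^esub> (\<lambda>f\<in>?D. G f v) h"
        using f h fh by simp
    qed
    moreover have "bidual_map R M ` carrier M
        = lin_maps R (Hom_module R M (self_module R)) (self_module R)"
      using refl unfolding reflexive_module_def module_isos_def bij_betw_def by simp
    ultimately obtain x where x: "x \<in> carrier M" "bidual_map R M x = (\<lambda>f\<in>?D. G f v)"
      by (metis (no_types, lifting) imageE)
    have x_val: "f x = G f v" if "f \<in> ?D" for f
      using fun_cong[OF x(2), of f] that x(1) unfolding bidual_map_def by simp
    \<comment> \<open>Every functional \<open>f\<close> takes the value \<open>s (G f v)\<close> on
      both sides. Applying \<open>j\<close> and cancelling \<open>s\<close> coordinatewise then
      identifies \<open>v\<close> with \<open>j x\<close>.\<close>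
    have "x' = s \<odot>\<^bsub>M\<^esub> x"
    proof (rule D_eq)
      fix f assume f: "f \<in> ?D"
      show "f x' = f (s \<odot>\<^bsub>M\<^esub> x)"
        using lin_mapsD(4)[OF f su(1) x(1)] G_val[OF f] x_val[OF f] by simp
    qed (use x x' su in auto)
    then have sv: "(\<lambda>i\<in>{..<r}. s \<otimes> v i) = (\<lambda>i\<in>{..<r}. s \<otimes> j x i)"
      using lin_mapsD(4)[OF j su(1) x(1)] jx' unfolding P_def by simp
    have "v = j x"
    proof (rule PiE_ext[OF v jP[OF x(1)]])
      fix i assume i: "i \<in> {..<r}"
      have "s \<otimes> v i = s \<otimes> j x i" using fun_cong[OF sv, of i] i by simp
      then show "v i = j x i"
        using Units_l_cancel[OF su(2)] PiE_mem[OF v i] PiE_mem[OF jP[OF x(1)] i] by simp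
    qed
    then show ?thesis using x(1) by blast
  qed
  have "\<exists>s\<in>nonzerodivisors R. (\<lambda>i\<in>{..<r}. s \<otimes> v i) \<in> j ` carrier M"
    if "v \<in> {..<r} \<rightarrow>\<^sub>E carrier Q" for v
    using full[OF that] by (metis imageI)
  then show ?thesis
    using j inj refl_L unfolding P_def by (intro bexI[of _ j] conjI ballI impI) blast+
qed

text \<open>The coordinates of the images of finitely many generators have a common denominator
  \<open>d\<close>, and the elements whose coordinates \<open>d\<close> clears form a
  submodule.\<close>

lemma fin_gen_bounded:
  assumes "module R M" "fin_gen_module R M" and j: "j \<in> lin_maps R M (power_module (self_module Q) r)"
  shows "\<exists>d\<in>nonzerodivisors R. \<forall>x\<in>carrier M. \<forall>i<r. d \<otimes> j x i \<in> A"
proof -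
  interpret M: module R M by fact
  obtain B where B: "finite B" "B \<subseteq> carrier M" "module_span R M B = carrier M"
    using assms(2) unfolding fin_gen_module_def by blast
  have jc: "j x i \<in> carrier Q" if "x \<in> carrier M" "i < r" for x i
    using lin_mapsD(2)[OF j that(1)] that(2) by auto
  have fin: "finite ((\<lambda>(x, i). j x i) ` (B \<times> {..<r}))" using B(1) by simp
  have sub: "(\<lambda>(x, i). j x i) ` (B \<times> {..<r}) \<subseteq> carrier Q" using jc B(2) by auto
  obtain d where d: "d \<in> nonzerodivisors R"
    "\<And>b. b \<in> (\<lambda>(x, i). j x i) ` (B \<times> {..<r}) \<Longrightarrow> d \<otimes> b \<in> A"
    using common_denominator[OF fin sub] by blast
  have dc: "d \<in> A" "d \<in> carrier Q" using d(1) A_sub by (auto simp: nonzerodivisors_iff)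
  define Y where "Y = {x \<in> carrier M. \<forall>i<r. d \<otimes> j x i \<in> A}"
  have smult: "a \<odot>\<^bsub>M\<^esub> x \<in> Y" if ax: "a \<in> A" "x \<in> Y" for a x
  proof -
    have "d \<otimes> j (a \<odot>\<^bsub>M\<^esub> x) i = a \<otimes> (d \<otimes> j x i)" if "i < r" for i
      using lin_mapsD(4)[OF j ax(1), of x] ax jc[of x i] A_sub dc that Y_def by (simp add: m_lcomm)
    then show ?thesis using ax unfolding Y_def by simp
  qed
  have "submodule Y R M"
  proof (rule M.submoduleI)
    show "Y \<subseteq> carrier M" unfolding Y_def by blast
    have "j \<zero>\<^bsub>M\<^esub> i = \<zero>" if "i < r" for i
      using lin_mapsD(4)[OF j, of \<zero> "\<zero>\<^bsub>M\<^esub>"] jc[of "\<zero>\<^bsub>M\<^esub>" i] that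
      by (simp, metis (no_types, lifting) l_null lessThan_iff restrict_apply')
    then show "\<zero>\<^bsub>M\<^esub> \<in> Y" unfolding Y_def using dc by simp
    show "\<ominus>\<^bsub>M\<^esub> a \<in> Y" if "a \<in> Y" for a
    proof -
      have "\<ominus>\<^bsub>M\<^esub> a = (\<ominus>\<^bsub>R\<^esub> \<one>\<^bsub>R\<^esub>) \<odot>\<^bsub>M\<^esub> a"
        using that M.smult_l_minus[of "\<one>\<^bsub>R\<^esub>" a] M.smult_one[of a] Y_def by auto
      then show ?thesis using smult[of "\<ominus>\<^bsub>R\<^esub> \<one>\<^bsub>R\<^esub>" a] that by (simp add: R_minus)
    qed
    show "a \<oplus>\<^bsub>M\<^esub> b \<in> Y" if "a \<in> Y" "b \<in> Y" for a b
      using that lin_mapsD(3)[OF j, of a b] jc dc unfolding Y_def by (auto simp: r_distr)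
  qed (rule smult)
  moreover have "B \<subseteq> Y" unfolding Y_def using B(2) d(2) by auto
  ultimately have "carrier M \<subseteq> Y" using B(3) unfolding module_span_def by blast
  then show ?thesis using d(1) unfolding Y_def by blast
qed

text \<open>Multiplication by \<open>\<alpha>\<close> is a functional on \<open>C\<close> whose
  value at one is \<open>\<alpha>\<close> itself; the inverse of \<open>\<theta>\<close> transports
  it to \<open>W\<close>.\<close>

lemma colon_subset_trace:
  fixes W :: "('a, 'w, 'd) module_scheme"
  assumes C: "submodule C R (self_module Q)" "\<one> \<in> C"
    and \<theta>: "\<theta> \<in> module_isos R ((self_module Q)\<lparr>carrier := C\<rparr>) W"
  shows "frac_colon Q A C \<subseteq> trace_ideal R W"
proof
  fix \<alpha> assume "\<alpha> \<in> frac_colon Q A C"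
  then have \<alpha>: "\<alpha> \<in> carrier Q" "\<And>c. c \<in> C \<Longrightarrow> \<alpha> \<otimes> c \<in> A" unfolding frac_colon_def by auto
  have \<theta>_lin: "\<theta> \<in> lin_maps R ((self_module Q)\<lparr>carrier := C\<rparr>) W"
    and bij: "bij_betw \<theta> C (carrier W)"
    using \<theta> unfolding module_isos_def by auto
  define \<eta> where "\<eta> = inv_into C \<theta>"
  have \<eta>: "\<eta> w \<in> C" "\<theta> (\<eta> w) = w" if "w \<in> carrier W" for w
    using that bij unfolding \<eta>_def bij_betw_def by (auto intro: inv_into_into f_inv_into_f)
  have \<eta>\<theta>: "\<eta> (\<theta> c) = c" if "c \<in> C" for c
    using that bij unfolding \<eta>_def bij_betw_def by simp
  interpret C: submodule C R "self_module Q" by fact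
  have C_sub: "c \<in> carrier Q" if "c \<in> C" for c using C.subset that by auto
  have C_add: "c \<oplus> c' \<in> C" if "c \<in> C" "c' \<in> C" for c c' using C.m_closed that by simp
  have C_smult: "a \<otimes> c \<in> C" if "a \<in> A" "c \<in> C" for a c using C.smult_closed that by simp
  define f where "f = (\<lambda>w\<in>carrier W. \<alpha> \<otimes> \<eta> w)"
  have "f \<in> lin_maps R W (self_module R)"
  proof (rule lin_mapsI)
    show "f \<in> carrier W \<rightarrow>\<^sub>E carrier (self_module R)"
      unfolding f_def using \<alpha>(2) \<eta>(1) by auto
    fix w assume w: "w \<in> carrier W"
    show "f (a \<odot>\<^bsub>W\<^esub> w) = a \<odot>\<^bsub>self_module R\<^esub> f w" if a: "a \<in> A" for a
    proof -
      have "\<theta> (a \<otimes> \<eta> w) = a \<odot>\<^bsub>W\<^esub> w"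
        using lin_mapsD(4)[OF \<theta>_lin a, of "\<eta> w"] \<eta>[OF w] by simp
      then have "a \<odot>\<^bsub>W\<^esub> w \<in> carrier W" "\<eta> (a \<odot>\<^bsub>W\<^esub> w) = a \<otimes> \<eta> w"
        using C_smult[OF a \<eta>(1)[OF w]] bij_betwE[OF bij] \<eta>\<theta> by metis+
      then show ?thesis
        unfolding f_def using w \<alpha>(1) a A_sub C_sub[OF \<eta>(1)[OF w]] by (simp add: m_lcomm)
    qed
    fix w' assume w': "w' \<in> carrier W"
    have "\<theta> (\<eta> w \<oplus> \<eta> w') = w \<oplus>\<^bsub>W\<^esub> w'"
      using lin_mapsD(3)[OF \<theta>_lin, of "\<eta> w" "\<eta> w'"] \<eta>[OF w] \<eta>[OF w'] by simp
    then have "w \<oplus>\<^bsub>W\<^esub> w' \<in> carrier W" "\<eta> (w \<oplus>\<^bsub>W\<^esub> w') = \<eta> w \<oplus> \<eta> w'"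
      using C_add[OF \<eta>(1)[OF w] \<eta>(1)[OF w']] bij_betwE[OF bij] \<eta>\<theta> by metis+
    then show "f (w \<oplus>\<^bsub>W\<^esub> w') = f w \<oplus>\<^bsub>self_module R\<^esub> f w'"
      unfolding f_def using w w' \<alpha>(1) C_sub[OF \<eta>(1)[OF w]] C_sub[OF \<eta>(1)[OF w']]
      by (simp add: r_distr)
  qed
  moreover have "f (\<theta> \<one>) = \<alpha>" "\<theta> \<one> \<in> carrier W"
    using bij_betwE[OF bij] C(2) \<eta>\<theta>[OF C(2)] \<alpha>(1) unfolding f_def by auto
  ultimately have "\<alpha> \<in> (\<Union>f\<in>lin_maps R W (self_module R). f ` carrier W)" by blast
  moreover have "(\<Union>f\<in>lin_maps R W (self_module R). f ` carrier W) \<subseteq> A"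
    using lin_mapsD(2)[where N = "self_module R"] by fastforce
  ultimately show "\<alpha> \<in> trace_ideal R W"
    using ring.genideal_self[of R] R_cring cring.axioms(1) unfolding trace_ideal_def by blast
qed

end

section \<open>Homomorphisms from the canonical module\<close>

context finite_local_normalization
begin

text \<open>An \<open>R\<close>-linear map from \<open>C\<close> to a lattice in \<open>Q^r\<close>
  is multiplication by the vector it assigns to one, as denominators can be cleared and cancelled.
  This makes evaluation at \<open>\<theta> \<one>\<close> an isomorphism onto \<open>H\<close>, to
  which \<open>lattice_free\<close> applies.\<close>

lemma Hom_canonical_free:
  fixes M :: "('a, 'm, 'd) module_scheme" and W :: "('a, 'w, 'e) module_scheme"
  assumes C: "submodule C R (self_module Q)" "A \<subseteq> C" "C \<subseteq> V"
    and iso: "isomorphic_modules R ((self_module Q)\<lparr>carrier := C\<rparr>) W"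
    and trace: "trace_ideal R W \<subseteq> frac_colon Q A V"
    and W: "module R W"
    and M: "module R M" "fin_gen_module R M" "reflexive_module R M" "has_rank R Q M r"
  shows "isomorphic_modules R (Hom_module R W M) (power_module (self_module N) r)"
proof -
  interpret M: module R M by fact
  interpret C: submodule C R "self_module Q" by fact
  define P where "P = power_module (self_module Q) r"
  obtain \<theta> where \<theta>: "\<theta> \<in> module_isos R ((self_module Q)\<lparr>carrier := C\<rparr>) W"
    using iso unfolding isomorphic_modules_def by blast
  then have \<theta>_lin: "\<theta> \<in> lin_maps R ((self_module Q)\<lparr>carrier := C\<rparr>) W"
    and \<theta>_bij: "bij_betw \<theta> C (carrier W)"
    unfolding module_isos_def by auto
  have C_one: "\<one> \<in> C" using C(2) A_closed(2) by blast
  have C_sub: "c \<in> carrier Q" if "c \<in> C" for c using C(3) V_sub that by blast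
  have \<theta>W: "\<theta> c \<in> carrier W" if "c \<in> C" for c using \<theta>_bij that bij_betwE by blast
  have \<theta>_smult: "\<theta> (a \<otimes> c) = a \<odot>\<^bsub>W\<^esub> \<theta> c" if "a \<in> A" "c \<in> C" for a c
    using lin_mapsD(4)[OF \<theta>_lin that(1), of c] that(2) by simp
  have \<theta>_add: "\<theta> (c \<oplus> c') = \<theta> c \<oplus>\<^bsub>W\<^esub> \<theta> c'" if "c \<in> C" "c' \<in> C" for c c'
    using lin_mapsD(3)[OF \<theta>_lin, of c c'] that by simp
  have colon: "\<alpha> \<otimes> v \<in> A" if "\<alpha> \<in> carrier Q" "\<And>c. c \<in> C \<Longrightarrow> \<alpha> \<otimes> c \<in> A" "v \<in> V" for \<alpha> v
    using colon_subset_trace[OF C(1) C_one \<theta>] trace that unfolding frac_colon_def by blast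
  obtain j where j: "j \<in> lin_maps R M P" and j_inj: "inj_on j (carrier M)"
    and j_full: "\<forall>v\<in>{..<r} \<rightarrow>\<^sub>E carrier Q.
      \<exists>s\<in>nonzerodivisors R. (\<lambda>i\<in>{..<r}. s \<otimes> v i) \<in> j ` carrier M"
    and j_refl: "\<forall>v\<in>{..<r} \<rightarrow>\<^sub>E carrier Q.
      (\<forall>g\<in>lin_maps R P (self_module Q). (\<forall>x\<in>carrier M. g (j x) \<in> A) \<longrightarrow> g v \<in> A) \<longrightarrow>
      v \<in> j ` carrier M"
    using reflexive_lattice[OF M(1,3,4)] unfolding P_def[symmetric] by (elim bexE conjE) (rule that)
  have jP: "j x \<in> {..<r} \<rightarrow>\<^sub>E carrier Q" if "x \<in> carrier M" for x
    using lin_mapsD(2)[OF j that] unfolding P_def by simp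
  have j_add: "j (x \<oplus>\<^bsub>M\<^esub> y) = (\<lambda>i\<in>{..<r}. j x i \<oplus> j y i)" if "x \<in> carrier M" "y \<in> carrier M" for x y
    using lin_mapsD(3)[OF j that] unfolding P_def by simp
  have j_smult: "j (a \<odot>\<^bsub>M\<^esub> x) = (\<lambda>i\<in>{..<r}. a \<otimes> j x i)" if "a \<in> A" "x \<in> carrier M" for a x
    using lin_mapsD(4)[OF j that] unfolding P_def by simp
  define H where "H = {v \<in> {..<r} \<rightarrow>\<^sub>E carrier Q. \<forall>c\<in>C. (\<lambda>i\<in>{..<r}. c \<otimes> v i) \<in> j ` carrier M}"
  have HP: "v \<in> {..<r} \<rightarrow>\<^sub>E carrier Q" if "v \<in> H" for v using that H_def by blast
  have Hc: "v i \<in> carrier Q" if "v \<in> H" "i < r" for v i using PiE_mem[OF HP[OF that(1)]] that(2) by simp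
  have HC: "\<exists>x\<in>carrier M. j x = (\<lambda>i\<in>{..<r}. c \<otimes> v i)" if "v \<in> H" "c \<in> C" for v c
  proof -
    have "(\<lambda>i\<in>{..<r}. c \<otimes> v i) \<in> j ` carrier M" using that unfolding H_def by blast
    then obtain x where "x \<in> carrier M" "(\<lambda>i\<in>{..<r}. c \<otimes> v i) = j x" by (rule imageE)
    then show ?thesis by (intro bexI[of _ x]) (rule sym)
  qed
  have HI: "v \<in> H" if "v \<in> {..<r} \<rightarrow>\<^sub>E carrier Q"
    "\<And>c. c \<in> C \<Longrightarrow> (\<lambda>i\<in>{..<r}. c \<otimes> v i) \<in> j ` carrier M" for v
    using that unfolding H_def by blast
  have H_add: "(\<lambda>i\<in>{..<r}. u i \<oplus> v i) \<in> H" if u: "u \<in> H" and v: "v \<in> H" for u v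
  proof (rule HI)
    show "(\<lambda>i\<in>{..<r}. u i \<oplus> v i) \<in> {..<r} \<rightarrow>\<^sub>E carrier Q"
      using Hc[OF u] Hc[OF v] by (intro PiE_I) auto
    fix c assume c: "c \<in> C"
    obtain x y where xy: "x \<in> carrier M" "j x = (\<lambda>i\<in>{..<r}. c \<otimes> u i)"
      "y \<in> carrier M" "j y = (\<lambda>i\<in>{..<r}. c \<otimes> v i)"
      using HC[OF u c] HC[OF v c] by blast
    have "(\<lambda>i\<in>{..<r}. c \<otimes> (\<lambda>i\<in>{..<r}. u i \<oplus> v i) i) = (\<lambda>i\<in>{..<r}. j x i \<oplus> j y i)"
      using Hc[OF u] Hc[OF v] C_sub[OF c] xy(2,4) by (intro restrict_ext) (simp add: r_distr)
    also have "\<dots> = j (x \<oplus>\<^bsub>M\<^esub> y)" using j_add xy(1,3) by simp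
    finally show "(\<lambda>i\<in>{..<r}. c \<otimes> (\<lambda>i\<in>{..<r}. u i \<oplus> v i) i) \<in> j ` carrier M" using xy(1,3) by blast
  qed
  have H_smult: "(\<lambda>i\<in>{..<r}. a \<otimes> v i) \<in> H" if a: "a \<in> V" and v: "v \<in> H" for a v
  proof (rule HI)
    have ac: "a \<in> carrier Q" using a V_sub by blast
    show "(\<lambda>i\<in>{..<r}. a \<otimes> v i) \<in> {..<r} \<rightarrow>\<^sub>E carrier Q"
      using Hc[OF v] ac by (intro PiE_I) auto
    fix c assume c: "c \<in> C"
    have cc: "c \<in> carrier Q" "c \<in> V" using c C_sub C(3) by auto
    have eq: "(\<lambda>i\<in>{..<r}. c \<otimes> (\<lambda>i\<in>{..<r}. a \<otimes> v i) i) = (\<lambda>i\<in>{..<r}. c \<otimes> a \<otimes> v i)"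
      using Hc[OF v] ac cc by (intro restrict_ext) (simp add: m_assoc)
    show "(\<lambda>i\<in>{..<r}. c \<otimes> (\<lambda>i\<in>{..<r}. a \<otimes> v i) i) \<in> j ` carrier M"
      unfolding eq
    proof (rule j_refl[rule_format])
      show "(\<lambda>i\<in>{..<r}. c \<otimes> a \<otimes> v i) \<in> {..<r} \<rightarrow>\<^sub>E carrier Q"
        using Hc[OF v] ac cc by (intro PiE_I) auto
      fix g assume g: "g \<in> lin_maps R P (self_module Q)" "\<And>x. x \<in> carrier M \<Longrightarrow> g (j x) \<in> A"
      have gQ: "g (\<lambda>i\<in>{..<r}. q \<otimes> v i) = q \<otimes> g v" if "q \<in> carrier Q" for q
        using lin_maps_Q_linear[OF g(1)[unfolded P_def] HP[OF v] that] .
      have gv: "g v \<in> carrier Q" using lin_mapsD(2)[OF g(1), of v] HP[OF v] unfolding P_def by simp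
      \<comment> \<open>This is where the trace hypothesis acts. The scalar
        \<open>\<alpha> = g v\<close> satisfies \<open>\<alpha> C \<subseteq> R\<close> because
        \<open>g\<close> is \<open>R\<close>-valued on \<open>C v\<close>; hence
        \<open>\<alpha> V \<subseteq> R\<close>, and \<open>c a\<close> lies in \<open>V\<close>
        because \<open>C\<close> does.\<close>
      have "g v \<otimes> (c \<otimes> a) \<in> A"
      proof (rule colon[OF gv])
        show "c \<otimes> a \<in> V" using cc a by simp
        fix c' assume c': "c' \<in> C"
        obtain x where x: "x \<in> carrier M" "j x = (\<lambda>i\<in>{..<r}. c' \<otimes> v i)" using HC[OF v c'] by blast
        have "g (j x) = c' \<otimes> g v" unfolding x(2) by (rule gQ[OF C_sub[OF c']])
        then show "g v \<otimes> c' \<in> A" using g(2)[OF x(1)] gv C_sub[OF c'] by (simp add: m_comm)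
      qed
      then show "g (\<lambda>i\<in>{..<r}. c \<otimes> a \<otimes> v i) \<in> A"
        using gQ[of "c \<otimes> a"] cc ac gv m_comm by simp
    qed
  qed
  have H_full: "\<exists>s\<in>carrier Q. s \<noteq> \<zero> \<and> (\<lambda>i\<in>{..<r}. s \<otimes> v i) \<in> H"
    if v: "v \<in> {..<r} \<rightarrow>\<^sub>E carrier Q" for v
  proof -
    obtain c where c: "c \<in> nonzerodivisors R" "\<forall>v\<in>V. c \<otimes> v \<in> A" using conductor by blast
    obtain s where s: "s \<in> nonzerodivisors R" "(\<lambda>i\<in>{..<r}. s \<otimes> v i) \<in> j ` carrier M"
      using bspec[OF j_full v] by blast
    from s(2) obtain x where x: "x \<in> carrier M" "(\<lambda>i\<in>{..<r}. s \<otimes> v i) = j x" by (rule imageE)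
    note x = x(1) x(2)[symmetric]
    have cs: "c \<otimes> s \<in> carrier Q" "c \<otimes> s \<noteq> \<zero>" "c \<in> carrier Q" "s \<in> carrier Q"
      using c(1) s(1) nonzerodivisors_mult[OF c(1) s(1)] A_sub nonzerodivisors_eq by auto
    have vc: "v i \<in> carrier Q" if "i < r" for i using PiE_mem[OF v] that by simp
    \<comment> \<open>The factor \<open>s\<close> moves \<open>v\<close> into the lattice and the
      conductor element \<open>c\<close> absorbs \<open>C\<close>: for \<open>c'\<close> in
      \<open>C\<close> the product \<open>c c'\<close> lies in \<open>R\<close>, so multiplying by
      it stays in the lattice.\<close>
    have "(\<lambda>i\<in>{..<r}. c \<otimes> s \<otimes> v i) \<in> H"
    proof (rule HI)
      show "(\<lambda>i\<in>{..<r}. c \<otimes> s \<otimes> v i) \<in> {..<r} \<rightarrow>\<^sub>E carrier Q"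
        using vc cs(1) by (intro PiE_I) auto
      fix c' assume c': "c' \<in> C"
      have cA: "c \<otimes> c' \<in> A" using c(2) c' C(3) by blast
      have "(\<lambda>i\<in>{..<r}. c' \<otimes> (\<lambda>i\<in>{..<r}. c \<otimes> s \<otimes> v i) i) = (\<lambda>i\<in>{..<r}. c \<otimes> c' \<otimes> j x i)"
        using vc cs C_sub[OF c'] unfolding x(2) by (intro restrict_ext) (simp add: m_ac)
      also have "\<dots> = j ((c \<otimes> c') \<odot>\<^bsub>M\<^esub> x)" using j_smult[OF cA x(1)] by simp
      finally show "(\<lambda>i\<in>{..<r}. c' \<otimes> (\<lambda>i\<in>{..<r}. c \<otimes> s \<otimes> v i) i) \<in> j ` carrier M"
        using M.smult_closed[OF cA x(1)] by blast
    qed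
    then show ?thesis using cs by blast
  qed
  obtain d where d: "d \<in> nonzerodivisors R" "\<And>x i. x \<in> carrier M \<Longrightarrow> i < r \<Longrightarrow> d \<otimes> j x i \<in> A"
    using fin_gen_bounded[OF M(1,2) j[unfolded P_def]] by blast
  have dn: "d \<in> carrier Q" "d \<noteq> \<zero>" using d(1) A_sub nonzerodivisors_eq by auto
  have H_bound: "d \<otimes> u i \<in> V" if u: "u \<in> H" and i: "i < r" for u i
  proof -
    \<comment> \<open>As one lies in \<open>C\<close>, the set \<open>H\<close> is contained in the
      lattice and inherits its bound.\<close>
    obtain x where x: "x \<in> carrier M" "j x = (\<lambda>i\<in>{..<r}. \<one> \<otimes> u i)" using HC[OF u C_one] by blast
    have "j x i = u i" unfolding x(2) using Hc[OF u i] i by simp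
    then show ?thesis using A_sub_V[OF d(2)[OF x(1) i]] by simp
  qed
  have H_sub: "H \<subseteq> {..<r} \<rightarrow>\<^sub>E carrier Q" using HP by blast
  have "\<exists>\<Phi>. bij_betw \<Phi> H ({..<r} \<rightarrow>\<^sub>E V) \<and>
    (\<forall>u\<in>H. \<forall>v\<in>H. \<Phi> (\<lambda>i\<in>{..<r}. u i \<oplus> v i) = (\<lambda>i\<in>{..<r}. \<Phi> u i \<oplus> \<Phi> v i)) \<and>
    (\<forall>a\<in>V. \<forall>u\<in>H. \<Phi> (\<lambda>i\<in>{..<r}. a \<otimes> u i) = (\<lambda>i\<in>{..<r}. a \<otimes> \<Phi> u i))"
    by (rule lattice_free[OF H_sub _ _ _ dn]; (rule H_add H_smult H_full H_bound; assumption))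
  then obtain \<Phi> where \<Phi>: "bij_betw \<Phi> H ({..<r} \<rightarrow>\<^sub>E V)"
    and \<Phi>_add: "\<forall>u\<in>H. \<forall>v\<in>H. \<Phi> (\<lambda>i\<in>{..<r}. u i \<oplus> v i) = (\<lambda>i\<in>{..<r}. \<Phi> u i \<oplus> \<Phi> v i)"
    and \<Phi>_smult: "\<forall>a\<in>V. \<forall>u\<in>H. \<Phi> (\<lambda>i\<in>{..<r}. a \<otimes> u i) = (\<lambda>i\<in>{..<r}. a \<otimes> \<Phi> u i)"
    by (elim exE conjE) (rule that)
  let ?L = "lin_maps R W M"
  define \<epsilon> where "\<epsilon> = (\<lambda>h. j (h (\<theta> \<one>)))"
  have \<epsilon>_val: "j (h (\<theta> c)) = (\<lambda>i\<in>{..<r}. c \<otimes> \<epsilon> h i)" if h: "h \<in> ?L" and c: "c \<in> C" for h c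
  proof -
    have hM: "h (\<theta> c') \<in> carrier M" if "c' \<in> C" for c' using lin_mapsD(2)[OF h \<theta>W[OF that]] .
    obtain s where s: "s \<in> nonzerodivisors R" "s \<otimes> c \<in> A" using denominator[OF C_sub[OF c]] by blast
    have su: "s \<in> A" "s \<in> Units Q" "s \<in> carrier Q"
      using s(1) A_sub by (auto simp: nonzerodivisors_iff)
    \<comment> \<open>The element \<open>s c\<close> is in \<open>R\<close>, so it can be pulled out
      of \<open>h\<close> as a scalar in front of the value at \<open>\<theta> \<one>\<close>;
      cancelling \<open>s\<close> gives the value at \<open>\<theta> c\<close>.\<close>
    have "(\<lambda>i\<in>{..<r}. s \<otimes> j (h (\<theta> c)) i) = j (h (\<theta> (s \<otimes> c)))"
      using j_smult[OF su(1) hM[OF c]] lin_mapsD(4)[OF h su(1) \<theta>W[OF c]] \<theta>_smult[OF su(1) c] by simp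
    also have "\<dots> = j (h (\<theta> (s \<otimes> c \<otimes> \<one>)))" using su C_sub[OF c] by simp
    also have "\<dots> = (\<lambda>i\<in>{..<r}. s \<otimes> c \<otimes> \<epsilon> h i)"
      using j_smult[OF s(2) hM[OF C_one]] lin_mapsD(4)[OF h s(2) \<theta>W[OF C_one]] \<theta>_smult[OF s(2) C_one]
      unfolding \<epsilon>_def by simp
    finally have eq: "(\<lambda>i\<in>{..<r}. s \<otimes> j (h (\<theta> c)) i) = (\<lambda>i\<in>{..<r}. s \<otimes> c \<otimes> \<epsilon> h i)" .
    have \<epsilon>c: "\<epsilon> h i \<in> carrier Q" if "i < r" for i
      using PiE_mem[OF jP[OF hM[OF C_one]]] that unfolding \<epsilon>_def by simp
    show ?thesis
    proof (rule PiE_ext[OF jP[OF hM[OF c]]])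
      show "(\<lambda>i\<in>{..<r}. c \<otimes> \<epsilon> h i) \<in> {..<r} \<rightarrow>\<^sub>E carrier Q"
        using \<epsilon>c C_sub[OF c] by (intro PiE_I) auto
      fix i assume i: "i \<in> {..<r}"
      have jc: "j (h (\<theta> c)) i \<in> carrier Q" using PiE_mem[OF jP[OF hM[OF c]] i] .
      have "s \<otimes> j (h (\<theta> c)) i = s \<otimes> (c \<otimes> \<epsilon> h i)"
        using fun_cong[OF eq, of i] i su C_sub[OF c] \<epsilon>c[of i] by (simp add: m_assoc)
      moreover have "c \<otimes> \<epsilon> h i \<in> carrier Q" using C_sub[OF c] \<epsilon>c[of i] i by simp
      ultimately have "j (h (\<theta> c)) i = c \<otimes> \<epsilon> h i"
        using Units_l_cancel[OF su(2) jc] by blast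
      then show "j (h (\<theta> c)) i = (\<lambda>i\<in>{..<r}. c \<otimes> \<epsilon> h i) i" using i by simp
    qed
  qed
  have \<epsilon>_H: "\<epsilon> h \<in> H" if h: "h \<in> ?L" for h
  proof (rule HI)
    show "\<epsilon> h \<in> {..<r} \<rightarrow>\<^sub>E carrier Q"
      unfolding \<epsilon>_def by (rule jP[OF lin_mapsD(2)[OF h \<theta>W[OF C_one]]])
    show "(\<lambda>i\<in>{..<r}. c \<otimes> \<epsilon> h i) \<in> j ` carrier M" if "c \<in> C" for c
      unfolding \<epsilon>_val[OF h that, symmetric] using lin_mapsD(2)[OF h \<theta>W[OF that]] by blast
  qed
  have \<theta>_surj: "\<exists>c\<in>C. w = \<theta> c" if "w \<in> carrier W" for w
    using that \<theta>_bij unfolding bij_betw_def by blast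
  have \<epsilon>_inj: "inj_on \<epsilon> ?L"
  proof (rule inj_onI)
    fix h h' assume h: "h \<in> ?L" "h' \<in> ?L" "\<epsilon> h = \<epsilon> h'"
    show "h = h'"
    proof (rule PiE_ext[OF lin_mapsD(1)[OF h(1)] lin_mapsD(1)[OF h(2)]])
      fix w assume "w \<in> carrier W"
      then obtain c where c: "c \<in> C" "w = \<theta> c" using \<theta>_surj by blast
      have "j (h w) = j (h' w)" unfolding c(2) \<epsilon>_val[OF h(1) c(1)] \<epsilon>_val[OF h(2) c(1)] h(3) ..
      then show "h w = h' w"
        using inj_onD[OF j_inj] lin_mapsD(2)[OF h(1) \<open>w \<in> carrier W\<close>]
          lin_mapsD(2)[OF h(2) \<open>w \<in> carrier W\<close>] by blast
    qed
  qed
  have \<epsilon>_surj: "\<exists>h\<in>?L. \<epsilon> h = v" if v: "v \<in> H" for v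
  proof -
    define \<eta> where "\<eta> = inv_into C \<theta>"
    have \<eta>\<theta>: "\<eta> (\<theta> c) = c" if "c \<in> C" for c
      using that \<theta>_bij unfolding \<eta>_def bij_betw_def by simp
    \<comment> \<open>These are the preimages under \<open>j\<close> of the vectors
      \<open>c v\<close>. As \<open>j\<close> is injective, linearity of
      \<open>c \<mapsto> c v\<close> passes to \<open>k\<close>.\<close>
    obtain k where k: "\<And>c. c \<in> C \<Longrightarrow> k c \<in> carrier M"
      "\<And>c. c \<in> C \<Longrightarrow> j (k c) = (\<lambda>i\<in>{..<r}. c \<otimes> v i)"
      using HC[OF v] by metis
    have k_eq: "k c = x" if "c \<in> C" "x \<in> carrier M" "j x = (\<lambda>i\<in>{..<r}. c \<otimes> v i)" for c x
      using inj_onD[OF j_inj _ k(1)[OF that(1)] that(2)] k(2)[OF that(1)] that(3) by simp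
    define h where "h = (\<lambda>w\<in>carrier W. k (\<eta> w))"
    have h\<theta>: "h (\<theta> c) = k c" if "c \<in> C" for c unfolding h_def using \<theta>W \<eta>\<theta> that by simp
    have C_add: "c \<oplus> c' \<in> C" if "c \<in> C" "c' \<in> C" for c c' using C.m_closed that by simp
    have C_smult: "a \<otimes> c \<in> C" if "a \<in> A" "c \<in> C" for a c using C.smult_closed that by simp
    have "h \<in> ?L"
    proof (rule lin_mapsI)
      show "h \<in> carrier W \<rightarrow>\<^sub>E carrier M"
      proof (rule PiE_I)
        fix w assume "w \<in> carrier W"
        then obtain c where c: "c \<in> C" "w = \<theta> c" using \<theta>_surj by blast
        then show "h w \<in> carrier M" using h\<theta> k(1) by simp
      qed (simp add: h_def)
      fix w assume "w \<in> carrier W"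
      then obtain c where c: "c \<in> C" "w = \<theta> c" using \<theta>_surj by blast
      show "h (a \<odot>\<^bsub>W\<^esub> w) = a \<odot>\<^bsub>M\<^esub> h w" if a: "a \<in> A" for a
      proof -
        have "j (a \<odot>\<^bsub>M\<^esub> k c) = (\<lambda>i\<in>{..<r}. a \<otimes> c \<otimes> v i)"
          unfolding j_smult[OF a k(1)[OF c(1)]] k(2)[OF c(1)]
          using Hc[OF v] C_sub[OF c(1)] A_sub[OF a] by (intro restrict_ext) (simp add: m_assoc)
        then have "k (a \<otimes> c) = a \<odot>\<^bsub>M\<^esub> k c"
          by (rule k_eq[OF C_smult[OF a c(1)] M.smult_closed[OF a k(1)[OF c(1)]]])
        then show ?thesis
          unfolding c(2) \<theta>_smult[OF a c(1), symmetric] h\<theta>[OF c(1)] h\<theta>[OF C_smult[OF a c(1)]] .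
      qed
      fix w' assume "w' \<in> carrier W"
      then obtain c' where c': "c' \<in> C" "w' = \<theta> c'" using \<theta>_surj by blast
      have "j (k c \<oplus>\<^bsub>M\<^esub> k c') = (\<lambda>i\<in>{..<r}. (c \<oplus> c') \<otimes> v i)"
        unfolding j_add[OF k(1)[OF c(1)] k(1)[OF c'(1)]] k(2)[OF c(1)] k(2)[OF c'(1)]
        using Hc[OF v] C_sub[OF c(1)] C_sub[OF c'(1)] by (intro restrict_ext) (simp add: l_distr)
      then have "k (c \<oplus> c') = k c \<oplus>\<^bsub>M\<^esub> k c'"
        by (rule k_eq[OF C_add[OF c(1) c'(1)] M.M.a_closed[OF k(1)[OF c(1)] k(1)[OF c'(1)]]])
      then show "h (w \<oplus>\<^bsub>W\<^esub> w') = h w \<oplus>\<^bsub>M\<^esub> h w'"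
        unfolding c(2) c'(2) \<theta>_add[OF c(1) c'(1), symmetric] h\<theta>[OF c(1)] h\<theta>[OF c'(1)]
          h\<theta>[OF C_add[OF c(1) c'(1)]] .
    qed
    moreover have "\<epsilon> h = v"
    proof (rule PiE_ext[OF _ HP[OF v]])
      have \<epsilon>h: "\<epsilon> h = (\<lambda>i\<in>{..<r}. \<one> \<otimes> v i)" unfolding \<epsilon>_def h\<theta>[OF C_one] by (rule k(2)[OF C_one])
      show "\<epsilon> h \<in> {..<r} \<rightarrow>\<^sub>E carrier Q" unfolding \<epsilon>_def h\<theta>[OF C_one] by (rule jP[OF k(1)[OF C_one]])
      show "\<epsilon> h i = v i" if "i \<in> {..<r}" for i unfolding \<epsilon>h using Hc[OF v] that by simp
    qed
    ultimately show ?thesis by blast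
  qed
  have "bij_betw \<epsilon> ?L H"
    unfolding bij_betw_def using \<epsilon>_inj \<epsilon>_H \<epsilon>_surj by (intro conjI) (simp, blast)
  then have bij: "bij_betw (\<Phi> \<circ> \<epsilon>) ?L ({..<r} \<rightarrow>\<^sub>E V)"
    using \<Phi> by (rule bij_betw_trans)
  \<comment> \<open>The restriction makes the composite extensional, as \<open>lin_maps\<close>
    demands.\<close>
  define \<Theta> where "\<Theta> = (\<lambda>h\<in>?L. \<Phi> (\<epsilon> h))"
  have \<Theta>_V: "\<Phi> (\<epsilon> h) \<in> {..<r} \<rightarrow>\<^sub>E V" if "h \<in> ?L" for h
    using bij_betwE[OF \<Phi>] \<epsilon>_H[OF that] by blast
  have W_one: "\<theta> \<one> \<in> carrier W" by (rule \<theta>W[OF C_one])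
  have hM: "h (\<theta> \<one>) \<in> carrier M" if "h \<in> ?L" for h using lin_mapsD(2)[OF that W_one] .
  have "\<Theta> \<in> lin_maps R (Hom_module R W M) (power_module (self_module N) r)"
  proof (rule lin_mapsI)
    show "\<Theta> \<in> carrier (Hom_module R W M) \<rightarrow>\<^sub>E carrier (power_module (self_module N) r)"
      unfolding \<Theta>_def using \<Theta>_V by (intro PiE_I) auto
    fix h assume "h \<in> carrier (Hom_module R W M)"
    then have h: "h \<in> ?L" by simp
    show "\<Theta> (a \<odot>\<^bsub>Hom_module R W M\<^esub> h) = a \<odot>\<^bsub>power_module (self_module N) r\<^esub> \<Theta> h"
      if a: "a \<in> A" for a
    proof -
      define ah where "ah = (\<lambda>w\<in>carrier W. a \<odot>\<^bsub>M\<^esub> h w)"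
      have ah: "ah \<in> ?L" unfolding ah_def by (rule lin_maps_closed(2)[OF W M(1) h h a])
      have "\<epsilon> ah = (\<lambda>i\<in>{..<r}. a \<otimes> \<epsilon> h i)"
        unfolding \<epsilon>_def j_smult[OF a hM[OF h], symmetric] using W_one by (simp add: ah_def)
      then have "\<Phi> (\<epsilon> ah) = (\<lambda>i\<in>{..<r}. a \<otimes> \<Phi> (\<epsilon> h) i)"
        by (simp only: bspec[OF bspec[OF \<Phi>_smult A_sub_V[OF a]] \<epsilon>_H[OF h]])
      then show ?thesis using ah h unfolding \<Theta>_def by (simp add: ah_def[symmetric])
    qed
    fix h' assume "h' \<in> carrier (Hom_module R W M)"
    then have h': "h' \<in> ?L" by simp
    show "\<Theta> (h \<oplus>\<^bsub>Hom_module R W M\<^esub> h') = \<Theta> h \<oplus>\<^bsub>power_module (self_module N) r\<^esub> \<Theta> h'"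
    proof -
      define sh where "sh = (\<lambda>w\<in>carrier W. h w \<oplus>\<^bsub>M\<^esub> h' w)"
      have sh: "sh \<in> ?L" unfolding sh_def by (rule lin_maps_closed(1)[OF W M(1) h h' A_closed(1)])
      have "\<epsilon> sh = (\<lambda>i\<in>{..<r}. \<epsilon> h i \<oplus> \<epsilon> h' i)"
        unfolding \<epsilon>_def j_add[OF hM[OF h] hM[OF h'], symmetric] using W_one by (simp add: sh_def)
      then have "\<Phi> (\<epsilon> sh) = (\<lambda>i\<in>{..<r}. \<Phi> (\<epsilon> h) i \<oplus> \<Phi> (\<epsilon> h') i)"
        by (simp only: bspec[OF bspec[OF \<Phi>_add \<epsilon>_H[OF h]] \<epsilon>_H[OF h']])
      then show ?thesis using sh h h' unfolding \<Theta>_def by (simp add: sh_def[symmetric])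
    qed
  qed
  moreover have "bij_betw \<Theta> (carrier (Hom_module R W M)) (carrier (power_module (self_module N) r))"
    using bij by (simp add: \<Theta>_def bij_betw_def inj_on_def)
  ultimately show ?thesis unfolding isomorphic_modules_def module_isos_def by blast
qed

end

theorem theorem4p1:
  fixes R Q :: "'a ring"
    and W :: "('a, 'w) module"
    and M :: "('a, 'm) module"
    and C :: "'a set"
    and r :: nat
  assumes "CM_local_ring R"
    and "krull_dim R = 1"
    and "canonical_module R W"
    and "total_fraction_ring R Q"
    and "submodule C R (self_module Q)"
    and "carrier R \<subseteq> C"
    and "C \<subseteq> integral_closure_in R Q"
    and "isomorphic_modules R ((self_module Q)\<lparr>carrier := C\<rparr>) W"
    and "fin_gen_module R (self_module (normalization R Q))"
    and "local_ring (normalization R Q)"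
    and "far_flung_Gorenstein R Q W"
    and "module R M"
    and "fin_gen_module R M"
    and "reflexive_module R M"
    and "has_rank R Q M r"
    and "r > 0"
  shows "isomorphic_modules R (Hom_module R W M)
           (power_module (self_module (normalization R Q)) r)"
proof -
  \<comment> \<open>The Cohen-Macaulay condition equates the depth with the dimension, which is one;
    the nonzero depth supplies the regular element of the maximal ideal.\<close>
  have R: "local_ring R" "noetherian_ring R" "ring_depth R \<noteq> 0"
    using assms(1,2) unfolding CM_local_ring_def by auto
  interpret R: local_cring R
    using R(1) by (simp add: local_cring_def local_cring_axioms_def local_ring_def)
  have "\<one>\<^bsub>R\<^esub> \<noteq> \<zero>\<^bsub>R\<^esub>"
    using R.one_notin_max_ideal additive_subgroup.zero_closed[OF ideal.axioms(1)[OF R.max_ideal_ideal]]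
    by metis
  moreover have R_eq: "R = Q\<lparr>carrier := carrier R\<rparr>" and "cring Q"
    using assms(4) unfolding total_fraction_ring_def by blast+
  moreover have "\<one>\<^bsub>R\<^esub> = \<one>\<^bsub>Q\<^esub>" "\<zero>\<^bsub>R\<^esub> = \<zero>\<^bsub>Q\<^esub>"
    by (subst R_eq, simp)+
  ultimately have "fraction_pair Q R"
    using assms(4) unfolding fraction_pair_def fraction_pair_axioms_def by simp
  moreover have "\<exists>t\<in>max_ideal R. t \<in> nonzerodivisors R"
    by (rule R.depth_pos_nonzerodivisor[OF R(3)]) blast
  moreover have "cring (normalization R Q)" using assms(10) unfolding local_ring_def by blast
  ultimately interpret finite_local_normalization Q R
    using assms(2,9,10) R(1,2)
    by (simp add: finite_local_normalization_def finite_normalization_def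
        finite_normalization_axioms_def finite_local_normalization_axioms_def)
  show ?thesis
  proof (rule Hom_canonical_free)
    show "trace_ideal R W \<subseteq> frac_colon Q (carrier R) (integral_closure_in R Q)"
      using assms(11) unfolding far_flung_Gorenstein_def by simp
    show "module R W" using assms(3) unfolding canonical_module_def by blast
  qed (use assms in auto)
qed

end
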